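(* Let $L\to Q$ be a line bundle and $i:S\hookrightarrow Q$ an embedded submanifold, with $L_S:=i^*L$. Then the restriction $(J^1L)|_S\subset J^1L$ of the jet bundle to $S$ is a coisotropic submanifold with respect to the canonical contact (Jacobi) structure on $J^1L$. Furthermore, there is a submersion factor $\zeta:L_{J^1L}|_{(J^1L)|_S}\to L_{J^1L_S}$ covering the surjective submersion $z:(J^1L)|_S\to J^1L_S$ given by the fibre-wise quotient $J^1_qL/(D_qL_S)^{0}\cong J^1_qL_S$, $q\in S$, such that the canonical contact structure on $J^1L$ Jacobi reduces via $\zeta$ to the canonical contact structure on $J^1L_S$.
   Context: A line bundle is a real vector bundle of rank 1. A factor is a vector bundle morphism $B$ of line bundles covering a smooth map $b$ that is a linear isomorphism $B_x$ on each fibre; it is a submersion factor if $b$ is a submersion. Pull-back of sections: $(B^*s)(x)=B_x^{-1}(s(b(x)))$. $D_xL$ is the space of $\mathbb{R}$-linear $a_x:\Gamma(L)\to L_x$ with $a_x(fs)=f(x)a_x(s)+\delta(a_x)[f]s(x)$ for some $\delta(a_x)\in T_xQ$; sections of $DL$ are derivations of $\Gamma(L)$ with the commutator bracket. For a submanifold $S$, $D_qL_S$ is regarded as a subspace of $D_qL$ via $a\mapsto(s\mapsto a(s|_S))$. $\pi:J^1L=(DL)^*\otimes L\to Q$, $J^1_xL=\mathrm{Hom}(D_xL,L_x)$, $j^1_xs(a)=a(s)$, and $(D_qL_S)^{0}=\{\alpha\in J^1_qL:\alpha|_{D_qL_S}=0\}$. $L_{J^1L}:=\pi^*L\to J^1L$.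 A Jacobi structure on a line bundle $L'\to M$ is a Lie bracket on $\Gamma(L')$ that is a first-order differential operator in each argument; $\Pi^\sharp:J^1L'\to DL'$ is defined by $\Pi^\sharp(j^1s)=\{s,\cdot\}$. A submanifold $C\subset M$ is coisotropic if $\Pi^\sharp_x$ maps $\{\alpha\in J^1_xL':\alpha|_{D_xL'_C}=0\}$ into $D_xL'_C$ for all $x\in C$. The canonical Jacobi structure on $L_{J^1L}$ (that of the canonical contact structure on $J^1L$) is the unique one with $\{l_a,l_b\}=l_{[a,b]}$, $\{l_a,\pi^*s\}=\pi^*(a[s])$, $\{\pi^*s,\pi^*r\}=0$ for $a,b\in\Gamma(DL)$, $s,r\in\Gamma(L)$, where $l_a(\alpha_q)=\alpha_q(a(q))$. Reduction: given a Jacobi structure $(\Gamma(L'),\{\cdot,\cdot\})$ on $L'\to M$, a submanifold $C\subset M$ with inclusion factor $\iota:L'_C\to L'$, and a submersion factor $\zeta:L'_C\to L''$ covering a surjective submersion $C\to M''$, the Jacobi structure on $L'$ reduces to a Jacobi structure $\{\cdot,\cdot\}''$ on $L''$ via $\zeta$ if for all $s_1,s_2\in\Gamma(L'')$ and all $S_1,S_2\in\Gamma(L')$ with $\zeta^*s_k=\iota^*S_k$ ($k=1,2$) one has $\zeta^*\{s_1,s_2\}''=\iota^*\{S_1,S_2\}$. *)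

theory Defs
  imports "HOL-Analysis.Analysis"
begin

section \<open>Smooth functions on subsets of Euclidean space\<close>

text \<open>\<open>C_diff k W f\<close>: \<open>f\<close> is of class \<open>C\<^sup>k\<close> on the open set \<open>W\<close>.\<close>

primrec C_diff :: "nat \<Rightarrow> 'a::euclidean_space set \<Rightarrow> ('a \<Rightarrow> 'b::euclidean_space) \<Rightarrow> bool" where
  "C_diff 0 W f \<longleftrightarrow> continuous_on W f"
| "C_diff (Suc k) W f \<longleftrightarrow>
     (\<forall>x\<in>W. f differentiable at x) \<and> (\<forall>v. C_diff k W (\<lambda>x. frechet_derivative f (at x) v))"

text \<open>Smoothness on an arbitrary subset means local extendability to a smooth function on an
  open set. It is used for relatively open subsets of coordinate subspaces.\<close>

definition smooth_on :: "'a::euclidean_space set \<Rightarrow> ('a \<Rightarrow> 'b::euclidean_space) \<Rightarrow> bool" where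
  "smooth_on A f \<longleftrightarrow>
     (\<forall>x\<in>A. \<exists>W g. open W \<and> x \<in> W \<and> (\<forall>k. C_diff k W g) \<and> (\<forall>y\<in>A \<inter> W. g y = f y))"


section \<open>Manifolds\<close>

text \<open>A manifold of dimension \<open>n\<close> is modelled on the coordinate subspace \<open>span I\<close> of a Euclidean
  space, where \<open>I \<subseteq> Basis\<close> has \<open>n\<close> elements. This allows dimension \<open>0\<close> and lets
  submanifolds use the same ambient coordinate type. The topology is the one induced by the
  atlas.\<close>

record ('m, 'e) mfd =
  pts :: "'m set"
  model :: "'e set"
  atlas :: "('m set \<times> ('m \<Rightarrow> 'e)) set"

definition is_chart :: "('m, 'e::euclidean_space) mfd \<Rightarrow> 'm set \<times> ('m \<Rightarrow> 'e) \<Rightarrow> bool" where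
  "is_chart M = (\<lambda>(U, \<phi>). U \<subseteq> pts M \<and> inj_on \<phi> U \<and>
     openin (top_of_set (span (model M))) (\<phi> ` U))"

definition compatible ::
    "('m, 'e::euclidean_space) mfd \<Rightarrow> 'm set \<times> ('m \<Rightarrow> 'e) \<Rightarrow> 'm set \<times> ('m \<Rightarrow> 'e) \<Rightarrow> bool" where
  "compatible M = (\<lambda>(U, \<phi>) (V, \<psi>).
     openin (top_of_set (span (model M))) (\<phi> ` (U \<inter> V)) \<and>
     openin (top_of_set (span (model M))) (\<psi> ` (U \<inter> V)) \<and>
     smooth_on (\<phi> ` (U \<inter> V)) (\<psi> \<circ> inv_into U \<phi>) \<and>
     smooth_on (\<psi> ` (U \<inter> V)) (\<phi> \<circ> inv_into V \<psi>))"

definition mfd_topology :: "('m, 'e::euclidean_space) mfd \<Rightarrow> 'm topology" where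
  "mfd_topology M = topology (\<lambda>W. W \<subseteq> pts M \<and>
     (\<forall>(U, \<phi>)\<in>atlas M. openin (top_of_set (span (model M))) (\<phi> ` (W \<inter> U))))"

definition manifold :: "('m, 'e::euclidean_space) mfd \<Rightarrow> bool" where
  "manifold M \<longleftrightarrow> model M \<subseteq> Basis \<and>
     (\<forall>c\<in>atlas M. is_chart M c) \<and>
     (\<forall>c\<in>atlas M. \<forall>d\<in>atlas M. compatible M c d) \<and>
     (\<Union>c\<in>atlas M. fst c) = pts M \<and>
     Hausdorff_space (mfd_topology M) \<and> second_countable (mfd_topology M)"

text \<open>The maximal atlas.\<close>

definition charts :: "('m, 'e::euclidean_space) mfd \<Rightarrow> ('m set \<times> ('m \<Rightarrow> 'e)) set" where
  "charts M = {c. is_chart M c \<and> (\<forall>d\<in>atlas M. compatible M c d)}"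

definition smooth_fun_on :: "('m, 'e::euclidean_space) mfd \<Rightarrow> 'm set \<Rightarrow> ('m \<Rightarrow> real) \<Rightarrow> bool" where
  "smooth_fun_on M W f \<longleftrightarrow> (\<forall>(U, \<phi>)\<in>atlas M. smooth_on (\<phi> ` (U \<inter> W)) (f \<circ> inv_into U \<phi>))"

text \<open>Functions and sections are extended by \<open>0\<close> outside the manifold, so that equality of
  functions on the manifold is equality in HOL.\<close>

definition smooth_functions :: "('m, 'e::euclidean_space) mfd \<Rightarrow> ('m \<Rightarrow> real) set" where
  "smooth_functions M = {f. smooth_fun_on M (pts M) f \<and> (\<forall>x. x \<notin> pts M \<longrightarrow> f x = 0)}"

definition smooth_map ::
    "('m, 'e::euclidean_space) mfd \<Rightarrow> ('n, 'f::euclidean_space) mfd \<Rightarrow> ('m \<Rightarrow> 'n) \<Rightarrow> bool" where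
  "smooth_map M N b \<longleftrightarrow> b ` pts M \<subseteq> pts N \<and>
     continuous_map (mfd_topology M) (mfd_topology N) b \<and>
     (\<forall>(U, \<phi>)\<in>atlas M. \<forall>(V, \<psi>)\<in>atlas N. smooth_on (\<phi> ` (U \<inter> b -` V)) (\<psi> \<circ> b \<circ> inv_into U \<phi>))"

definition tangent_space :: "('m, 'e::euclidean_space) mfd \<Rightarrow> 'm \<Rightarrow> (('m \<Rightarrow> real) \<Rightarrow> real) set" where
  "tangent_space M x = {v.
     (\<forall>f. f \<notin> smooth_functions M \<longrightarrow> v f = 0) \<and>
     (\<forall>f\<in>smooth_functions M. \<forall>g\<in>smooth_functions M. v (\<lambda>y. f y + g y) = v f + v g) \<and>
     (\<forall>c. \<forall>f\<in>smooth_functions M. v (\<lambda>y. c * f y) = c * v f) \<and>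
     (\<forall>f\<in>smooth_functions M. \<forall>g\<in>smooth_functions M. v (\<lambda>y. f y * g y) = f x * v g + g x * v f)}"

definition differential ::
    "('m, 'e::euclidean_space) mfd \<Rightarrow> ('n, 'f::euclidean_space) mfd \<Rightarrow> ('m \<Rightarrow> 'n) \<Rightarrow>
      (('m \<Rightarrow> real) \<Rightarrow> real) \<Rightarrow> ('n \<Rightarrow> real) \<Rightarrow> real" where
  "differential M N b v = (\<lambda>f.
     if f \<in> smooth_functions N then v (\<lambda>y. if y \<in> pts M then f (b y) else 0) else 0)"

definition submersion ::
    "('m, 'e::euclidean_space) mfd \<Rightarrow> ('n, 'f::euclidean_space) mfd \<Rightarrow> ('m \<Rightarrow> 'n) \<Rightarrow> bool" where
  "submersion M N b \<longleftrightarrow> smooth_map M N b \<and>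
     (\<forall>x\<in>pts M. differential M N b ` tangent_space M x = tangent_space N (b x))"

text \<open>Embedded submanifolds of dimension \<open>card K\<close>, by slice charts in the maximal atlas.\<close>

definition slice_charts ::
    "('m, 'e::euclidean_space) mfd \<Rightarrow> 'e set \<Rightarrow> 'm set \<Rightarrow> ('m set \<times> ('m \<Rightarrow> 'e)) set" where
  "slice_charts M K S = {(U, \<phi>) \<in> charts M. \<phi> ` (U \<inter> S) = \<phi> ` U \<inter> span K}"

definition embedded_submanifold :: "('m, 'e::euclidean_space) mfd \<Rightarrow> 'e set \<Rightarrow> 'm set \<Rightarrow> bool" where
  "embedded_submanifold M K S \<longleftrightarrow> K \<subseteq> model M \<and> S \<subseteq> pts M \<and>
     S \<subseteq> (\<Union>c\<in>slice_charts M K S. fst c)"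

definition submfd :: "('m, 'e::euclidean_space) mfd \<Rightarrow> 'e set \<Rightarrow> 'm set \<Rightarrow> ('m, 'e) mfd" where
  "submfd M K S = \<lparr>pts = S, model = K, atlas = (\<lambda>(U, \<phi>). (U \<inter> S, \<phi>)) ` slice_charts M K S\<rparr>"


section \<open>Line bundles\<close>

text \<open>The fibres are lines in one real vector space \<open>'v\<close>, which plays no role beyond
  providing the operations of the fibres: any line bundle has this form, with \<open>'v\<close> the
  algebraic direct sum of all fibres. The smooth structure is given by local frames, that is,
  by local trivialisations.\<close>

record ('m, 'e, 'v) lbundle =
  base :: "('m, 'e) mfd"
  fibre :: "'m \<Rightarrow> 'v set"
  frames :: "('m set \<times> ('m \<Rightarrow> 'v)) set"

definition coef :: "'v::real_vector \<Rightarrow> 'v \<Rightarrow> real" where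
  "coef e v = (THE c. v = c *\<^sub>R e)"

definition line_bundle :: "('m, 'e::euclidean_space, 'v::real_vector) lbundle \<Rightarrow> bool" where
  "line_bundle L \<longleftrightarrow> manifold (base L) \<and>
     (\<forall>x\<in>pts (base L). subspace (fibre L x) \<and> dim (fibre L x) = 1) \<and>
     (\<forall>(U, e)\<in>frames L. openin (mfd_topology (base L)) U \<and>
        (\<forall>x\<in>U. e x \<in> fibre L x \<and> e x \<noteq> 0)) \<and>
     (\<Union>c\<in>frames L. fst c) = pts (base L) \<and>
     (\<forall>(U, e)\<in>frames L. \<forall>(V, e')\<in>frames L.
        smooth_fun_on (base L) (U \<inter> V) (\<lambda>x. coef (e x) (e' x)))"

definition sections :: "('m, 'e::euclidean_space, 'v::real_vector) lbundle \<Rightarrow> ('m \<Rightarrow> 'v) set" where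
  "sections L = {s. (\<forall>x\<in>pts (base L). s x \<in> fibre L x) \<and> (\<forall>x. x \<notin> pts (base L) \<longrightarrow> s x = 0) \<and>
     (\<forall>(U, e)\<in>frames L. smooth_fun_on (base L) U (\<lambda>x. coef (e x) (s x)))}"

definition pullback_bundle ::
    "('n \<Rightarrow> 'm) \<Rightarrow> ('n, 'f) mfd \<Rightarrow> ('m, 'e, 'v) lbundle \<Rightarrow> ('n, 'f, 'v) lbundle" where
  "pullback_bundle b N L = \<lparr>base = N, fibre = (\<lambda>y. fibre L (b y)),
     frames = (\<lambda>(U, e). (pts N \<inter> b -` U, e \<circ> b)) ` frames L\<rparr>"

text \<open>Pull-back along the inclusion of a submanifold.\<close>

definition restrict_bundle ::
    "('m, 'e::euclidean_space, 'v) lbundle \<Rightarrow> 'e set \<Rightarrow> 'm set \<Rightarrow> ('m, 'e, 'v) lbundle" where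
  "restrict_bundle L K S = pullback_bundle (\<lambda>x. x) (submfd (base L) K S) L"

text \<open>Restriction \<open>s|\<^sub>S\<close> of sections, which is pull-back by the inclusion factor.\<close>

definition restrict_section :: "'m set \<Rightarrow> ('m \<Rightarrow> 'v::real_vector) \<Rightarrow> 'm \<Rightarrow> 'v" where
  "restrict_section S s = (\<lambda>x. if x \<in> S then s x else 0)"

definition factor ::
    "('m, 'e::euclidean_space, 'v::real_vector) lbundle \<Rightarrow> ('n, 'f::euclidean_space, 'w::real_vector) lbundle \<Rightarrow>
      ('m \<Rightarrow> 'n) \<Rightarrow> ('m \<Rightarrow> 'v \<Rightarrow> 'w) \<Rightarrow> bool" where
  "factor L1 L2 b B \<longleftrightarrow> smooth_map (base L1) (base L2) b \<and>
     (\<forall>x\<in>pts (base L1).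
        (\<forall>u\<in>fibre L1 x. \<forall>v\<in>fibre L1 x. B x (u + v) = B x u + B x v) \<and>
        (\<forall>c. \<forall>u\<in>fibre L1 x. B x (c *\<^sub>R u) = c *\<^sub>R B x u) \<and>
        bij_betw (B x) (fibre L1 x) (fibre L2 (b x))) \<and>
     (\<forall>(U, e)\<in>frames L1. \<forall>(V, e')\<in>frames L2.
        smooth_fun_on (base L1) (U \<inter> b -` V) (\<lambda>x. coef (e' (b x)) (B x (e x))))"

definition submersion_factor ::
    "('m, 'e::euclidean_space, 'v::real_vector) lbundle \<Rightarrow> ('n, 'f::euclidean_space, 'w::real_vector) lbundle \<Rightarrow>
      ('m \<Rightarrow> 'n) \<Rightarrow> ('m \<Rightarrow> 'v \<Rightarrow> 'w) \<Rightarrow> bool" where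
  "submersion_factor L1 L2 b B \<longleftrightarrow> factor L1 L2 b B \<and> submersion (base L1) (base L2) b"

definition factor_pullback ::
    "('m, 'e, 'v::real_vector) lbundle \<Rightarrow> ('m \<Rightarrow> 'n) \<Rightarrow> ('m \<Rightarrow> 'v \<Rightarrow> 'w) \<Rightarrow>
      ('n \<Rightarrow> 'w) \<Rightarrow> 'm \<Rightarrow> 'v" where
  "factor_pullback L1 b B s =
     (\<lambda>x. if x \<in> pts (base L1) then inv_into (fibre L1 x) (B x) (s (b x)) else 0)"


section \<open>Derivations\<close>

text \<open>The fibre \<open>D\<^sub>xL\<close>. Its elements are functionals on \<open>\<Gamma>(L)\<close>, set to \<open>0\<close> elsewhere.\<close>

definition der_space ::
    "('m, 'e::euclidean_space, 'v::real_vector) lbundle \<Rightarrow> 'm \<Rightarrow> (('m \<Rightarrow> 'v) \<Rightarrow> 'v) set" where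
  "der_space L x = {a.
     (\<forall>s. s \<notin> sections L \<longrightarrow> a s = 0) \<and>
     (\<forall>s\<in>sections L. a s \<in> fibre L x) \<and>
     (\<forall>s\<in>sections L. \<forall>r\<in>sections L. a (\<lambda>y. s y + r y) = a s + a r) \<and>
     (\<forall>c. \<forall>s\<in>sections L. a (\<lambda>y. c *\<^sub>R s y) = c *\<^sub>R a s) \<and>
     (\<exists>\<delta>\<in>tangent_space (base L) x. \<forall>f\<in>smooth_functions (base L). \<forall>s\<in>sections L.
        a (\<lambda>y. f y *\<^sub>R s y) = f x *\<^sub>R a s + \<delta> f *\<^sub>R s x)}"

text \<open>\<open>\<Gamma>(DL)\<close>, as derivations of \<open>\<Gamma>(L)\<close>. The value of such an \<open>a\<close> at \<open>x\<close> is
  \<open>\<lambda>s. a s x\<close>.\<close>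

definition derivations ::
    "('m, 'e::euclidean_space, 'v::real_vector) lbundle \<Rightarrow> (('m \<Rightarrow> 'v) \<Rightarrow> 'm \<Rightarrow> 'v) set" where
  "derivations L = {a.
     (\<forall>s. s \<notin> sections L \<longrightarrow> a s = (\<lambda>x. 0)) \<and>
     (\<forall>s\<in>sections L. a s \<in> sections L) \<and>
     (\<forall>x\<in>pts (base L). (\<lambda>s. a s x) \<in> der_space L x)}"

definition commutator ::
    "(('m \<Rightarrow> 'v::real_vector) \<Rightarrow> 'm \<Rightarrow> 'v) \<Rightarrow> (('m \<Rightarrow> 'v) \<Rightarrow> 'm \<Rightarrow> 'v) \<Rightarrow> ('m \<Rightarrow> 'v) \<Rightarrow> 'm \<Rightarrow> 'v" where
  "commutator a b = (\<lambda>s x. a (b s) x - b (a s) x)"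

text \<open>\<open>D\<^sub>qL\<^sub>S\<close> as a subspace of \<open>D\<^sub>qL\<close>.\<close>

definition push_der ::
    "('m, 'e::euclidean_space, 'v::real_vector) lbundle \<Rightarrow> 'm set \<Rightarrow> (('m \<Rightarrow> 'v) \<Rightarrow> 'v) \<Rightarrow> ('m \<Rightarrow> 'v) \<Rightarrow> 'v" where
  "push_der L S a = (\<lambda>s. if s \<in> sections L then a (restrict_section S s) else 0)"

definition sub_der_space ::
    "('m, 'e::euclidean_space, 'v::real_vector) lbundle \<Rightarrow> 'e set \<Rightarrow> 'm set \<Rightarrow> 'm \<Rightarrow> (('m \<Rightarrow> 'v) \<Rightarrow> 'v) set" where
  "sub_der_space L K S x = push_der L S ` der_space (restrict_bundle L K S) x"


section \<open>The jet bundle\<close>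

type_synonym ('m, 'v) jet = "(('m \<Rightarrow> 'v) \<Rightarrow> 'v) \<Rightarrow> 'v"

definition jet_space ::
    "('m, 'e::euclidean_space, 'v::real_vector) lbundle \<Rightarrow> 'm \<Rightarrow> ('m, 'v) jet set" where
  "jet_space L x = {\<alpha>.
     (\<forall>a. a \<notin> der_space L x \<longrightarrow> \<alpha> a = 0) \<and>
     (\<forall>a\<in>der_space L x. \<alpha> a \<in> fibre L x) \<and>
     (\<forall>a\<in>der_space L x. \<forall>b\<in>der_space L x. \<alpha> (\<lambda>s. a s + b s) = \<alpha> a + \<alpha> b) \<and>
     (\<forall>c. \<forall>a\<in>der_space L x. \<alpha> (\<lambda>s. c *\<^sub>R a s) = c *\<^sub>R \<alpha> a)}"

definition jet_of ::
    "('m, 'e::euclidean_space, 'v::real_vector) lbundle \<Rightarrow> 'm \<Rightarrow> ('m \<Rightarrow> 'v) \<Rightarrow> ('m, 'v) jet" where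
  "jet_of L x s = (\<lambda>a. if a \<in> der_space L x then a s else 0)"

definition section_of_jet ::
    "('m, 'e::euclidean_space, 'v::real_vector) lbundle \<Rightarrow> 'm \<Rightarrow> ('m, 'v) jet \<Rightarrow> 'm \<Rightarrow> 'v" where
  "section_of_jet L x \<alpha> = (SOME s. s \<in> sections L \<and> jet_of L x s = \<alpha>)"

definition annihilator ::
    "('m, 'e::euclidean_space, 'v::real_vector) lbundle \<Rightarrow> 'e set \<Rightarrow> 'm set \<Rightarrow> 'm \<Rightarrow> ('m, 'v) jet set" where
  "annihilator L K S x = {\<alpha> \<in> jet_space L x. \<forall>a\<in>sub_der_space L K S x. \<alpha> a = 0}"

text \<open>The usual jet coordinates \<open>(x\<^sup>i, u, u\<^sub>i)\<close> of \<open>j\<^sup>1s\<close>, \<open>s = f e\<close>, for a chart \<open>(U, \<phi>)\<close>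
  and a frame \<open>(V, e)\<close>.\<close>

definition jet_coords ::
    "('m, 'e::euclidean_space, 'v::real_vector) lbundle \<Rightarrow> 'm set \<Rightarrow> ('m \<Rightarrow> 'e) \<Rightarrow> ('m \<Rightarrow> 'v) \<Rightarrow>
      'm \<times> ('m, 'v) jet \<Rightarrow> 'e \<times> real \<times> 'e" where
  "jet_coords L U \<phi> e = (\<lambda>(q, \<alpha>).
     let f = (\<lambda>x. coef (e x) (section_of_jet L q \<alpha> x)) \<circ> inv_into U \<phi> in
     (\<phi> q, f (\<phi> q), \<Sum>b\<in>model (base L). deriv (\<lambda>t. f (\<phi> q + t *\<^sub>R b)) 0 *\<^sub>R b))"

definition jets_over ::
    "('m, 'e::euclidean_space, 'v::real_vector) lbundle \<Rightarrow> 'm set \<Rightarrow> ('m \<times> ('m, 'v) jet) set" where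
  "jets_over L S = (SIGMA q:S. jet_space L q)"

definition jet_model :: "'e::euclidean_space set \<Rightarrow> 'e set \<Rightarrow> ('e \<times> real \<times> 'e) set" where
  "jet_model A B = (\<lambda>b. (b, 0, 0)) ` A \<union> {(0, 1, 0)} \<union> (\<lambda>b. (0, 0, b)) ` B"

definition jet_mfd ::
    "('m, 'e::euclidean_space, 'v::real_vector) lbundle \<Rightarrow> ('m \<times> ('m, 'v) jet, 'e \<times> real \<times> 'e) mfd" where
  "jet_mfd L = \<lparr>pts = jets_over L (pts (base L)),
     model = jet_model (model (base L)) (model (base L)),
     atlas = {(jets_over L (U \<inter> V), jet_coords L U \<phi> e) |U \<phi> V e.
       (U, \<phi>) \<in> charts (base L) \<and> (V, e) \<in> frames L}\<rparr>"

text \<open>\<open>L\<^bsub>J\<^sup>1L\<^esub> = \<pi>\<^sup>*L\<close>.\<close>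

definition jet_lbundle ::
    "('m, 'e::euclidean_space, 'v::real_vector) lbundle \<Rightarrow>
      ('m \<times> ('m, 'v) jet, 'e \<times> real \<times> 'e, 'v) lbundle" where
  "jet_lbundle L = pullback_bundle fst (jet_mfd L) L"

definition lift_section ::
    "('m, 'e::euclidean_space, 'v::real_vector) lbundle \<Rightarrow> ('m \<Rightarrow> 'v) \<Rightarrow> 'm \<times> ('m, 'v) jet \<Rightarrow> 'v" where
  "lift_section L s = (\<lambda>(q, \<alpha>). if (q, \<alpha>) \<in> pts (jet_mfd L) then s q else 0)"

definition linear_section ::
    "('m, 'e::euclidean_space, 'v::real_vector) lbundle \<Rightarrow> (('m \<Rightarrow> 'v) \<Rightarrow> 'm \<Rightarrow> 'v) \<Rightarrow>
      'm \<times> ('m, 'v) jet \<Rightarrow> 'v" where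
  "linear_section L a = (\<lambda>(q, \<alpha>). if (q, \<alpha>) \<in> pts (jet_mfd L) then \<alpha> (\<lambda>s. a s q) else 0)"


section \<open>Jacobi structures\<close>

text \<open>First-order differential operators \<open>\<Delta>\<close> on \<open>\<Gamma>(L)\<close>: \<open>[[\<Delta>, f], g] = 0\<close> for all smooth
  functions \<open>f\<close>, \<open>g\<close>.\<close>

definition first_order_diffop ::
    "('m, 'e::euclidean_space, 'v::real_vector) lbundle \<Rightarrow> (('m \<Rightarrow> 'v) \<Rightarrow> 'm \<Rightarrow> 'v) \<Rightarrow> bool" where
  "first_order_diffop L \<Delta> \<longleftrightarrow>
     (\<forall>s\<in>sections L. \<Delta> s \<in> sections L) \<and>
     (\<forall>s\<in>sections L. \<forall>r\<in>sections L. \<Delta> (\<lambda>x. s x + r x) = (\<lambda>x. \<Delta> s x + \<Delta> r x)) \<and>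
     (\<forall>c. \<forall>s\<in>sections L. \<Delta> (\<lambda>x. c *\<^sub>R s x) = (\<lambda>x. c *\<^sub>R \<Delta> s x)) \<and>
     (\<forall>f\<in>smooth_functions (base L). \<forall>g\<in>smooth_functions (base L). \<forall>s\<in>sections L. \<forall>x.
        \<Delta> (\<lambda>y. f y *\<^sub>R g y *\<^sub>R s y) x - f x *\<^sub>R \<Delta> (\<lambda>y. g y *\<^sub>R s y) x
        - g x *\<^sub>R \<Delta> (\<lambda>y. f y *\<^sub>R s y) x + f x *\<^sub>R g x *\<^sub>R \<Delta> s x = 0)"

text \<open>The clauses on differential operators contain bilinearity and closedness of the bracket.\<close>

definition jacobi_structure ::
    "('m, 'e::euclidean_space, 'v::real_vector) lbundle \<Rightarrow>
      (('m \<Rightarrow> 'v) \<Rightarrow> ('m \<Rightarrow> 'v) \<Rightarrow> 'm \<Rightarrow> 'v) \<Rightarrow> bool" where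
  "jacobi_structure L J \<longleftrightarrow>
     (\<forall>s\<in>sections L. first_order_diffop L (\<lambda>r. J s r) \<and> first_order_diffop L (\<lambda>r. J r s)) \<and>
     (\<forall>s\<in>sections L. \<forall>r\<in>sections L. J s r = (\<lambda>x. - J r s x)) \<and>
     (\<forall>s\<in>sections L. \<forall>r\<in>sections L. \<forall>t\<in>sections L. \<forall>x.
        J s (J r t) x + J r (J t s) x + J t (J s r) x = 0)"

definition sharp ::
    "('m, 'e::euclidean_space, 'v::real_vector) lbundle \<Rightarrow>
      (('m \<Rightarrow> 'v) \<Rightarrow> ('m \<Rightarrow> 'v) \<Rightarrow> 'm \<Rightarrow> 'v) \<Rightarrow> 'm \<Rightarrow> ('m, 'v) jet \<Rightarrow> ('m \<Rightarrow> 'v) \<Rightarrow> 'v" where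
  "sharp L J x \<alpha> = (\<lambda>r. if r \<in> sections L then J (section_of_jet L x \<alpha>) r x else 0)"

definition coisotropic ::
    "('m, 'e::euclidean_space, 'v::real_vector) lbundle \<Rightarrow>
      (('m \<Rightarrow> 'v) \<Rightarrow> ('m \<Rightarrow> 'v) \<Rightarrow> 'm \<Rightarrow> 'v) \<Rightarrow> 'e set \<Rightarrow> 'm set \<Rightarrow> bool" where
  "coisotropic L J K C \<longleftrightarrow> embedded_submanifold (base L) K C \<and>
     (\<forall>x\<in>C. sharp L J x ` annihilator L K C x \<subseteq> sub_der_space L K C x)"

text \<open>The Jacobi structure on \<open>L\<^bsub>J\<^sup>1L\<^esub>\<close> of the canonical contact structure; these conditions
  determine it uniquely.\<close>

definition canonical_jacobi ::
    "('m, 'e::euclidean_space, 'v::real_vector) lbundle \<Rightarrow>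
      (('m \<times> ('m, 'v) jet \<Rightarrow> 'v) \<Rightarrow> ('m \<times> ('m, 'v) jet \<Rightarrow> 'v) \<Rightarrow> 'm \<times> ('m, 'v) jet \<Rightarrow> 'v) \<Rightarrow> bool" where
  "canonical_jacobi L J \<longleftrightarrow> jacobi_structure (jet_lbundle L) J \<and>
     (\<forall>a\<in>derivations L. \<forall>b\<in>derivations L.
        J (linear_section L a) (linear_section L b) = linear_section L (commutator a b)) \<and>
     (\<forall>a\<in>derivations L. \<forall>s\<in>sections L.
        J (linear_section L a) (lift_section L s) = lift_section L (a s)) \<and>
     (\<forall>s\<in>sections L. \<forall>r\<in>sections L. J (lift_section L s) (lift_section L r) = (\<lambda>x. 0))"

definition jacobi_reduces ::
    "('m, 'e::euclidean_space, 'v::real_vector) lbundle \<Rightarrow>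
      (('m \<Rightarrow> 'v) \<Rightarrow> ('m \<Rightarrow> 'v) \<Rightarrow> 'm \<Rightarrow> 'v) \<Rightarrow> 'e set \<Rightarrow> 'm set \<Rightarrow>
      ('m \<Rightarrow> 'n) \<Rightarrow> ('m \<Rightarrow> 'v \<Rightarrow> 'w) \<Rightarrow>
      ('n, 'f::euclidean_space, 'w::real_vector) lbundle \<Rightarrow>
      (('n \<Rightarrow> 'w) \<Rightarrow> ('n \<Rightarrow> 'w) \<Rightarrow> 'n \<Rightarrow> 'w) \<Rightarrow> bool" where
  "jacobi_reduces L J K C z \<zeta> L'' J'' \<longleftrightarrow>
     (\<forall>s1\<in>sections L''. \<forall>s2\<in>sections L''. \<forall>S1\<in>sections L. \<forall>S2\<in>sections L.
        factor_pullback (restrict_bundle L K C) z \<zeta> s1 = restrict_section C S1 \<and>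
        factor_pullback (restrict_bundle L K C) z \<zeta> s2 = restrict_section C S2 \<longrightarrow>
        factor_pullback (restrict_bundle L K C) z \<zeta> (J'' s1 s2) = restrict_section C (J S1 S2))"


section \<open>Restriction of jets to a submanifold\<close>

text \<open>\<open>J\<^sup>1\<^sub>qL \<rightarrow> J\<^sup>1\<^sub>qL\<^sub>S\<close>, restriction of \<open>\<alpha>\<close> to \<open>D\<^sub>qL\<^sub>S\<close>.\<close>

definition jet_restrict ::
    "('m, 'e::euclidean_space, 'v::real_vector) lbundle \<Rightarrow> 'e set \<Rightarrow> 'm set \<Rightarrow> 'm \<Rightarrow>
      ('m, 'v) jet \<Rightarrow> ('m, 'v) jet" where
  "jet_restrict L K S q \<alpha> =
     (\<lambda>a. if a \<in> der_space (restrict_bundle L K S) q then \<alpha> (push_der L S a) else 0)"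

definition jet_quotient_map ::
    "('m, 'e::euclidean_space, 'v::real_vector) lbundle \<Rightarrow> 'e set \<Rightarrow> 'm set \<Rightarrow>
      'm \<times> ('m, 'v) jet \<Rightarrow> 'm \<times> ('m, 'v) jet" where
  "jet_quotient_map L K S = (\<lambda>(q, \<alpha>). (q, jet_restrict L K S q \<alpha>))"

text \<open>\<open>\<rho>\<close> is linear from \<open>J\<^sup>1\<^sub>qL\<close> onto \<open>J\<^sup>1\<^sub>qL\<^sub>S\<close> with kernel \<open>(D\<^sub>qL\<^sub>S)\<^sup>0\<close>, i.e. it induces
  \<open>J\<^sup>1\<^sub>qL / (D\<^sub>qL\<^sub>S)\<^sup>0 \<cong> J\<^sup>1\<^sub>qL\<^sub>S\<close>.\<close>

definition induces_quotient_iso ::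
    "('m, 'e::euclidean_space, 'v::real_vector) lbundle \<Rightarrow> 'e set \<Rightarrow> 'm set \<Rightarrow> 'm \<Rightarrow>
      (('m, 'v) jet \<Rightarrow> ('m, 'v) jet) \<Rightarrow> bool" where
  "induces_quotient_iso L K S q \<rho> \<longleftrightarrow>
     (\<forall>\<alpha>\<in>jet_space L q. \<forall>\<beta>\<in>jet_space L q. \<rho> (\<lambda>a. \<alpha> a + \<beta> a) = (\<lambda>a. \<rho> \<alpha> a + \<rho> \<beta> a)) \<and>
     (\<forall>c. \<forall>\<alpha>\<in>jet_space L q. \<rho> (\<lambda>a. c *\<^sub>R \<alpha> a) = (\<lambda>a. c *\<^sub>R \<rho> \<alpha> a)) \<and>
     \<rho> ` jet_space L q = jet_space (restrict_bundle L K S) q \<and>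
     {\<alpha> \<in> jet_space L q. \<rho> \<alpha> = (\<lambda>a. 0)} = annihilator L K S q"

end

theory Submission
  imports Defs
begin

text \<open>The value of a Jacobi bracket at a point depends only on the 1-jets of its arguments there: by
  Hadamard's lemma a first-order functional kills every section with vanishing 1-jet. At a point of
  \<open>J\<^sup>1L\<close> every 1-jet of a section of \<open>\<pi>\<^sup>*L\<close> is the jet of some \<open>l\<^sub>a + \<pi>\<^sup>*t\<close>, and on such sections the
  canonical bracket is given explicitly. In coordinates adapted to \<open>S\<close> the map \<open>z\<close> is a linear
  projection, and \<open>\<zeta>\<close> is the identity on fibres.

  A 1-jet annihilating the derivations tangent to \<open>C = (J\<^sup>1L)|\<^sub>S\<close> is the jet of some \<open>\<pi>\<^sup>*t\<close>. Brackets of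
  pulled back sections vanish, and \<open>C\<close> is cut out by pulled back sections; so the image of this jet
  is tangent to \<open>C\<close>, that is, \<open>C\<close> is coisotropic. If sections \<open>S\<^sub>1\<close>, \<open>S\<^sub>2\<close> restrict on \<open>C\<close> to the pull-backs
  of \<open>s\<^sub>1\<close>, \<open>s\<^sub>2\<close>, then at corresponding points \<open>S\<^sub>i\<close> and \<open>s\<^sub>i\<close> have the jets of \<open>l\<^sub>a + \<pi>\<^sup>*t\<close> and
  \<open>l\<^sub>b + \<pi>\<^sup>*r\<close>, where the derivation \<open>a\<close> restricts to \<open>b\<close> and the section \<open>t\<close> to \<open>r\<close>. The explicit
  brackets of these agree.\<close>

section \<open>Smooth functions on open sets\<close>

text \<open>The canonical bracket is prescribed only on the sections \<open>l_a\<close> and on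
  pulled back ones, whereas reduction speaks of arbitrary sections. This is why sections are
  replaced, point by point, by representatives with the same 1-jet. The representatives must exist
  globally: they come from derivations \<open>k + w . grad\<close> with constant coefficients in a
  chart and frame, multiplied by a cut-off function. In jet coordinates \<open>l_a\<close> plus a
  suitable pulled back section is then affine near the point, so its jet can be read off. The crux
  of the reduction is that \<open>a\<close> can be chosen tangent to \<open>S\<close>. The part of
  the gradient along the derivative coordinates of the jet is the symbol of \<open>a\<close>. A
  section that on \<open>C\<close> is pulled back along \<open>z\<close> is constant along the
  fibres of \<open>z\<close>, so the transverse components of this part vanish and the symbol lies
  in \<open>span K\<close>. The part of the gradient along the base may point out of
  \<open>S\<close>; it is absorbed by \<open>t\<close>, whose restriction to \<open>S\<close> sees
  only its projection. Commutators of derivations tangent to \<open>S\<close> restrict to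
  commutators, which matches the terms \<open>l_[a,b]\<close>.\<close>

definition Cinf :: "'a::euclidean_space set \<Rightarrow> ('a \<Rightarrow> 'b::euclidean_space) \<Rightarrow> bool" where
  "Cinf W f \<longleftrightarrow> (\<forall>k. C_diff k W f)"

lemma C_diff_subset: "C_diff k W f \<Longrightarrow> V \<subseteq> W \<Longrightarrow> C_diff k V f"
  by (induction k arbitrary: f) (auto intro: continuous_on_subset)

lemma C_diff_SucD:
  assumes "C_diff (Suc k) W f" "x \<in> W"
  shows "(f has_derivative frechet_derivative f (at x)) (at x)"
  using assms by (simp add: frechet_derivative_works)

lemma C_diff_cong:
  assumes "open W" "\<And>x. x \<in> W \<Longrightarrow> f x = g x" "C_diff k W f"
  shows "C_diff k W g"
  using assms(2,3)
proof (induction k arbitrary: f g)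
  case 0
  then show ?case by (metis C_diff.simps(1) continuous_on_cong)
next
  case (Suc k)
  have d: "(g has_derivative frechet_derivative f (at x)) (at x)" if "x \<in> W" for x
    using has_derivative_transform_within_open[OF C_diff_SucD[OF Suc.prems(2) that] assms(1) that]
      Suc.prems(1) by auto
  have e: "frechet_derivative f (at x) = frechet_derivative g (at x)" if "x \<in> W" for x
    using frechet_derivative_at[OF d[OF that]] .
  have "C_diff k W (\<lambda>x. frechet_derivative g (at x) v)" for v
    by (rule Suc.IH[of "\<lambda>x. frechet_derivative f (at x) v"]) (use Suc.prems e in auto)
  then show ?case using d by (auto simp: differentiable_def)
qed

text \<open>\<open>C_diff\<close> refers to the chosen \<open>frechet_derivative\<close>. Uniqueness
  of derivatives lets an explicit formula \<open>f'\<close> take its place, and the inductions below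
  rest on this.\<close>

lemma C_diff_SucI:
  assumes "open W" "\<And>x. x \<in> W \<Longrightarrow> (f has_derivative f' x) (at x)"
    "\<And>v. C_diff k W (\<lambda>x. f' x v)"
  shows "C_diff (Suc k) W f"
proof -
  have "frechet_derivative f (at x) = f' x" if "x \<in> W" for x
    using frechet_derivative_at[OF assms(2)[OF that]] by simp
  then have "C_diff k W (\<lambda>x. frechet_derivative f (at x) v)" for v
    by (intro C_diff_cong[OF assms(1) _ assms(3)]) auto
  then show ?thesis using assms(2) by (auto simp: differentiable_def)
qed

lemma C_diff_SucD_C_diff: "C_diff (Suc k) W f \<Longrightarrow> C_diff k W f"
proof (induction k arbitrary: f)
  case 0
  then show ?case
    by (auto intro!: continuous_at_imp_continuous_on differentiable_imp_continuous_within)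
next
  case (Suc k)
  then show ?case by (metis C_diff.simps(2))
qed

lemma C_diff_derivative: "C_diff (Suc k) W f \<Longrightarrow> C_diff k W (\<lambda>x. frechet_derivative f (at x) v)"
  by simp

lemma C_diff_const: "open W \<Longrightarrow> C_diff k W (\<lambda>x. c)"
  by (induction k arbitrary: c) auto

lemma C_diff_linear:
  assumes "open W" "bounded_linear f"
  shows "C_diff k W f"
proof (cases k)
  case 0
  then show ?thesis using assms(2) by (simp add: linear_continuous_on)
next
  case (Suc n)
  show ?thesis unfolding Suc
    by (rule C_diff_SucI[OF assms(1) bounded_linear_imp_has_derivative[OF assms(2)]])
      (rule C_diff_const[OF assms(1)])
qed

lemma C_diff_add:
  assumes "open W" "C_diff k W f" "C_diff k W g"
  shows "C_diff k W (\<lambda>x. f x + g x)"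
  using assms(2,3)
proof (induction k arbitrary: f g)
  case 0
  then show ?case by (simp add: continuous_on_add)
next
  case (Suc k)
  show ?case
    by (rule C_diff_SucI[OF assms(1) has_derivative_add[OF C_diff_SucD[OF Suc.prems(1)] C_diff_SucD[OF Suc.prems(2)]]])
      (use Suc in auto)
qed

text \<open>Both functions stay arbitrary in the induction, since the product rule pairs each of
  them with a derivative of the other.\<close>

lemma C_diff_bilinear:
  assumes "bounded_bilinear B" "open W" "C_diff k W f" "C_diff k W g"
  shows "C_diff k W (\<lambda>x. B (f x) (g x))"
  using assms(3,4)
proof (induction k arbitrary: f g)
  case 0
  then show ?case by (simp add: bounded_bilinear.continuous_on[OF assms(1)])
next
  case (Suc k)
  show ?case
    by (rule C_diff_SucI[OF assms(2) bounded_bilinear.FDERIV[OF assms(1)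
            C_diff_SucD[OF Suc.prems(1)] C_diff_SucD[OF Suc.prems(2)]]], assumption+)
      (intro C_diff_add[OF assms(2)] Suc.IH C_diff_SucD_C_diff[OF Suc.prems(1)]
        C_diff_SucD_C_diff[OF Suc.prems(2)] C_diff_derivative[OF Suc.prems(1)]
        C_diff_derivative[OF Suc.prems(2)])
qed

lemma C_diff_sum:
  assumes "open W" "\<And>i. i \<in> A \<Longrightarrow> C_diff k W (f i)"
  shows "C_diff k W (\<lambda>x. \<Sum>i\<in>A. f i x)"
  using assms(2)
  by (induction A rule: infinite_finite_induct) (auto intro!: C_diff_add C_diff_const assms(1))

text \<open>In the chain rule the direction \<open>?f' x v\<close> moves with \<open>x\<close>,
  while \<open>C_diff\<close> constrains derivatives in fixed directions only. Expanding the
  direction over \<open>Basis\<close> leaves a sum of products, whose factors with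
  \<open>?g'\<close> are covered by the induction hypothesis.\<close>

lemma C_diff_compose:
  assumes "open W" "C_diff k W f" "C_diff k V g" "f ` W \<subseteq> V"
  shows "C_diff k W (\<lambda>x. g (f x))"
  using assms(2,3)
proof (induction k arbitrary: g)
  case 0
  then show ?case using assms(4) continuous_on_compose2 by (metis C_diff.simps(1))
next
  case (Suc k)
  let ?f' = "\<lambda>x. frechet_derivative f (at x)" and ?g' = "\<lambda>x. frechet_derivative g (at x)"
  have d: "((\<lambda>x. g (f x)) has_derivative (\<lambda>v. \<Sum>b\<in>Basis. (?f' x v \<bullet> b) *\<^sub>R ?g' (f x) b)) (at x)"
    if "x \<in> W" for x
  proof -
    have g: "(g has_derivative ?g' (f x)) (at (f x))"
      using C_diff_SucD[OF Suc.prems(2)] assms(4) that by blast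
    have l: "linear (?g' (f x))"
      using has_derivative_linear[OF g] .
    have "?g' (f x) w = (\<Sum>b\<in>Basis. (w \<bullet> b) *\<^sub>R ?g' (f x) b)" for w
      using arg_cong[OF euclidean_representation[of w], of "?g' (f x)"]
      by (simp add: linear_sum[OF l] linear_scale[OF l])
    then have "(\<lambda>v. ?g' (f x) (?f' x v)) = (\<lambda>v. \<Sum>b\<in>Basis. (?f' x v \<bullet> b) *\<^sub>R ?g' (f x) b)"
      by blast
    with has_derivative_compose[OF C_diff_SucD[OF Suc.prems(1) that] g] show ?thesis by simp
  qed
  show ?case
  proof (rule C_diff_SucI[OF assms(1) d], assumption)
    fix v
    have "C_diff k W (\<lambda>x. ?f' x v \<bullet> b)" for b
      using Suc.prems(1)
      by (intro C_diff_bilinear[OF bounded_bilinear_inner assms(1)] C_diff_const[OF assms(1)]) auto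
    moreover have "C_diff k W (\<lambda>x. ?g' (f x) b)" for b
      by (rule Suc.IH[OF C_diff_SucD_C_diff[OF Suc.prems(1)] C_diff_derivative[OF Suc.prems(2)]])
    ultimately show "C_diff k W (\<lambda>x. \<Sum>b\<in>Basis. (?f' x v \<bullet> b) *\<^sub>R ?g' (f x) b)"
      by (intro C_diff_sum[OF assms(1)] C_diff_bilinear[OF bounded_bilinear_scaleR assms(1)]) auto
  qed
qed

lemma Cinf_subset: "Cinf W f \<Longrightarrow> V \<subseteq> W \<Longrightarrow> Cinf V f"
  by (auto simp: Cinf_def intro: C_diff_subset)

lemma Cinf_const: "open W \<Longrightarrow> Cinf W (\<lambda>x. c)"
  by (simp add: Cinf_def C_diff_const)

lemma Cinf_linear: "open W \<Longrightarrow> bounded_linear f \<Longrightarrow> Cinf W f"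
  by (simp add: Cinf_def C_diff_linear)

lemma Cinf_add: "open W \<Longrightarrow> Cinf W f \<Longrightarrow> Cinf W g \<Longrightarrow> Cinf W (\<lambda>x. f x + g x)"
  by (simp add: Cinf_def C_diff_add)

lemma Cinf_bilinear:
  "bounded_bilinear B \<Longrightarrow> open W \<Longrightarrow> Cinf W f \<Longrightarrow> Cinf W g \<Longrightarrow> Cinf W (\<lambda>x. B (f x) (g x))"
  by (simp add: Cinf_def C_diff_bilinear)

lemma Cinf_compose:
  "open W \<Longrightarrow> Cinf W f \<Longrightarrow> Cinf V g \<Longrightarrow> f ` W \<subseteq> V \<Longrightarrow> Cinf W (\<lambda>x. g (f x))"
  unfolding Cinf_def using C_diff_compose by blast

lemma Cinf_has_derivative:
  "Cinf W f \<Longrightarrow> x \<in> W \<Longrightarrow> (f has_derivative frechet_derivative f (at x)) (at x)"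
  using C_diff_SucD unfolding Cinf_def by blast

lemma Cinf_derivative: "Cinf W f \<Longrightarrow> Cinf W (\<lambda>x. frechet_derivative f (at x) v)"
  unfolding Cinf_def by (metis C_diff.simps(2))

lemma Cinf_continuous_on: "Cinf W f \<Longrightarrow> continuous_on W f"
  unfolding Cinf_def by (metis C_diff.simps(1))

lemma C_diff_continuous_on: "C_diff k W f \<Longrightarrow> continuous_on W f"
  by (induction k) (auto dest: C_diff_SucD_C_diff simp del: C_diff.simps(2))

section \<open>Integration along segments and Hadamard's lemma\<close>

lemma segment_in_ball:
  fixes p y :: "'a::euclidean_space"
  assumes "y \<in> ball p r" "t \<in> {0..1::real}"
  shows "p + t *\<^sub>R (y - p) \<in> ball p r"
proof -
  have "dist p (p + t *\<^sub>R (y - p)) = t * dist p y"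
    using assms(2) by (simp add: dist_norm norm_minus_commute)
  also have "\<dots> \<le> dist p y"
    using assms(2) by (simp add: mult_left_le_one_le)
  finally show ?thesis using assms(1) by simp
qed

lemma continuous_on_segment:
  fixes F :: "'a::euclidean_space \<Rightarrow> real"
  assumes "continuous_on (ball p r) F"
  shows "continuous_on (ball p r \<times> {0..1}) (\<lambda>(y, t). t ^ m * F (p + t *\<^sub>R (y - p)))"
proof -
  have "continuous_on (ball p r \<times> {0..1::real}) (\<lambda>z. F (p + snd z *\<^sub>R (fst z - p)))"
    by (rule continuous_on_compose2[OF assms]) (auto intro!: continuous_intros segment_in_ball)
  then show ?thesis
    unfolding case_prod_unfold by (intro continuous_intros)
qed

lemma C_diff_segment_integral:
  fixes F :: "'a::euclidean_space \<Rightarrow> real"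
  assumes "C_diff k (ball p r) F"
  shows "C_diff k (ball p r) (\<lambda>y. integral {0..1} (\<lambda>t. t ^ m * F (p + t *\<^sub>R (y - p))))"
  using assms
proof (induction k arbitrary: F m)
  case 0
  then have "continuous_on (ball p r) F" by simp
  from continuous_on_segment[OF this]
  have "continuous_on (ball p r \<times> cbox 0 1) (\<lambda>(y, t). t ^ m * F (p + t *\<^sub>R (y - p)))"
    unfolding cbox_interval .
  from integral_continuous_on_param[OF this] show ?case
    by (simp add: cbox_interval)
next
  case (Suc k)
  let ?W = "ball p r" and ?F' = "\<lambda>x. frechet_derivative F (at x)"
  let ?\<gamma> = "\<lambda>y t. p + t *\<^sub>R (y - p)"
  \<comment> \<open>The Leibniz rule wants the derivative as a bounded linear map that depends
    continuously on \<open>(y, t)\<close>. Continuity is then checked on basis vectors.\<close>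
  define D where "D y t = t ^ Suc m *\<^sub>R Blinfun (?F' (?\<gamma> y t))" for y t
  have F: "(F has_derivative ?F' x) (at x)" if "x \<in> ?W" for x
    using C_diff_SucD[OF Suc.prems that] .
  have D: "blinfun_apply (D y t) v = t ^ Suc m * ?F' (?\<gamma> y t) v"
    if "y \<in> ?W" "t \<in> {0..1}" for y t v
    unfolding D_def
    using has_derivative_bounded_linear[OF F[OF segment_in_ball[OF that]]]
    by (simp add: blinfun.scaleR_left bounded_linear_Blinfun_apply)
  have contD: "continuous_on (?W \<times> {0..1}) (\<lambda>(y, t). D y t)"
  proof (rule continuous_on_blinfun_componentwise)
    fix i :: 'a assume "i \<in> Basis"
    have "continuous_on (?W \<times> {0..1}) (\<lambda>(y, t). t ^ Suc m * ?F' (?\<gamma> y t) i)"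
      by (rule continuous_on_segment[OF C_diff_continuous_on[OF C_diff_derivative[OF Suc.prems]]])
    then show "continuous_on (?W \<times> {0..1}) (\<lambda>z. blinfun_apply (case z of (y, t) \<Rightarrow> D y t) i)"
      by (rule continuous_on_eq) (auto simp del: power_Suc simp: D)
  qed
  have der: "((\<lambda>y. t ^ m * F (?\<gamma> y t)) has_derivative blinfun_apply (D y t)) (at y within ?W)"
    if yt: "y \<in> ?W" "t \<in> {0..1}" for y t
  proof -
    have "((\<lambda>y. ?\<gamma> y t) has_derivative (\<lambda>v. t *\<^sub>R v)) (at y)"
      by (auto intro!: derivative_eq_intros)
    from has_derivative_compose[OF this F[OF segment_in_ball[OF yt]]]
    have "((\<lambda>y. t ^ m * F (?\<gamma> y t)) has_derivative (\<lambda>v. t ^ m * ?F' (?\<gamma> y t) (t *\<^sub>R v))) (at y)"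
      by (rule has_derivative_mult_right)
    moreover have "t ^ m * ?F' (?\<gamma> y t) (t *\<^sub>R v) = blinfun_apply (D y t) v" for v
      using linear_scale[OF has_derivative_linear[OF F[OF segment_in_ball[OF yt]]], of t v] D[OF yt]
      by simp
    ultimately show ?thesis using has_derivative_at_withinI by force
  qed
  have intD: "D y integrable_on {0..1}" if "y \<in> ?W" for y
  proof -
    have "continuous_on {0..1} (\<lambda>t. case (y, t) of (y, t) \<Rightarrow> D y t)"
      by (rule continuous_on_compose2[OF contD]) (use that in \<open>auto intro!: continuous_intros\<close>)
    then show ?thesis using integrable_continuous_real by auto
  qed
  have int: "(\<lambda>t. t ^ m * F (?\<gamma> y t)) integrable_on {0..1}" if "y \<in> ?W" for y
  proof -
    have c: "continuous_on ?W F"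
      using C_diff_continuous_on[OF Suc.prems] .
    have "continuous_on {0..1} (\<lambda>t. case (y, t) of (y, t) \<Rightarrow> t ^ m * F (?\<gamma> y t))"
      by (rule continuous_on_compose2[OF continuous_on_segment[OF c]])
        (use that in \<open>auto intro!: continuous_intros\<close>)
    then show ?thesis using integrable_continuous_real by auto
  qed
  have apply_int: "blinfun_apply (integral {0..1} (D y)) v =
      integral {0..1} (\<lambda>t. t ^ Suc m * ?F' (?\<gamma> y t) v)" if "y \<in> ?W" for y v
    using blinfun_apply_integral[OF intD[OF that], of v] D[OF that]
    by (auto intro!: integral_cong simp del: power_Suc)
  have "((\<lambda>y. integral {0..1} (\<lambda>t. t ^ m * F (?\<gamma> y t))) has_derivative
      (\<lambda>v. integral {0..1} (\<lambda>t. t ^ Suc m * ?F' (?\<gamma> y t) v))) (at y)" if "y \<in> ?W" for y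
  proof -
    have "((\<lambda>y. integral (cbox 0 1) (\<lambda>t. t ^ m * F (?\<gamma> y t))) has_derivative
        blinfun_apply (integral (cbox 0 1) (D y))) (at y within ?W)"
      unfolding cbox_interval
      by (rule leibniz_rule[of "ball p r" "0::real" 1, unfolded cbox_interval, OF der int contD that convex_ball])
    moreover have "blinfun_apply (integral {0..1} (D y)) =
        (\<lambda>v. integral {0..1} (\<lambda>t. t ^ Suc m * ?F' (?\<gamma> y t) v))"
      using apply_int[OF that] by blast
    ultimately show ?thesis
      unfolding cbox_interval at_within_open[OF that open_ball] by metis
  qed
  from C_diff_SucI[OF open_ball this Suc.IH[OF C_diff_derivative[OF Suc.prems]]]
  show ?case by this simp
qed

text \<open>The fundamental theorem of calculus along the segment from \<open>p\<close> to
  \<open>y\<close>. The witness \<open>H b\<close> is the mean of the partial derivative of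
  \<open>G\<close> in direction \<open>b\<close> over this segment.\<close>

lemma Hadamard:
  fixes G :: "'a::euclidean_space \<Rightarrow> real"
  assumes G: "Cinf (ball p r) G"
  obtains H where "\<And>b. Cinf (ball p r) (H b)" "\<And>b. H b p = frechet_derivative G (at p) b"
    "\<And>y. y \<in> ball p r \<Longrightarrow> G y = G p + (\<Sum>b\<in>Basis. ((y - p) \<bullet> b) * H b y)"
proof
  let ?G' = "\<lambda>x. frechet_derivative G (at x)"
  let ?H = "\<lambda>b y. integral {0..1} (\<lambda>t. t ^ 0 * ?G' (p + t *\<^sub>R (y - p)) b)"
  show "Cinf (ball p r) (?H b)" for b
    unfolding Cinf_def
    by (intro allI C_diff_segment_integral) (use Cinf_derivative[OF G] Cinf_def in auto)
  show "?H b p = frechet_derivative G (at p) b" for b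
    by simp
  fix y assume y: "y \<in> ball p r"
  have "((\<lambda>t. G (p + t *\<^sub>R (y - p))) has_vector_derivative ?G' (p + t *\<^sub>R (y - p)) (y - p))
      (at t within {0..1})" if "t \<in> {0..1}" for t
  proof -
    have "((\<lambda>t. p + t *\<^sub>R (y - p)) has_derivative (\<lambda>s. s *\<^sub>R (y - p))) (at t within {0..1})"
      by (auto intro!: derivative_eq_intros)
    from has_derivative_compose[OF this Cinf_has_derivative[OF G segment_in_ball[OF y that]]]
    show ?thesis
      unfolding has_vector_derivative_def
      using linear_scale[OF has_derivative_linear[OF Cinf_has_derivative[OF G segment_in_ball[OF y that]]]]
      by simp
  qed
  from fundamental_theorem_of_calculus[OF _ this]
  have ftc: "((\<lambda>t. ?G' (p + t *\<^sub>R (y - p)) (y - p)) has_integral G y - G p) {0..1}"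
    by force
  have exp: "?G' (p + t *\<^sub>R (y - p)) (y - p) =
      (\<Sum>b\<in>Basis. ((y - p) \<bullet> b) * (t ^ 0 * ?G' (p + t *\<^sub>R (y - p)) b))" if "t \<in> {0..1}" for t
  proof -
    have l: "linear (?G' (p + t *\<^sub>R (y - p)))"
      using has_derivative_linear[OF Cinf_has_derivative[OF G segment_in_ball[OF y that]]] .
    show ?thesis
      using arg_cong[OF euclidean_representation[of "y - p"], of "?G' (p + t *\<^sub>R (y - p))"]
      by (simp add: linear_sum[OF l] linear_scale[OF l])
  qed
  have integ: "(\<lambda>t. t ^ 0 * ?G' (p + t *\<^sub>R (y - p)) b) integrable_on {0..1}" for b
  proof -
    have "continuous_on {0..1} (\<lambda>t. case (y, t) of (y, t) \<Rightarrow> t ^ 0 * ?G' (p + t *\<^sub>R (y - p)) b)"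
      by (rule continuous_on_compose2[OF continuous_on_segment[OF Cinf_continuous_on[OF Cinf_derivative[OF G]]]])
        (use y in \<open>auto intro!: continuous_intros\<close>)
    then show ?thesis using integrable_continuous_real by (simp add: split_def)
  qed
  have "G y - G p = integral {0..1} (\<lambda>t. ?G' (p + t *\<^sub>R (y - p)) (y - p))"
    using ftc by (simp add: integral_unique)
  also have "\<dots> = integral {0..1} (\<lambda>t. \<Sum>b\<in>Basis. ((y - p) \<bullet> b) * (t ^ 0 * ?G' (p + t *\<^sub>R (y - p)) b))"
    by (rule integral_cong) (rule exp)
  also have "\<dots> = (\<Sum>b\<in>Basis. ((y - p) \<bullet> b) * ?H b y)"
    using integ by (subst integral_sum) (auto intro!: integrable_on_mult_right)
  finally show "G y = G p + (\<Sum>b\<in>Basis. ((y - p) \<bullet> b) * ?H b y)" by simp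
qed

text \<open>The classical flat function is \<open>flat 0\<close>. The powers \<open>t ^ n\<close>
  make the family closed under differentiation, so that smoothness of all members follows by one
  induction.\<close>

definition flat :: "nat \<Rightarrow> real \<Rightarrow> real" where
  "flat n t = (if t > 0 then exp (- 1 / t) / t ^ n else 0)"

lemma flat_has_real_derivative:
  "(flat n has_real_derivative flat (n + 2) t - n * flat (n + 1) t) (at t)"
proof (cases t "0::real" rule: linorder_cases)
  case less
  have "((\<lambda>_. 0) has_real_derivative 0) (at t)" by simp
  then have "(flat n has_real_derivative 0) (at t)"
    by (rule has_field_derivative_transform_within_open[of _ _ _ "{..<0}"])
      (use less in \<open>auto simp: flat_def\<close>)
  then show ?thesis using less by (simp add: flat_def)
next
  case greater
  have "((\<lambda>t. exp (- 1 / t) / t ^ n) has_real_derivative flat (n + 2) t - n * flat (n + 1) t) (at t)"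
  proof (cases n)
    case 0
    then show ?thesis
      using greater by (auto intro!: derivative_eq_intros simp: flat_def field_simps power2_eq_square)
  next
    case (Suc m)
    have "t ^ n = t * t ^ m" "n - 1 = m" using Suc by auto
    then show ?thesis
      using greater Suc
      by (auto intro!: derivative_eq_intros simp: flat_def divide_simps) (cases m; simp add: algebra_simps)
  qed
  then show ?thesis
    by (rule has_field_derivative_transform_within_open[of _ _ _ "{0<..}"])
      (use greater in \<open>auto simp: flat_def\<close>)
next
  \<comment> \<open>At 0 the difference quotient is \<open>flat n x / x\<close>. From the right it
    equals \<open>u ^ Suc n / exp u\<close> with \<open>u = inverse x\<close> tending to infinity;
    from the left it is 0.\<close>
  case equal
  have "((\<lambda>x. inverse x ^ Suc n / exp (inverse x)) \<longlongrightarrow> (0::real)) (at_right 0)"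
    by (rule filterlim_compose[OF tendsto_power_div_exp_0 filterlim_inverse_at_top_right])
  moreover have "inverse x ^ Suc n / exp (inverse x) = flat n x / x" if "x > 0" for x :: real
  proof -
    have "exp (- 1 / x) = inverse (exp (inverse x))"
      by (simp add: exp_minus[symmetric] divide_inverse)
    then show ?thesis
      using that by (simp add: flat_def divide_inverse power_inverse mult_ac)
  qed
  then have "\<forall>\<^sub>F x in at_right 0. inverse x ^ Suc n / exp (inverse x) = flat n x / x"
    by (auto simp: eventually_at_filter intro: always_eventually)
  ultimately have "((\<lambda>x. flat n x / x) \<longlongrightarrow> 0) (at_right 0)"
    by (rule Lim_transform_eventually)
  moreover have "((\<lambda>x. flat n x / x) \<longlongrightarrow> 0) (at_left 0)"
    by (rule tendsto_eventually) (auto simp: eventually_at_filter flat_def intro: always_eventually)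
  ultimately have "((\<lambda>x. flat n x / x) \<longlongrightarrow> 0) (at 0)"
    by (simp add: filterlim_split_at)
  then show ?thesis
    unfolding equal by (simp add: has_field_derivative_iff flat_def)
qed

lemma Cinf_flat: "Cinf UNIV (flat n)"
proof -
  have "C_diff k UNIV (flat n)" for k
  proof (induction k arbitrary: n)
    case 0
    then show ?case
      using DERIV_isCont[OF flat_has_real_derivative] by (auto intro: continuous_at_imp_continuous_on)
  next
    case (Suc k)
    show ?case
    proof (rule C_diff_SucI[OF open_UNIV flat_has_real_derivative[unfolded has_field_derivative_def]])
      fix v :: real
      have "C_diff k UNIV (\<lambda>x. v *\<^sub>R flat (n + 2) x + (- (n * v)) *\<^sub>R flat (n + 1) x)"
        by (intro C_diff_add C_diff_bilinear[OF bounded_bilinear_scaleR] C_diff_const Suc.IH open_UNIV)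
      then show "C_diff k UNIV (\<lambda>x. (flat (n + 2) x - n * flat (n + 1) x) * v)"
        by (simp add: algebra_simps)
    qed
  qed
  then show ?thesis by (simp add: Cinf_def)
qed

lemma bump_exists:
  fixes p :: "'a::euclidean_space"
  assumes "r > 0"
  obtains \<rho> :: "'a \<Rightarrow> real" where "Cinf UNIV \<rho>" "\<And>y. y \<notin> ball p r \<Longrightarrow> \<rho> y = 0"
    "\<And>y. y \<in> ball p (r / 2) \<Longrightarrow> \<rho> y = 1"
proof
  \<comment> \<open>\<open>c\<close> is the value of the inner function \<open>flat 0 (?u y)\<close>
    on the sphere of radius \<open>r\<close>. Within radius \<open>r / 2\<close> the inner function
    is 0 and the quotient is 1; outside radius \<open>r\<close> it is at least \<open>c\<close> by
    monotonicity, so the outer argument is not positive and the quotient is 0.\<close>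
  define c where "c = flat 0 (3 / 4 * r\<^sup>2)"
  have c: "c > 0" "flat 0 c > 0"
    using assms by (auto simp: c_def flat_def)
  let ?u = "\<lambda>y. (y - p) \<bullet> (y - p) - r\<^sup>2 / 4"
  let ?\<rho> = "\<lambda>y. flat 0 (c - flat 0 (?u y)) / flat 0 c"
  have lin: "Cinf UNIV (\<lambda>y::'a. y - p)"
    using Cinf_add[OF open_UNIV Cinf_linear[OF open_UNIV bounded_linear_ident] Cinf_const[OF open_UNIV, of "- p"]]
    by simp
  have "Cinf UNIV ?u"
    using Cinf_add[OF open_UNIV Cinf_bilinear[OF bounded_bilinear_inner open_UNIV lin lin]
        Cinf_const[OF open_UNIV, of "- (r\<^sup>2 / 4)"]] by simp
  then have "Cinf UNIV (\<lambda>y. flat 0 (?u y))"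
    by (rule Cinf_compose[OF open_UNIV _ Cinf_flat]) auto
  then have "Cinf UNIV (\<lambda>y. c + (- 1) *\<^sub>R flat 0 (?u y))"
    by (intro Cinf_add Cinf_const Cinf_bilinear[OF bounded_bilinear_scaleR] open_UNIV)
  then have "Cinf UNIV (\<lambda>y. flat 0 (c + (- 1) *\<^sub>R flat 0 (?u y)))"
    by (rule Cinf_compose[OF open_UNIV _ Cinf_flat]) auto
  then have "Cinf UNIV (\<lambda>y. (1 / flat 0 c) *\<^sub>R flat 0 (c + (- 1) *\<^sub>R flat 0 (?u y)))"
    by (intro Cinf_const Cinf_bilinear[OF bounded_bilinear_scaleR] open_UNIV)
  then show "Cinf UNIV ?\<rho>" by simp
  have mono: "flat 0 s \<le> flat 0 t" if "0 < s" "s \<le> t" for s t :: real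
    using that by (auto simp: flat_def divide_simps)
  show "?\<rho> y = 0" if "y \<notin> ball p r" for y
  proof -
    have "r\<^sup>2 \<le> (y - p) \<bullet> (y - p)"
      using that assms unfolding dot_square_norm
      by (intro power_mono) (auto simp: dist_norm norm_minus_commute)
    then have "c \<le> flat 0 (?u y)"
      unfolding c_def using assms by (intro mono) auto
    then show ?thesis by (simp add: flat_def)
  qed
  show "?\<rho> y = 1" if "y \<in> ball p (r / 2)" for y
  proof -
    have "(y - p) \<bullet> (y - p) \<le> (r / 2)\<^sup>2"
      using that assms unfolding dot_square_norm
      by (intro power_mono) (auto simp: dist_norm norm_minus_commute)
    then have "flat 0 (?u y) = 0"
      by (simp add: flat_def power_divide)
    then show ?thesis using c by simp
  qed
qed

section \<open>Charts and smoothness at a point\<close>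

lemma compatible_sym: "compatible M c d \<Longrightarrow> compatible M d c"
  unfolding compatible_def by (auto simp: Int_commute split: prod.splits)

text \<open>The conditions of \<open>manifold\<close> on the atlas. For submanifolds and jet
  manifolds they are established first; the Hausdorff property is then proved with the help of the
  topology and charts obtained here.\<close>

locale atlas_mfd =
  fixes M :: "('m, 'e::euclidean_space) mfd"
  assumes model_Basis: "model M \<subseteq> Basis"
    and atlas_is_chart: "\<And>c. c \<in> atlas M \<Longrightarrow> is_chart M c"
    and atlas_compatible: "\<And>c d. c \<in> atlas M \<Longrightarrow> d \<in> atlas M \<Longrightarrow> compatible M c d"
    and atlas_cover: "(\<Union>c\<in>atlas M. fst c) = pts M"
begin

abbreviation "T \<equiv> mfd_topology M"
abbreviation "E \<equiv> span (model M)"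

lemma finite_model: "finite (model M)"
  using finite_subset[OF model_Basis finite_Basis] .

lemma atlas_subset_charts: "c \<in> atlas M \<Longrightarrow> c \<in> charts M"
  unfolding charts_def using atlas_is_chart atlas_compatible by auto

lemma atlas_at:
  assumes "x \<in> pts M" obtains U \<phi> where "(U, \<phi>) \<in> atlas M" "x \<in> U"
  using assms atlas_cover by fastforce

lemma chart_at:
  assumes "x \<in> pts M" obtains U \<phi> where "(U, \<phi>) \<in> charts M" "x \<in> U"
  using atlas_at[OF assms] atlas_subset_charts by metis

lemma chart_subset: "(U, \<phi>) \<in> charts M \<Longrightarrow> U \<subseteq> pts M"
  and chart_inj: "(U, \<phi>) \<in> charts M \<Longrightarrow> inj_on \<phi> U"
  and chart_openin: "(U, \<phi>) \<in> charts M \<Longrightarrow> openin (top_of_set E) (\<phi> ` U)"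
  unfolding charts_def is_chart_def by auto

lemma chart_image: "(U, \<phi>) \<in> charts M \<Longrightarrow> x \<in> U \<Longrightarrow> \<phi> x \<in> E"
  using chart_openin[of U \<phi>] openin_subset by fastforce

text \<open>Chart images are open only relative to \<open>E\<close>, while smooth extensions live on
  open subsets of the whole Euclidean space. An ambient open set \<open>N\<close> that detects
  membership in \<open>A\<close> bridges the two.\<close>

lemma relopen_image:
  assumes "inj_on \<phi> U" "openin (top_of_set E) (\<phi> ` A)" "A \<subseteq> U" "\<phi> ` U \<subseteq> E"
  obtains N where "open N" "\<And>y. y \<in> U \<Longrightarrow> \<phi> y \<in> N \<longleftrightarrow> y \<in> A"
proof -
  obtain N where N: "open N" "\<phi> ` A = E \<inter> N"
    using assms(2) openin_open by metis
  have "\<phi> y \<in> N \<longleftrightarrow> y \<in> A" if y: "y \<in> U" for y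
  proof
    assume "\<phi> y \<in> N"
    then have "\<phi> y \<in> \<phi> ` A" using N(2) y assms(4) by auto
    then show "y \<in> A" using inj_on_image_mem_iff[OF assms(1) y assms(3)] by simp
  next
    assume "y \<in> A" then show "\<phi> y \<in> N" using N(2) by blast
  qed
  then show thesis using that N(1) by blast
qed

lemma istopology_mfd: "istopology (\<lambda>W. W \<subseteq> pts M \<and>
     (\<forall>(U, \<phi>)\<in>atlas M. openin (top_of_set E) (\<phi> ` (W \<inter> U))))"
  unfolding istopology_def
proof (intro conjI allI impI)
  fix A B
  assume A: "A \<subseteq> pts M \<and> (\<forall>(U, \<phi>)\<in>atlas M. openin (top_of_set E) (\<phi> ` (A \<inter> U)))"
    and B: "B \<subseteq> pts M \<and> (\<forall>(U, \<phi>)\<in>atlas M. openin (top_of_set E) (\<phi> ` (B \<inter> U)))"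
  show "A \<inter> B \<subseteq> pts M" using A by auto
  show "\<forall>(U, \<phi>)\<in>atlas M. openin (top_of_set E) (\<phi> ` (A \<inter> B \<inter> U))"
  proof clarify
    fix U \<phi> assume U: "(U, \<phi>) \<in> atlas M"
    have "\<phi> ` (A \<inter> B \<inter> U) = \<phi> ` (A \<inter> U) \<inter> \<phi> ` (B \<inter> U)"
      using chart_inj[OF atlas_subset_charts[OF U]] by (auto simp: inj_on_def)
    then show "openin (top_of_set E) (\<phi> ` (A \<inter> B \<inter> U))"
      using A B U by auto
  qed
next
  fix \<K>
  assume K: "\<forall>A\<in>\<K>. A \<subseteq> pts M \<and> (\<forall>(U, \<phi>)\<in>atlas M. openin (top_of_set E) (\<phi> ` (A \<inter> U)))"
  then show "\<Union>\<K> \<subseteq> pts M" by auto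
  show "\<forall>(U, \<phi>)\<in>atlas M. openin (top_of_set E) (\<phi> ` (\<Union>\<K> \<inter> U))"
  proof clarify
    fix U \<phi> assume U: "(U, \<phi>) \<in> atlas M"
    have "\<phi> ` (\<Union>\<K> \<inter> U) = \<Union>((\<lambda>A. \<phi> ` (A \<inter> U)) ` \<K>)" by auto
    moreover have "openin (top_of_set E) (\<Union>((\<lambda>A. \<phi> ` (A \<inter> U)) ` \<K>))"
      by (rule openin_Union) (use K U in auto)
    ultimately show "openin (top_of_set E) (\<phi> ` (\<Union>\<K> \<inter> U))" by simp
  qed
qed

lemma openin_T: "openin T W \<longleftrightarrow> W \<subseteq> pts M \<and>
     (\<forall>(U, \<phi>)\<in>atlas M. openin (top_of_set E) (\<phi> ` (W \<inter> U)))"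
  unfolding mfd_topology_def topology_inverse'[OF istopology_mfd] by simp

lemma openin_pts: "openin T (pts M)"
  unfolding openin_T
proof (intro conjI subset_refl, clarify)
  fix U \<phi> assume "(U, \<phi>) \<in> atlas M"
  then have c: "(U, \<phi>) \<in> charts M" by (rule atlas_subset_charts)
  have "pts M \<inter> U = U" using chart_subset[OF c] by auto
  then show "openin (top_of_set E) (\<phi> ` (pts M \<inter> U))" using chart_openin[OF c] by simp
qed

lemma topspace_T: "topspace T = pts M"
  using openin_pts openin_T topspace_def by (metis openin_subset openin_topspace subset_antisym)

lemma compat_local:
  assumes "is_chart M (U, \<phi>)" "is_chart M (V, \<psi>)" "compatible M (U, \<phi>) (V, \<psi>)" "x \<in> U" "x \<in> V"
  obtains N G where "open N" "\<phi> x \<in> N" "Cinf N G"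
    "\<And>y. y \<in> U \<Longrightarrow> \<phi> y \<in> N \<Longrightarrow> y \<in> V \<and> \<psi> y = G (\<phi> y)"
proof -
  have inj: "inj_on \<phi> U" and UE: "\<phi> ` U \<subseteq> E"
    using assms(1) openin_subset by (fastforce simp: is_chart_def)+
  have op: "openin (top_of_set E) (\<phi> ` (U \<inter> V))"
    and sm: "smooth_on (\<phi> ` (U \<inter> V)) (\<psi> \<circ> inv_into U \<phi>)"
    using assms(3) by (auto simp: compatible_def)
  obtain N1 where N1: "open N1" "\<And>y. y \<in> U \<Longrightarrow> \<phi> y \<in> N1 \<longleftrightarrow> y \<in> U \<inter> V"
    by (rule relopen_image[OF inj op _ UE]) auto
  obtain N2 G where N2: "open N2" "\<phi> x \<in> N2" "\<forall>k. C_diff k N2 G"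
    "\<forall>y\<in>\<phi> ` (U \<inter> V) \<inter> N2. G y = (\<psi> \<circ> inv_into U \<phi>) y"
    using sm assms(4,5) unfolding smooth_on_def by blast
  show thesis
  proof (rule that[of "N1 \<inter> N2" G])
    show "Cinf (N1 \<inter> N2) G" using N2(3) by (auto simp: Cinf_def intro: C_diff_subset)
    fix y assume y: "y \<in> U" "\<phi> y \<in> N1 \<inter> N2"
    then have "y \<in> V" using N1 by auto
    with y show "y \<in> V \<and> \<psi> y = G (\<phi> y)" using N2(4) inj by auto
  qed (use N1 N2 assms in auto)
qed

text \<open>Charts of the maximal atlas are compared by definition with atlas charts only, so the
  transition is factored through an atlas chart around \<open>x\<close>.\<close>

lemma transition:
  assumes "(U, \<phi>) \<in> charts M" "(V, \<psi>) \<in> charts M" "x \<in> U" "x \<in> V"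
  obtains N G where "open N" "\<phi> x \<in> N" "Cinf N G"
    "\<And>y. y \<in> U \<Longrightarrow> \<phi> y \<in> N \<Longrightarrow> y \<in> V \<and> \<psi> y = G (\<phi> y)"
proof -
  obtain A \<theta> where A: "(A, \<theta>) \<in> atlas M" "x \<in> A"
    using atlas_at chart_subset[OF assms(1)] assms(3) by blast
  have c: "compatible M (U, \<phi>) (A, \<theta>)" "compatible M (A, \<theta>) (V, \<psi>)"
    using assms(1,2) A(1) by (auto simp: charts_def intro: compatible_sym)
  have i: "is_chart M (U, \<phi>)" "is_chart M (A, \<theta>)" "is_chart M (V, \<psi>)"
    using assms A atlas_is_chart by (auto simp: charts_def)
  obtain N1 G1 where 1: "open N1" "\<phi> x \<in> N1" "Cinf N1 G1"
    "\<And>y. y \<in> U \<Longrightarrow> \<phi> y \<in> N1 \<Longrightarrow> y \<in> A \<and> \<theta> y = G1 (\<phi> y)"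
    using compat_local[OF i(1,2) c(1) assms(3) A(2)] by metis
  obtain N2 G2 where 2: "open N2" "\<theta> x \<in> N2" "Cinf N2 G2"
    "\<And>y. y \<in> A \<Longrightarrow> \<theta> y \<in> N2 \<Longrightarrow> y \<in> V \<and> \<psi> y = G2 (\<theta> y)"
    using compat_local[OF i(2,3) c(2) A(2) assms(4)] by metis
  let ?N = "N1 \<inter> G1 -` N2"
  have o: "open ?N"
    using continuous_open_preimage[OF Cinf_continuous_on[OF 1(3)] 1(1) 2(1)] .
  show thesis
  proof (rule that[OF o])
    show "\<phi> x \<in> ?N" using 1(2) 1(4)[OF assms(3)] 2(2) by auto
    show "Cinf ?N (\<lambda>w. G2 (G1 w))"
      by (rule Cinf_compose[OF o Cinf_subset[OF 1(3)] 2(3)]) auto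
    fix y assume "y \<in> U" "\<phi> y \<in> ?N"
    then show "y \<in> V \<and> \<psi> y = G2 (G1 (\<phi> y))" using 1(4)[of y] 2(4)[of y] by auto
  qed
qed

text \<open>One chart at each point replaces the quantification over the atlas; transition maps
  carry the neighbourhood to any atlas chart.\<close>

lemma openin_local:
  assumes "\<And>x. x \<in> W \<Longrightarrow> \<exists>U \<phi> N. (U, \<phi>) \<in> charts M \<and> x \<in> U \<and> open N \<and> \<phi> x \<in> N \<and>
    (\<forall>y\<in>U. \<phi> y \<in> N \<longrightarrow> y \<in> W)"
  shows "openin T W"
  unfolding openin_T
proof (intro conjI subsetI)
  fix x assume "x \<in> W"
  from assms[OF this] show "x \<in> pts M" using chart_subset by blast
next
  show "\<forall>(A, \<theta>)\<in>atlas M. openin (top_of_set E) (\<theta> ` (W \<inter> A))"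
  proof clarify
    fix A \<theta> assume "(A, \<theta>) \<in> atlas M"
    then have A: "(A, \<theta>) \<in> charts M" by (rule atlas_subset_charts)
    show "openin (top_of_set E) (\<theta> ` (W \<inter> A))"
      unfolding openin_subopen[of _ "\<theta> ` (W \<inter> A)"]
    proof
      fix p assume "p \<in> \<theta> ` (W \<inter> A)"
      then obtain x where x: "p = \<theta> x" "x \<in> W" "x \<in> A" by auto
      obtain U \<phi> N where U: "(U, \<phi>) \<in> charts M" "x \<in> U" "open N" "\<phi> x \<in> N"
        "\<forall>y\<in>U. \<phi> y \<in> N \<longrightarrow> y \<in> W" using assms[OF x(2)] by blast
      obtain N1 G where N1: "open N1" "\<theta> x \<in> N1" "Cinf N1 G"
        "\<And>y. y \<in> A \<Longrightarrow> \<theta> y \<in> N1 \<Longrightarrow> y \<in> U \<and> \<phi> y = G (\<theta> y)"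
        using transition[OF A U(1) x(3) U(2)] by metis
      let ?N = "N1 \<inter> G -` N"
      have o: "open ?N"
        using continuous_open_preimage[OF Cinf_continuous_on[OF N1(3)] N1(1) U(3)] .
      have "openin (top_of_set E) (\<theta> ` A \<inter> ?N)"
        using openin_Int_open[OF chart_openin[OF A] o] .
      moreover have "p \<in> \<theta> ` A \<inter> ?N" using x N1(2) N1(4)[OF x(3)] U(4) by auto
      moreover have "\<theta> ` A \<inter> ?N \<subseteq> \<theta> ` (W \<inter> A)" using N1(4) U(5) by fastforce
      ultimately show "\<exists>S'. openin (top_of_set E) S' \<and> p \<in> S' \<and> S' \<subseteq> \<theta> ` (W \<inter> A)" by blast
    qed
  qed
qed

lemma chart_nbhd:
  assumes "openin T W" "(U, \<phi>) \<in> charts M" "x \<in> W" "x \<in> U"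
  obtains N where "open N" "\<phi> x \<in> N" "\<And>y. y \<in> U \<Longrightarrow> \<phi> y \<in> N \<Longrightarrow> y \<in> W"
proof -
  obtain A \<theta> where A: "(A, \<theta>) \<in> atlas M" "x \<in> A"
    using atlas_at chart_subset[OF assms(2)] assms(4) by blast
  have Ac: "(A, \<theta>) \<in> charts M" using A by (simp add: atlas_subset_charts)
  have "openin (top_of_set E) (\<theta> ` (W \<inter> A))" using assms(1) A openin_T by auto
  then obtain N0 where N0: "open N0" "\<And>y. y \<in> A \<Longrightarrow> \<theta> y \<in> N0 \<longleftrightarrow> y \<in> W \<inter> A"
    using relopen_image[OF chart_inj[OF Ac], of "W \<inter> A"] chart_image[OF Ac] by blast
  obtain N1 G where N1: "open N1" "\<phi> x \<in> N1" "Cinf N1 G"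
    "\<And>y. y \<in> U \<Longrightarrow> \<phi> y \<in> N1 \<Longrightarrow> y \<in> A \<and> \<theta> y = G (\<phi> y)"
    using transition[OF assms(2) Ac assms(4) A(2)] by metis
  have o: "open (N1 \<inter> G -` N0)"
    using continuous_open_preimage[OF Cinf_continuous_on[OF N1(3)] N1(1) N0(1)] .
  show thesis
  proof (rule that[OF o])
    show "\<phi> x \<in> N1 \<inter> G -` N0" using N1(2) N1(4)[OF assms(4)] assms(3) N0(2)[of x] A(2) by auto
    fix y assume "y \<in> U" "\<phi> y \<in> N1 \<inter> G -` N0"
    then show "y \<in> W" using N1(4)[of y] N0(2)[of y] by auto
  qed
qed

lemma openin_chart_preimage:
  assumes "(U, \<phi>) \<in> charts M" "open N"
  shows "openin T {y \<in> U. \<phi> y \<in> N}"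
  by (rule openin_local) (use assms in blast)

lemma openin_chart: "(U, \<phi>) \<in> charts M \<Longrightarrow> openin T U"
  using openin_chart_preimage[OF _ open_UNIV] by simp

lemma openin_chart_image:
  assumes "openin T W" "(U, \<phi>) \<in> charts M"
  shows "openin (top_of_set E) (\<phi> ` (W \<inter> U))"
  unfolding openin_subopen[of _ "\<phi> ` (W \<inter> U)"]
proof
  fix p assume "p \<in> \<phi> ` (W \<inter> U)"
  then obtain x where x: "p = \<phi> x" "x \<in> W" "x \<in> U" by auto
  obtain N where N: "open N" "\<phi> x \<in> N" "\<And>y. y \<in> U \<Longrightarrow> \<phi> y \<in> N \<Longrightarrow> y \<in> W"
    using chart_nbhd[OF assms x(2,3)] by metis
  have "openin (top_of_set E) (\<phi> ` U \<inter> N)"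
    using openin_Int_open[OF chart_openin[OF assms(2)] N(1)] .
  moreover have "p \<in> \<phi> ` U \<inter> N" "\<phi> ` U \<inter> N \<subseteq> \<phi> ` (W \<inter> U)" using x N by auto
  ultimately show "\<exists>S'. openin (top_of_set E) S' \<and> p \<in> S' \<and> S' \<subseteq> \<phi> ` (W \<inter> U)" by blast
qed

lemma charts_compatible:
  assumes "c \<in> charts M" "d \<in> charts M"
  shows "compatible M c d"
proof -
  obtain U \<phi> V \<psi> where cd: "c = (U, \<phi>)" "d = (V, \<psi>)" by fastforce
  have sm: "smooth_on (\<phi> ` (U \<inter> V)) (\<psi> \<circ> inv_into U \<phi>)"
    if U: "(U, \<phi>) \<in> charts M" and V: "(V, \<psi>) \<in> charts M" for U \<phi> V \<psi>
    unfolding smooth_on_def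
  proof
    fix p assume "p \<in> \<phi> ` (U \<inter> V)"
    then obtain x where x: "p = \<phi> x" "x \<in> U" "x \<in> V" by auto
    obtain N G where N: "open N" "\<phi> x \<in> N" "Cinf N G"
      "\<And>y. y \<in> U \<Longrightarrow> \<phi> y \<in> N \<Longrightarrow> y \<in> V \<and> \<psi> y = G (\<phi> y)"
      using transition[OF U V x(2,3)] by metis
    then show "\<exists>W g. open W \<and> p \<in> W \<and> (\<forall>k. C_diff k W g) \<and>
        (\<forall>y\<in>\<phi> ` (U \<inter> V) \<inter> W. g y = (\<psi> \<circ> inv_into U \<phi>) y)"
      using x chart_inj[OF U] by (intro exI[of _ N] exI[of _ G]) (auto simp: Cinf_def)
  qed
  have "openin (top_of_set E) (\<phi> ` (U \<inter> V))" "openin (top_of_set E) (\<psi> ` (U \<inter> V))"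
    using openin_chart_image[OF openin_chart] assms cd by (metis Int_commute)+
  then show ?thesis
    using sm[of U \<phi> V \<psi>] sm[of V \<psi> U \<phi>] assms by (auto simp: cd compatible_def Int_commute)
qed

end

text \<open>A function is smooth at \<open>x\<close> if near \<open>x\<close> it is a smooth function of the coordinates of some
  chart; this avoids the inverse charts used in the definition of smoothness on a set.\<close>

definition smooth_at ::
    "('m, 'e::euclidean_space) mfd \<Rightarrow> ('m \<Rightarrow> 'b::euclidean_space) \<Rightarrow> 'm \<Rightarrow> bool" where
  "smooth_at M f x \<longleftrightarrow> (\<exists>U \<phi> N G W. (U, \<phi>) \<in> charts M \<and> open N \<and> Cinf N G \<and>
     openin (mfd_topology M) W \<and> x \<in> W \<and> W \<subseteq> U \<and> \<phi> ` W \<subseteq> N \<and> (\<forall>y\<in>W. f y = G (\<phi> y)))"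

context atlas_mfd
begin

text \<open>The chart in \<open>smooth_at\<close> is existentially quantified. A transition map
  moves the local representation to any prescribed chart around \<open>x\<close>.\<close>

lemma smooth_atE:
  assumes "smooth_at M f x" "(V, \<psi>) \<in> charts M" "x \<in> V"
  obtains N G W where "open N" "Cinf N G" "openin T W" "x \<in> W" "W \<subseteq> V" "\<psi> ` W \<subseteq> N"
    "\<And>y. y \<in> W \<Longrightarrow> f y = G (\<psi> y)"
proof -
  obtain U \<phi> N G W where *: "(U, \<phi>) \<in> charts M" "open N" "Cinf N G"
    "openin T W" "x \<in> W" "W \<subseteq> U" "\<phi> ` W \<subseteq> N" "\<forall>y\<in>W. f y = G (\<phi> y)"
    using assms(1) unfolding smooth_at_def by blast
  obtain N1 G1 where N1: "open N1" "\<psi> x \<in> N1" "Cinf N1 G1"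
    "\<And>y. y \<in> V \<Longrightarrow> \<psi> y \<in> N1 \<Longrightarrow> y \<in> U \<and> \<phi> y = G1 (\<psi> y)"
    using transition[OF assms(2) *(1) assms(3)] * by (metis subsetD)
  let ?N = "N1 \<inter> G1 -` N" and ?W = "W \<inter> {y \<in> V. \<psi> y \<in> N1}"
  have o: "open ?N"
    using continuous_open_preimage[OF Cinf_continuous_on[OF N1(3)] N1(1) *(2)] .
  show thesis
  proof (rule that[OF o])
    show "Cinf ?N (\<lambda>w. G (G1 w))"
      by (rule Cinf_compose[OF o Cinf_subset[OF N1(3)] *(3)]) auto
    show "openin T ?W" using openin_Int[OF *(4) openin_chart_preimage[OF assms(2) N1(1)]] .
    show "x \<in> ?W" using * assms(3) N1 by auto
    show "?W \<subseteq> V" by auto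
    show "\<psi> ` ?W \<subseteq> ?N" using N1(4) *(7) by fastforce
    show "f y = G (G1 (\<psi> y))" if "y \<in> ?W" for y using that *(8) N1(4) by force
  qed
qed

lemma smooth_at_pts: "smooth_at M f x \<Longrightarrow> x \<in> pts M"
  unfolding smooth_at_def using chart_subset by blast

lemma smooth_atE2:
  assumes "smooth_at M f x" "smooth_at M g x"
  obtains V \<psi> N G H W where "(V, \<psi>) \<in> charts M" "x \<in> V" "open N" "Cinf N G" "Cinf N H" "openin T W" "x \<in> W"
    "W \<subseteq> V" "\<psi> ` W \<subseteq> N" "\<And>y. y \<in> W \<Longrightarrow> f y = G (\<psi> y)" "\<And>y. y \<in> W \<Longrightarrow> g y = H (\<psi> y)"
proof -
  obtain V \<psi> where V: "(V, \<psi>) \<in> charts M" "x \<in> V"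
    using chart_at smooth_at_pts[OF assms(1)] .
  obtain N G W where 1: "open N" "Cinf N G" "openin T W" "x \<in> W" "W \<subseteq> V" "\<psi> ` W \<subseteq> N"
    "\<And>y. y \<in> W \<Longrightarrow> f y = G (\<psi> y)" using smooth_atE[OF assms(1) V] by metis
  obtain N' G' W' where 2: "open N'" "Cinf N' G'" "openin T W'" "x \<in> W'" "W' \<subseteq> V" "\<psi> ` W' \<subseteq> N'"
    "\<And>y. y \<in> W' \<Longrightarrow> g y = G' (\<psi> y)" using smooth_atE[OF assms(2) V] by metis
  show thesis
    by (rule that[OF V, of "N \<inter> N'" G G' "W \<inter> W'"])
      (use 1 2 in \<open>auto intro: Cinf_subset\<close>)
qed

lemma smooth_atI:
  assumes "(U, \<phi>) \<in> charts M" "open N" "Cinf N G" "openin T W" "x \<in> W" "W \<subseteq> U" "\<phi> ` W \<subseteq> N"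
    "\<And>y. y \<in> W \<Longrightarrow> f y = G (\<phi> y)"
  shows "smooth_at M f x"
  using assms unfolding smooth_at_def by blast

lemma smooth_at_cong:
  assumes "smooth_at M f x" "openin T W" "x \<in> W" "\<And>y. y \<in> W \<Longrightarrow> f y = g y"
  shows "smooth_at M g x"
proof -
  obtain U \<phi> where U: "(U, \<phi>) \<in> charts M" "x \<in> U" using chart_at smooth_at_pts[OF assms(1)] .
  obtain N G W' where 1: "open N" "Cinf N G" "openin T W'" "x \<in> W'" "W' \<subseteq> U" "\<phi> ` W' \<subseteq> N"
    "\<And>y. y \<in> W' \<Longrightarrow> f y = G (\<phi> y)" using smooth_atE[OF assms(1) U] by metis
  show ?thesis
    by (rule smooth_atI[OF U(1) 1(1,2) openin_Int[OF 1(3) assms(2)]])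
      (use 1(4-6) 1(7) assms(3) assms(4)[symmetric] in auto)
qed

lemma smooth_at_chart:
  assumes "(U, \<phi>) \<in> charts M" "x \<in> U" shows "smooth_at M \<phi> x"
  by (rule smooth_atI[OF assms(1) open_UNIV Cinf_linear[OF open_UNIV bounded_linear_ident]
        openin_chart[OF assms(1)] assms(2)]) auto

lemma smooth_at_const: "x \<in> pts M \<Longrightarrow> smooth_at M (\<lambda>y. c) x"
  by (metis chart_at smooth_atI Cinf_const open_UNIV openin_chart subset_refl subset_UNIV)

lemma smooth_at_continuous:
  assumes "smooth_at M f x" "open A" "f x \<in> A"
  obtains W where "openin T W" "x \<in> W" "\<And>y. y \<in> W \<Longrightarrow> f y \<in> A"
proof -
  obtain U \<phi> where U: "(U, \<phi>) \<in> charts M" "x \<in> U" using chart_at smooth_at_pts[OF assms(1)] .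
  obtain N G W' where 1: "open N" "Cinf N G" "openin T W'" "x \<in> W'" "W' \<subseteq> U" "\<phi> ` W' \<subseteq> N"
    "\<And>y. y \<in> W' \<Longrightarrow> f y = G (\<phi> y)" using smooth_atE[OF assms(1) U] by metis
  have o: "open (N \<inter> G -` A)"
    using continuous_open_preimage[OF Cinf_continuous_on[OF 1(2)] 1(1) assms(2)] .
  show thesis
    by (rule that[OF openin_Int[OF 1(3) openin_chart_preimage[OF U(1) o]]])
      (use 1 U assms(3) in auto)
qed

lemma smooth_at_compose:
  assumes "smooth_at M f x" "open A" "Cinf A g" "f x \<in> A"
  shows "smooth_at M (\<lambda>y. g (f y)) x"
proof -
  obtain U \<phi> where U: "(U, \<phi>) \<in> charts M" "x \<in> U" using chart_at smooth_at_pts[OF assms(1)] .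
  obtain N G W' where 1: "open N" "Cinf N G" "openin T W'" "x \<in> W'" "W' \<subseteq> U" "\<phi> ` W' \<subseteq> N"
    "\<And>y. y \<in> W' \<Longrightarrow> f y = G (\<phi> y)" using smooth_atE[OF assms(1) U] by metis
  obtain W where W: "openin T W" "x \<in> W" "\<And>y. y \<in> W \<Longrightarrow> f y \<in> A"
    using smooth_at_continuous[OF assms(1,2,4)] by metis
  have o: "open (N \<inter> G -` A)"
    using continuous_open_preimage[OF Cinf_continuous_on[OF 1(2)] 1(1) assms(2)] .
  have c: "Cinf (N \<inter> G -` A) (\<lambda>w. g (G w))"
    by (rule Cinf_compose[OF o Cinf_subset[OF 1(2)] assms(3)]) auto
  have "G (\<phi> y) \<in> A" if "y \<in> W' \<inter> W" for y
    using that 1(7) W(3) by (metis IntD1 IntD2)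
  then show ?thesis
    by (intro smooth_atI[OF U(1) o c openin_Int[OF 1(3) W(1)]]) (use 1 W(2) in auto)
qed

lemma smooth_at_linear: "bounded_linear g \<Longrightarrow> smooth_at M f x \<Longrightarrow> smooth_at M (\<lambda>y. g (f y)) x"
  by (rule smooth_at_compose[OF _ open_UNIV Cinf_linear]) auto

lemma smooth_at_bilinear:
  assumes "bounded_bilinear B" "smooth_at M f x" "smooth_at M g x"
  shows "smooth_at M (\<lambda>y. B (f y) (g y)) x"
proof -
  obtain V \<psi> N G H W where *: "(V, \<psi>) \<in> charts M" "x \<in> V" "open N" "Cinf N G" "Cinf N H" "openin T W" "x \<in> W"
    "W \<subseteq> V" "\<psi> ` W \<subseteq> N" "\<And>y. y \<in> W \<Longrightarrow> f y = G (\<psi> y)" "\<And>y. y \<in> W \<Longrightarrow> g y = H (\<psi> y)"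
    using smooth_atE2[OF assms(2,3)] by metis
  show ?thesis
    by (rule smooth_atI[OF *(1,3) Cinf_bilinear[OF assms(1) *(3,4,5)] *(6-9)]) (use * in auto)
qed

lemma smooth_at_add:
  assumes "smooth_at M f x" "smooth_at M g x"
  shows "smooth_at M (\<lambda>y. f y + g y) x"
proof -
  obtain V \<psi> N G H W where *: "(V, \<psi>) \<in> charts M" "x \<in> V" "open N" "Cinf N G" "Cinf N H" "openin T W" "x \<in> W"
    "W \<subseteq> V" "\<psi> ` W \<subseteq> N" "\<And>y. y \<in> W \<Longrightarrow> f y = G (\<psi> y)" "\<And>y. y \<in> W \<Longrightarrow> g y = H (\<psi> y)"
    using smooth_atE2[OF assms] by metis
  show ?thesis
    by (rule smooth_atI[OF *(1,3) Cinf_add[OF *(3,4,5)] *(6-9)]) (use * in auto)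
qed

lemmas smooth_at_mult = smooth_at_bilinear[OF bounded_bilinear_mult[where 'a = real]]
lemmas smooth_at_scaleR = smooth_at_bilinear[OF bounded_bilinear_scaleR]
lemmas smooth_at_inner = smooth_at_bilinear[OF bounded_bilinear_inner]

lemma smooth_at_sum:
  assumes "x \<in> pts M" "\<And>i. i \<in> A \<Longrightarrow> smooth_at M (f i) x"
  shows "smooth_at M (\<lambda>y. \<Sum>i\<in>A. f i y) x"
  using assms(2)
  by (induction A rule: infinite_finite_induct) (auto intro!: smooth_at_add smooth_at_const assms(1))

lemma smooth_at_smooth_on:
  assumes "(U, \<phi>) \<in> charts M" "A \<subseteq> U" "\<And>x. x \<in> A \<Longrightarrow> smooth_at M f x"
  shows "smooth_on (\<phi> ` A) (f \<circ> inv_into U \<phi>)"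
  unfolding smooth_on_def
proof
  fix p assume "p \<in> \<phi> ` A"
  then obtain x where x: "p = \<phi> x" "x \<in> A" "x \<in> U" using assms(2) by auto
  obtain N G W where 1: "open N" "Cinf N G" "openin T W" "x \<in> W" "W \<subseteq> U" "\<phi> ` W \<subseteq> N"
    "\<And>y. y \<in> W \<Longrightarrow> f y = G (\<phi> y)" using smooth_atE[OF assms(3)[OF x(2)] assms(1) x(3)] by metis
  obtain N2 where N2: "open N2" "\<phi> x \<in> N2" "\<And>y. y \<in> U \<Longrightarrow> \<phi> y \<in> N2 \<Longrightarrow> y \<in> W"
    using chart_nbhd[OF 1(3) assms(1) 1(4) x(3)] by metis
  show "\<exists>W g. open W \<and> p \<in> W \<and> (\<forall>k. C_diff k W g) \<and> (\<forall>y\<in>\<phi> ` A \<inter> W. g y = (f \<circ> inv_into U \<phi>) y)"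
    using 1 N2 x assms(2) chart_inj[OF assms(1)] Cinf_subset[OF 1(2), of "N \<inter> N2"]
    by (intro exI[of _ "N \<inter> N2"] exI[of _ G]) (auto simp: Cinf_def subset_iff)
qed

lemma smooth_fun_onI:
  assumes "W \<subseteq> pts M" "\<And>x. x \<in> W \<Longrightarrow> smooth_at M f x"
  shows "smooth_fun_on M W f"
  unfolding smooth_fun_on_def
proof clarify
  fix U \<phi> assume "(U, \<phi>) \<in> atlas M"
  then show "smooth_on (\<phi> ` (U \<inter> W)) (f \<circ> inv_into U \<phi>)"
    by (rule smooth_at_smooth_on[OF atlas_subset_charts]) (use assms(2) in auto)
qed

lemma smooth_fun_onD:
  assumes "openin T W" "smooth_fun_on M W f" "x \<in> W"
  shows "smooth_at M f x"
proof -
  have "x \<in> pts M" using assms openin_T by auto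
  then obtain U \<phi> where U: "(U, \<phi>) \<in> atlas M" "x \<in> U" by (rule atlas_at)
  then have Uc: "(U, \<phi>) \<in> charts M" by (simp add: atlas_subset_charts)
  have "smooth_on (\<phi> ` (U \<inter> W)) (f \<circ> inv_into U \<phi>)"
    using assms(2) U unfolding smooth_fun_on_def by auto
  then obtain N G where N: "open N" "\<phi> x \<in> N" "\<forall>k. C_diff k N G"
    "\<forall>y\<in>\<phi> ` (U \<inter> W) \<inter> N. G y = (f \<circ> inv_into U \<phi>) y"
    using U assms(3) unfolding smooth_on_def by blast
  show ?thesis
    by (rule smooth_atI[OF Uc N(1) _ openin_Int[OF assms(1) openin_chart_preimage[OF Uc N(1)]]])
      (use N U assms chart_inj[OF Uc] in \<open>auto simp: Cinf_def\<close>)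
qed

lemma smooth_fun_on_iff:
  assumes "openin T W"
  shows "smooth_fun_on M W f \<longleftrightarrow> (\<forall>x\<in>W. smooth_at M f x)"
proof
  assume "smooth_fun_on M W f"
  then show "\<forall>x\<in>W. smooth_at M f x" using smooth_fun_onD[OF assms] by simp
next
  assume "\<forall>x\<in>W. smooth_at M f x"
  then show "smooth_fun_on M W f" using smooth_fun_onI[of W f] assms openin_T by simp
qed

lemma smooth_functions_iff:
  "f \<in> smooth_functions M \<longleftrightarrow> (\<forall>x\<in>pts M. smooth_at M f x) \<and> (\<forall>x. x \<notin> pts M \<longrightarrow> f x = 0)"
  by (simp add: smooth_functions_def smooth_fun_on_iff[OF openin_pts])

lemma smooth_functions_smooth_at: "f \<in> smooth_functions M \<Longrightarrow> x \<in> pts M \<Longrightarrow> smooth_at M f x"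
  by (simp add: smooth_functions_iff)

lemma smooth_functions_add:
  "f \<in> smooth_functions M \<Longrightarrow> g \<in> smooth_functions M \<Longrightarrow> (\<lambda>y. f y + g y) \<in> smooth_functions M"
  by (simp add: smooth_functions_iff smooth_at_add)

lemma smooth_functions_mult:
  "f \<in> smooth_functions M \<Longrightarrow> g \<in> smooth_functions M \<Longrightarrow> (\<lambda>y. f y * g y) \<in> smooth_functions M"
  by (simp add: smooth_functions_iff smooth_at_mult)

lemma smooth_functions_one: "(\<lambda>y. if y \<in> pts M then c else 0) \<in> smooth_functions M"
  using smooth_at_cong[OF smooth_at_const openin_pts, of _ c]
  by (auto simp: smooth_functions_iff)

lemma smooth_functions_cmult:
  "f \<in> smooth_functions M \<Longrightarrow> (\<lambda>y. c * f y) \<in> smooth_functions M"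
  by (simp add: smooth_functions_iff smooth_at_mult smooth_at_const)

lemma smooth_functions_sum:
  "(\<And>i. i \<in> A \<Longrightarrow> f i \<in> smooth_functions M) \<Longrightarrow> (\<lambda>y. \<Sum>i\<in>A. f i y) \<in> smooth_functions M"
  by (auto simp: smooth_functions_iff intro!: smooth_at_sum sum.neutral)

end

section \<open>Smooth maps and coordinate derivatives\<close>

text \<open>Continuity is built in: a neighbourhood of \<open>x\<close> goes into the domain of one
  chart of the target, and the coordinates of \<open>b\<close> are smooth there as functions.
  Preimages of smaller open sets follow from continuity of these coordinates.\<close>

definition smooth_map_at ::
    "('m, 'e::euclidean_space) mfd \<Rightarrow> ('n, 'f::euclidean_space) mfd \<Rightarrow> ('m \<Rightarrow> 'n) \<Rightarrow> 'm \<Rightarrow> bool" where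
  "smooth_map_at M N b x \<longleftrightarrow> (\<exists>V \<psi> W. (V, \<psi>) \<in> charts N \<and> openin (mfd_topology M) W \<and> x \<in> W \<and>
     b ` W \<subseteq> V \<and> smooth_at M (\<lambda>y. \<psi> (b y)) x)"

lemma smooth_map_at_preimage:
  assumes M: "atlas_mfd M" and N: "atlas_mfd N" and b: "smooth_map_at M N b x"
    and A: "openin (mfd_topology N) A" "b x \<in> A"
  obtains W where "openin (mfd_topology M) W" "x \<in> W" "b ` W \<subseteq> A"
proof -
  interpret M: atlas_mfd M by (rule M)
  interpret N: atlas_mfd N by (rule N)
  obtain V \<psi> W where V: "(V, \<psi>) \<in> charts N" "openin M.T W" "x \<in> W" "b ` W \<subseteq> V"
    "smooth_at M (\<lambda>y. \<psi> (b y)) x" using b unfolding smooth_map_at_def by blast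
  have "b x \<in> V" using V by auto
  then obtain O' where O: "open O'" "\<psi> (b x) \<in> O'" "\<And>y. y \<in> V \<Longrightarrow> \<psi> y \<in> O' \<Longrightarrow> y \<in> A"
    using N.chart_nbhd[OF A(1) V(1) A(2)] by metis
  obtain W' where W': "openin M.T W'" "x \<in> W'" "\<And>y. y \<in> W' \<Longrightarrow> \<psi> (b y) \<in> O'"
    using M.smooth_at_continuous[OF V(5) O(1,2)] by metis
  show thesis
    by (rule that[OF openin_Int[OF V(2) W'(1)]]) (use V W' O in auto)
qed

lemma smooth_at_pullback:
  assumes M: "atlas_mfd M" and N: "atlas_mfd N" and b: "smooth_map_at M N b x" and f: "smooth_at N f (b x)"
  shows "smooth_at M (\<lambda>y. f (b y)) x"
proof -
  interpret M: atlas_mfd M by (rule M)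
  interpret N: atlas_mfd N by (rule N)
  obtain V \<psi> W where V: "(V, \<psi>) \<in> charts N" "openin M.T W" "x \<in> W" "b ` W \<subseteq> V"
    "smooth_at M (\<lambda>y. \<psi> (b y)) x" using b unfolding smooth_map_at_def by blast
  have "b x \<in> V" using V by auto
  then obtain O' G A where G: "open O'" "Cinf O' G" "openin N.T A" "b x \<in> A" "A \<subseteq> V" "\<psi> ` A \<subseteq> O'"
    "\<And>y. y \<in> A \<Longrightarrow> f y = G (\<psi> y)" using N.smooth_atE[OF f V(1)] by metis
  obtain W' where W': "openin M.T W'" "x \<in> W'" "b ` W' \<subseteq> A"
    using smooth_map_at_preimage[OF M N b G(3,4)] by metis
  have "smooth_at M (\<lambda>y. G (\<psi> (b y))) x"
    by (rule M.smooth_at_compose[OF V(5) G(1,2)]) (use G in auto)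
  then show ?thesis
    by (rule M.smooth_at_cong[OF _ W'(1,2)]) (use G(7) W'(3) in auto)
qed

lemma smooth_map_atI:
  assumes M: "atlas_mfd M" and N: "atlas_mfd N"
    and b: "\<And>x. x \<in> pts M \<Longrightarrow> smooth_map_at M N b x"
  shows "smooth_map M N b"
  unfolding smooth_map_def
proof (intro conjI)
  interpret M: atlas_mfd M by (rule M)
  interpret N: atlas_mfd N by (rule N)
  show img: "b ` pts M \<subseteq> pts N"
    using b N.chart_subset unfolding smooth_map_at_def by fastforce
  show "continuous_map M.T N.T b"
    unfolding continuous_map_def M.topspace_T N.topspace_T
  proof (intro conjI allI impI)
    show "b \<in> pts M \<rightarrow> pts N" using img by auto
    fix A assume A: "openin N.T A"
    show "openin M.T {x \<in> pts M. b x \<in> A}"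
      unfolding openin_subopen[of _ "{x \<in> pts M. b x \<in> A}"]
    proof clarify
      fix x assume x: "x \<in> pts M" "b x \<in> A"
      obtain W where W: "openin M.T W" "x \<in> W" "b ` W \<subseteq> A"
        using smooth_map_at_preimage[OF M N b[OF x(1)] A x(2)] by metis
      have "W \<subseteq> pts M" using W(1) M.openin_T by auto
      then show "\<exists>W. openin M.T W \<and> x \<in> W \<and> W \<subseteq> {x \<in> pts M. b x \<in> A}" using W by blast
    qed
  qed
  show "\<forall>(U, \<phi>)\<in>atlas M. \<forall>(V, \<psi>)\<in>atlas N. smooth_on (\<phi> ` (U \<inter> b -` V)) (\<psi> \<circ> b \<circ> inv_into U \<phi>)"
  proof clarify
    fix U \<phi> V \<psi> assume "(U, \<phi>) \<in> atlas M" "(V, \<psi>) \<in> atlas N"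
    then have U: "(U, \<phi>) \<in> charts M" and V: "(V, \<psi>) \<in> charts N"
      by (simp_all add: M.atlas_subset_charts N.atlas_subset_charts)
    have "smooth_on (\<phi> ` (U \<inter> b -` V)) ((\<lambda>y. \<psi> (b y)) \<circ> inv_into U \<phi>)"
    proof (rule M.smooth_at_smooth_on[OF U])
      fix x assume x: "x \<in> U \<inter> b -` V"
      then have "x \<in> pts M" using M.chart_subset[OF U] by auto
      then show "smooth_at M (\<lambda>y. \<psi> (b y)) x"
        by (intro smooth_at_pullback[OF M N b] N.smooth_at_chart[OF V]) (use x in auto)
    qed simp
    then show "smooth_on (\<phi> ` (U \<inter> b -` V)) (\<psi> \<circ> b \<circ> inv_into U \<phi>)"
      by (simp add: comp_def)
  qed
qed

text \<open>Written with the same expression as in \<open>jet_coords\<close>, whose third component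
  thus unfolds to the \<open>grad\<close> of a coefficient function.\<close>

definition partial ::
    "'m set \<Rightarrow> ('m \<Rightarrow> 'e::euclidean_space) \<Rightarrow> 'e \<Rightarrow> ('m \<Rightarrow> real) \<Rightarrow> 'm \<Rightarrow> real" where
  "partial U \<phi> b f x = deriv (\<lambda>t. f (inv_into U \<phi> (\<phi> x + t *\<^sub>R b))) 0"

definition grad ::
    "'e::euclidean_space set \<Rightarrow> 'm set \<Rightarrow> ('m \<Rightarrow> 'e) \<Rightarrow> ('m \<Rightarrow> real) \<Rightarrow> 'm \<Rightarrow> 'e" where
  "grad B U \<phi> f x = (\<Sum>b\<in>B. partial U \<phi> b f x *\<^sub>R b)"

lemma sum_Basis_inner:
  assumes "B \<subseteq> Basis" "c \<in> B"
  shows "(\<Sum>b\<in>B. k b *\<^sub>R b) \<bullet> c = (k c :: real)"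
proof -
  have "(\<Sum>b\<in>B. k b *\<^sub>R b) \<bullet> c = (\<Sum>b\<in>B. if b = c then k b else 0)"
    unfolding inner_sum_left using assms
    by (intro sum.cong) (auto simp: inner_Basis subset_iff)
  then show ?thesis using assms finite_subset[OF assms(1) finite_Basis] by simp
qed

lemma span_Basis_subset_inner:
  assumes "B \<subseteq> Basis" "v \<in> span B" "c \<in> Basis" "c \<notin> B"
  shows "v \<bullet> c = 0"
  using assms(2)
proof (induction rule: span_induct_alt)
  case base then show ?case by simp
next
  case (step k x y)
  then have "x \<bullet> c = 0" using assms by (auto simp: inner_Basis subset_iff)
  with step show ?case by (simp add: inner_add_left)
qed

lemma span_Basis_subset_iff:
  assumes "B \<subseteq> Basis"
  shows "v \<in> span B \<longleftrightarrow> (\<forall>c\<in>Basis - B. v \<bullet> c = 0)"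
proof
  assume "v \<in> span B" then show "\<forall>c\<in>Basis - B. v \<bullet> c = 0"
    using span_Basis_subset_inner[OF assms] by auto
next
  assume *: "\<forall>c\<in>Basis - B. v \<bullet> c = 0"
  have "v = (\<Sum>b\<in>Basis. (v \<bullet> b) *\<^sub>R b)" by (simp add: euclidean_representation)
  also have "\<dots> = (\<Sum>b\<in>B. (v \<bullet> b) *\<^sub>R b)"
    by (rule sum.mono_neutral_right) (use assms * in auto)
  finally show "v \<in> span B" by (metis (no_types, lifting) span_base span_scale span_sum)
qed

lemma span_Basis_eqI:
  assumes "B \<subseteq> Basis" "v \<in> span B" "w \<in> span B" "\<And>b. b \<in> B \<Longrightarrow> v \<bullet> b = w \<bullet> b"
  shows "v = w"
proof (rule euclidean_eqI)
  fix b :: 'a assume "b \<in> Basis"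
  then show "v \<bullet> b = w \<bullet> b"
    using assms span_Basis_subset_inner[OF assms(1)] by (cases "b \<in> B") auto
qed

lemma span_Basis_expand:
  assumes "B \<subseteq> Basis" "v \<in> span B"
  shows "(\<Sum>b\<in>B. (v \<bullet> b) *\<^sub>R b) = v"
proof (rule span_Basis_eqI[OF assms(1) _ assms(2)])
  show "(\<Sum>b\<in>B. (v \<bullet> b) *\<^sub>R b) \<in> span B" by (intro span_sum span_scale) (rule span_base)
qed (simp add: sum_Basis_inner[OF assms(1)])

lemma grad_in_span: "grad B U \<phi> f x \<in> span B"
  unfolding grad_def by (intro span_sum span_scale span_base)

context atlas_mfd
begin

text \<open>Since \<open>b\<close> belongs to the model, the line through \<open>\<phi> x\<close> in
  direction \<open>b\<close> stays in \<open>E\<close> and, for small \<open>t\<close>, in the chart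
  image. Every smooth extension \<open>G\<close> therefore has the same derivative in this
  direction.\<close>

lemma partial_rep:
  assumes U: "(U, \<phi>) \<in> charts M" and W: "openin T W" "x \<in> W" "W \<subseteq> U" "\<phi> ` W \<subseteq> N"
    and G: "open N" "Cinf N G" "\<And>y. y \<in> W \<Longrightarrow> f y = G (\<phi> y)" and b: "b \<in> model M"
  shows "((\<lambda>t. f (inv_into U \<phi> (\<phi> x + t *\<^sub>R b))) has_real_derivative
    frechet_derivative G (at (\<phi> x)) b) (at 0)"
proof -
  have x: "x \<in> U" using W by auto
  obtain N2 where N2: "open N2" "\<phi> x \<in> N2" "\<And>y. y \<in> U \<Longrightarrow> \<phi> y \<in> N2 \<Longrightarrow> y \<in> W"
    using chart_nbhd[OF W(1) U W(2) x] by metis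
  obtain N3 where N3: "open N3" "\<phi> ` U = E \<inter> N3"
    using chart_openin[OF U] openin_open by metis
  let ?l = "\<lambda>t::real. \<phi> x + t *\<^sub>R b"
  have o: "open (?l -` (N2 \<inter> N3))"
    by (rule open_vimage[OF open_Int[OF N2(1) N3(1)]]) (intro continuous_intros)
  have "((\<lambda>t. \<phi> x + t *\<^sub>R b) has_derivative (\<lambda>t. t *\<^sub>R b)) (at 0)"
    by (auto intro!: derivative_eq_intros)
  moreover have d: "(G has_derivative frechet_derivative G (at (\<phi> x))) (at (?l 0))"
    using Cinf_has_derivative[OF G(2), of "\<phi> x"] W(2,4) by auto
  ultimately have "((\<lambda>t. G (?l t)) has_derivative (\<lambda>t. frechet_derivative G (at (\<phi> x)) (t *\<^sub>R b))) (at 0)"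
    by (rule has_derivative_compose)
  then have "((\<lambda>t. G (?l t)) has_real_derivative frechet_derivative G (at (\<phi> x)) b) (at 0)"
    unfolding has_field_derivative_def linear_scale[OF has_derivative_linear[OF d]]
    by (rule has_derivative_eq_rhs) (simp add: fun_eq_iff)
  then show ?thesis
  proof (rule has_field_derivative_transform_within_open[OF _ o])
    show "0 \<in> ?l -` (N2 \<inter> N3)" using N2 N3 x by auto
    fix t assume t: "t \<in> ?l -` (N2 \<inter> N3)"
    have "?l t \<in> E" using chart_image[OF U x] b by (simp add: span_add span_scale span_base)
    then have "?l t \<in> \<phi> ` U" using t N3(2) by simp
    then obtain y where y: "?l t = \<phi> y" "y \<in> U" by (rule imageE)
    then have "y \<in> W" using N2(3)[of y] t by simp
    then show "G (?l t) = f (inv_into U \<phi> (?l t))"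
      unfolding y(1) inv_into_f_f[OF chart_inj[OF U] y(2)] using G(3) by simp
  qed
qed

lemmas partial_eq = DERIV_imp_deriv[OF partial_rep, folded partial_def]

lemma has_partial:
  assumes "smooth_at M f x" "(U, \<phi>) \<in> charts M" "x \<in> U" "b \<in> model M"
  shows "((\<lambda>t. f (inv_into U \<phi> (\<phi> x + t *\<^sub>R b))) has_real_derivative partial U \<phi> b f x) (at 0)"
proof -
  obtain N G W where 1: "open N" "Cinf N G" "openin T W" "x \<in> W" "W \<subseteq> U" "\<phi> ` W \<subseteq> N"
    "\<And>y. y \<in> W \<Longrightarrow> f y = G (\<phi> y)" using smooth_atE[OF assms(1-3)] by metis
  have "partial U \<phi> b f x = frechet_derivative G (at (\<phi> x)) b"
    by (rule partial_eq[OF assms(2) 1(3-6) 1(1,2,7) assms(4)])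
  then show ?thesis
    using partial_rep[OF assms(2) 1(3-6) 1(1,2,7) assms(4)] by simp
qed

lemma smooth_at_partial:
  assumes "smooth_at M f x" "(U, \<phi>) \<in> charts M" "x \<in> U" "b \<in> model M"
  shows "smooth_at M (partial U \<phi> b f) x"
proof -
  obtain N G W where 1: "open N" "Cinf N G" "openin T W" "x \<in> W" "W \<subseteq> U" "\<phi> ` W \<subseteq> N"
    "\<And>y. y \<in> W \<Longrightarrow> f y = G (\<phi> y)" using smooth_atE[OF assms(1-3)] by metis
  show ?thesis
    by (rule smooth_atI[OF assms(2) 1(1) Cinf_derivative[OF 1(2)] 1(3-6)])
      (rule partial_eq[OF assms(2) 1(3) _ 1(5,6,1,2,7) assms(4)])
qed

context
  fixes U \<phi> x b assumes U: "(U, \<phi>) \<in> charts M" and x: "x \<in> U" and b: "b \<in> model M"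
begin

lemma partial_cong:
  assumes "smooth_at M f x" "openin T W" "x \<in> W" "\<And>y. y \<in> W \<Longrightarrow> f y = g y"
  shows "partial U \<phi> b g x = partial U \<phi> b f x"
proof -
  obtain N G W' where 1: "open N" "Cinf N G" "openin T W'" "x \<in> W'" "W' \<subseteq> U" "\<phi> ` W' \<subseteq> N"
    "\<And>y. y \<in> W' \<Longrightarrow> f y = G (\<phi> y)" using smooth_atE[OF assms(1) U x] by metis
  have "partial U \<phi> b f x = frechet_derivative G (at (\<phi> x)) b"
    by (rule partial_eq[OF U 1(3-6) 1(1,2,7) b])
  moreover have "partial U \<phi> b g x = frechet_derivative G (at (\<phi> x)) b"
  proof (rule partial_eq[OF U openin_Int[OF 1(3) assms(2)] _ _ _ 1(1,2) _ b])
    show "x \<in> W' \<inter> W" "W' \<inter> W \<subseteq> U" "\<phi> ` (W' \<inter> W) \<subseteq> N"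
      using 1(4-6) assms(3) by auto
    show "g y = G (\<phi> y)" if "y \<in> W' \<inter> W" for y
      using that 1(7)[of y] assms(4)[of y] by simp
  qed
  ultimately show ?thesis by simp
qed

lemma partial_add:
  "smooth_at M f x \<Longrightarrow> smooth_at M g x \<Longrightarrow>
    partial U \<phi> b (\<lambda>y. f y + g y) x = partial U \<phi> b f x + partial U \<phi> b g x"
  unfolding partial_def[of U \<phi> b "\<lambda>y. f y + g y"]
  using DERIV_imp_deriv[OF DERIV_add[OF has_partial[OF _ U x b] has_partial[OF _ U x b]]] .

lemma partial_mult:
  assumes "smooth_at M f x" "smooth_at M g x"
  shows "partial U \<phi> b (\<lambda>y. f y * g y) x = f x * partial U \<phi> b g x + partial U \<phi> b f x * g x"
proof -
  have "inv_into U \<phi> (\<phi> x + 0 *\<^sub>R b) = x" using chart_inj[OF U] x by simp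
  then show ?thesis
    unfolding partial_def[of U \<phi> b "\<lambda>y. f y * g y"]
    using DERIV_imp_deriv[OF DERIV_mult[OF has_partial[OF assms(1) U x b] has_partial[OF assms(2) U x b]]]
    by simp
qed

lemma partial_cmult: "smooth_at M f x \<Longrightarrow> partial U \<phi> b (\<lambda>y. c * f y) x = c * partial U \<phi> b f x"
  unfolding partial_def[of U \<phi> b "\<lambda>y. c * f y"]
  using DERIV_imp_deriv[OF DERIV_cmult[OF has_partial[OF _ U x b]]] .

lemma partial_coordinate: "partial U \<phi> b (\<lambda>y. w \<bullet> \<phi> y) x = w \<bullet> b"
proof -
  have "partial U \<phi> b (\<lambda>y. w \<bullet> \<phi> y) x = frechet_derivative (\<lambda>v. w \<bullet> v) (at (\<phi> x)) b"
    by (rule partial_eq[OF U openin_chart[OF U] x _ _ open_UNIV Cinf_linear[OF open_UNIV] _ b])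
      (auto simp: bounded_linear_inner_right)
  then show ?thesis
    using frechet_derivative_at[OF bounded_linear_imp_has_derivative[OF bounded_linear_inner_right]] by metis
qed

end

lemma partial_change:
  assumes U: "(U, \<phi>) \<in> charts M" "x \<in> U" and V: "(V, \<psi>) \<in> charts M" "x \<in> V"
    and b: "b \<in> model M" and f: "smooth_at M f x"
  shows "partial V \<psi> b f x = (\<Sum>c\<in>model M. partial U \<phi> c f x * partial V \<psi> b (\<lambda>y. c \<bullet> \<phi> y) x)"
proof -
  obtain N G W where 1: "open N" "Cinf N G" "openin T W" "x \<in> W" "W \<subseteq> U" "\<phi> ` W \<subseteq> N"
    "\<And>y. y \<in> W \<Longrightarrow> f y = G (\<phi> y)" using smooth_atE[OF f U] by metis
  obtain N' H W' where 2: "open N'" "Cinf N' H" "openin T W'" "x \<in> W'" "W' \<subseteq> V" "\<psi> ` W' \<subseteq> N'"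
    "\<And>y. y \<in> W' \<Longrightarrow> \<phi> y = H (\<psi> y)" using smooth_atE[OF smooth_at_chart[OF U] V] by metis
  let ?N = "N' \<inter> H -` N" and ?W = "W \<inter> W'"
  let ?H = "frechet_derivative H (at (\<psi> x))" and ?G = "frechet_derivative G (at (\<phi> x))"
  have o: "open ?N"
    using continuous_open_preimage[OF Cinf_continuous_on[OF 2(2)] 2(1) 1(1)] .
  have c: "Cinf ?N (\<lambda>w. G (H w))"
    by (rule Cinf_compose[OF o Cinf_subset[OF 2(2)] 1(2)]) auto
  have H: "(H has_derivative ?H) (at (\<psi> x))"
    using Cinf_has_derivative[OF 2(2)] 2(4,6) by auto
  have "\<phi> x = H (\<psi> x)" using 2(4,7) by auto
  then have G: "(G has_derivative ?G) (at (H (\<psi> x)))"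
    using Cinf_has_derivative[OF 1(2), of "\<phi> x"] 1(4,6) by auto
  have im: "\<psi> ` ?W \<subseteq> ?N"
  proof clarify
    fix y assume y: "y \<in> W" "y \<in> W'"
    then show "\<psi> y \<in> ?N" using 1(6) 2(6) 2(7)[OF y(2)] by auto
  qed
  have fG: "f y = G (H (\<psi> y))" if "y \<in> ?W" for y
    using that 1(7)[of y] 2(7)[of y] by simp
  have "partial V \<psi> b f x = frechet_derivative (\<lambda>w. G (H w)) (at (\<psi> x)) b"
    by (rule partial_eq[OF V(1) openin_Int[OF 1(3) 2(3)] _ _ im o c fG b]) (use 1 2 in auto)
  also have "\<dots> = ?G (?H b)"
    by (rule fun_cong[OF frechet_derivative_at[OF has_derivative_compose[OF H G], symmetric]])
  also have "\<dots> = ?G (\<Sum>c\<in>Basis. (?H b \<bullet> c) *\<^sub>R c)" by (simp add: euclidean_representation)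
  also have "\<dots> = (\<Sum>c\<in>Basis. ?G c * (?H b \<bullet> c))"
    by (simp add: linear_sum[OF has_derivative_linear[OF G]] linear_scale[OF has_derivative_linear[OF G]]
        mult.commute)
  also have "\<dots> = (\<Sum>c\<in>Basis. ?G c * partial V \<psi> b (\<lambda>y. c \<bullet> \<phi> y) x)"
  proof (rule sum.cong[OF refl])
    fix c :: 'e
    have cH: "Cinf N' (\<lambda>w. c \<bullet> H w)"
      by (rule Cinf_bilinear[OF bounded_bilinear_inner 2(1) Cinf_const[OF 2(1)] 2(2)])
    have cG: "c \<bullet> \<phi> y = c \<bullet> H (\<psi> y)" if "y \<in> W'" for y
      using 2(7)[OF that] by simp
    have "partial V \<psi> b (\<lambda>y. c \<bullet> \<phi> y) x = frechet_derivative (\<lambda>w. c \<bullet> H w) (at (\<psi> x)) b"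
      by (rule partial_eq[OF V(1) 2(3-6) 2(1) cH cG b])
    also have "\<dots> = c \<bullet> ?H b"
      by (rule fun_cong[OF frechet_derivative_at[OF has_derivative_inner_right[OF H, of c], symmetric]])
    finally show "?G c * (?H b \<bullet> c) = ?G c * partial V \<psi> b (\<lambda>y. c \<bullet> \<phi> y) x"
      by (simp add: inner_commute)
  qed
  \<comment> \<open>Derivatives of the extension \<open>G\<close> in directions outside the model
    are not determined by \<open>f\<close>. They drop out because the corresponding coordinates of
    \<open>\<phi>\<close> vanish identically.\<close>
  also have "\<dots> = (\<Sum>c\<in>model M. ?G c * partial V \<psi> b (\<lambda>y. c \<bullet> \<phi> y) x)"
  proof (rule sum.mono_neutral_right[OF finite_Basis model_Basis], rule ballI)
    fix c assume c: "c \<in> Basis - model M"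
    have z: "c \<bullet> \<phi> y = 0" if "y \<in> U" for y
      using span_Basis_subset_inner[OF model_Basis chart_image[OF U(1) that]] c by (simp add: inner_commute)
    have "partial V \<psi> b (\<lambda>y. c \<bullet> \<phi> y) x = partial V \<psi> b (\<lambda>y. 0) x"
      by (rule partial_cong[OF V b smooth_at_const openin_chart[OF U(1)] U(2)])
        (use z chart_subset[OF U(1)] U(2) in auto)
    then show "?G c * partial V \<psi> b (\<lambda>y. c \<bullet> \<phi> y) x = 0"
      by (simp add: partial_def)
  qed
  also have "\<dots> = (\<Sum>c\<in>model M. partial U \<phi> c f x * partial V \<psi> b (\<lambda>y. c \<bullet> \<phi> y) x)"
    by (rule sum.cong[OF refl]) (simp add: partial_eq[OF U(1) 1(3-6) 1(1,2,7)])
  finally show ?thesis .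
qed

abbreviation "gradM \<equiv> grad (model M)"

lemma grad_inner: "b \<in> model M \<Longrightarrow> gradM U \<phi> f x \<bullet> b = partial U \<phi> b f x"
  unfolding grad_def by (rule sum_Basis_inner[OF model_Basis])

lemma grad_eqI:
  assumes "w \<in> E" "\<And>b. b \<in> model M \<Longrightarrow> partial U \<phi> b f x = w \<bullet> b"
  shows "gradM U \<phi> f x = w"
  by (rule span_Basis_eqI[OF model_Basis grad_in_span assms(1)]) (simp add: grad_inner assms(2))

context
  fixes U \<phi> x assumes U: "(U, \<phi>) \<in> charts M" and x: "x \<in> U"
begin

lemma grad_cong:
  assumes "smooth_at M f x" "openin T W" "x \<in> W" "\<And>y. y \<in> W \<Longrightarrow> f y = g y"
  shows "gradM U \<phi> g x = gradM U \<phi> f x"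
  unfolding grad_def by (rule sum.cong[OF refl]) (simp only: partial_cong[OF U x _ assms])

lemma grad_add:
  "smooth_at M f x \<Longrightarrow> smooth_at M g x \<Longrightarrow>
    gradM U \<phi> (\<lambda>y. f y + g y) x = gradM U \<phi> f x + gradM U \<phi> g x"
  unfolding grad_def by (simp add: partial_add[OF U x] scaleR_add_left sum.distrib)

lemma grad_mult:
  "smooth_at M f x \<Longrightarrow> smooth_at M g x \<Longrightarrow>
    gradM U \<phi> (\<lambda>y. f y * g y) x = f x *\<^sub>R gradM U \<phi> g x + g x *\<^sub>R gradM U \<phi> f x"
  unfolding grad_def
  by (simp add: partial_mult[OF U x] scaleR_add_left sum.distrib scaleR_sum_right mult.commute)

lemma grad_cmult:
  "smooth_at M f x \<Longrightarrow> gradM U \<phi> (\<lambda>y. c * f y) x = c *\<^sub>R gradM U \<phi> f x"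
  unfolding grad_def by (simp add: partial_cmult[OF U x] scaleR_sum_right)

lemma grad_const: "gradM U \<phi> (\<lambda>y. c) x = 0"
  unfolding grad_def partial_def by simp

lemma grad_coordinate: "w \<in> E \<Longrightarrow> gradM U \<phi> (\<lambda>y. w \<bullet> \<phi> y) x = w"
  by (rule grad_eqI) (simp_all add: partial_coordinate[OF U x])

lemma smooth_at_grad: "smooth_at M f x \<Longrightarrow> smooth_at M (gradM U \<phi> f) x"
  unfolding grad_def
  by (intro smooth_at_sum smooth_at_scaleR smooth_at_partial[OF _ U x] smooth_at_const)
    (use chart_subset[OF U] x in auto)

lemma smooth_at_affine: "smooth_at M (\<lambda>y. u + w \<bullet> (\<phi> y - p)) x"
proof -
  have "smooth_at M (\<lambda>y. (u - w \<bullet> p) + w \<bullet> \<phi> y) x"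
    by (intro smooth_at_add smooth_at_inner smooth_at_const smooth_at_chart[OF U x])
      (use chart_subset[OF U] x in auto)
  moreover have "(\<lambda>y. (u - w \<bullet> p) + w \<bullet> \<phi> y) = (\<lambda>y. u + w \<bullet> (\<phi> y - p))"
    by (simp add: inner_diff_right fun_eq_iff)
  ultimately show ?thesis by simp
qed

lemma grad_affine: "w \<in> E \<Longrightarrow> gradM U \<phi> (\<lambda>y. u + w \<bullet> (\<phi> y - p)) x = w"
proof -
  assume w: "w \<in> E"
  have "x \<in> pts M" using chart_subset[OF U] x by auto
  then have "gradM U \<phi> (\<lambda>y. (u - w \<bullet> p) + w \<bullet> \<phi> y) x = w"
    by (subst grad_add)
      (auto intro!: smooth_at_const smooth_at_inner smooth_at_chart[OF U x] simp: grad_const grad_coordinate[OF w])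
  moreover have "(\<lambda>y. (u - w \<bullet> p) + w \<bullet> \<phi> y) = (\<lambda>y. u + w \<bullet> (\<phi> y - p))"
    by (simp add: inner_diff_right fun_eq_iff)
  ultimately show ?thesis by simp
qed

end

end

section \<open>Cut-off functions and first-order functionals\<close>

text \<open>The condition on the support is phrased without closures: \<open>W\<close> and an open
  set on which \<open>\<rho>\<close> vanishes cover the manifold, so the closed support of
  \<open>\<rho>\<close> lies in \<open>W\<close>.\<close>

definition cutoff :: "('m, 'e::euclidean_space) mfd \<Rightarrow> 'm set \<Rightarrow> ('m \<Rightarrow> real) \<Rightarrow> bool" where
  "cutoff M W \<rho> \<longleftrightarrow> openin (mfd_topology M) W \<and> \<rho> \<in> smooth_functions M \<and>
     (\<exists>W0. openin (mfd_topology M) W0 \<and> W \<union> W0 = pts M \<and> (\<forall>y\<in>W0. \<rho> y = 0))"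

lemma linear_functional_inner:
  fixes l :: "'a::euclidean_space \<Rightarrow> real"
  assumes "linear l"
  shows "l w = (\<Sum>b\<in>Basis. l b *\<^sub>R b) \<bullet> w"
  using arg_cong[OF euclidean_representation[of w], of l]
  by (simp add: linear_sum[OF assms] linear_scale[OF assms] inner_sum_left inner_commute[of w] mult.commute)

definition proj :: "'a::euclidean_space set \<Rightarrow> 'a \<Rightarrow> 'a" where
  "proj B v = (\<Sum>b\<in>B. (v \<bullet> b) *\<^sub>R b)"

lemma proj_in_span: "proj B v \<in> span B"
  unfolding proj_def by (intro span_sum span_scale) (rule span_base)

lemma proj_inner:
  assumes "B \<subseteq> Basis" "w \<in> span B" shows "proj B v \<bullet> w = v \<bullet> w"
proof -
  have "proj B v \<bullet> w = (\<Sum>b\<in>B. (v \<bullet> b) * (w \<bullet> b))"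
    by (simp add: proj_def inner_sum_left inner_commute[of w])
  also have "\<dots> = v \<bullet> (\<Sum>b\<in>B. (w \<bullet> b) *\<^sub>R b)"
    by (simp add: inner_sum_right mult.commute)
  finally show ?thesis by (simp add: span_Basis_expand[OF assms])
qed

context atlas_mfd
begin

text \<open>Near a point of \<open>W\<close> the function is a product of smooth functions; any
  other point lies in the open set on which \<open>\<rho>\<close> is 0. The set \<open>V\<close>
  accommodates coefficient functions that are meaningful only on a frame domain.\<close>

lemma cutoff_smooth_at:
  assumes "cutoff M W \<rho>" "openin T V" "x \<in> V" "x \<in> W \<Longrightarrow> smooth_at M h x"
    "\<And>y. y \<in> V \<Longrightarrow> y \<in> W \<Longrightarrow> k y = \<rho> y * h y" "\<And>y. y \<in> V \<Longrightarrow> y \<notin> W \<Longrightarrow> k y = 0"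
  shows "smooth_at M k x"
proof -
  obtain W0 where W: "openin T W" "\<rho> \<in> smooth_functions M" "openin T W0" "W \<union> W0 = pts M"
    "\<forall>y\<in>W0. \<rho> y = 0" using assms(1) unfolding cutoff_def by blast
  have x: "x \<in> pts M" using assms(2,3) openin_T by auto
  show ?thesis
  proof (cases "x \<in> W")
    case True
    have "smooth_at M (\<lambda>y. \<rho> y * h y) x"
      by (rule smooth_at_mult[OF smooth_functions_smooth_at[OF W(2) x] assms(4)[OF True]])
    then show ?thesis
      by (rule smooth_at_cong[OF _ openin_Int[OF assms(2) W(1)]]) (use assms(3,5) True in auto)
  next
    case False
    then have "x \<in> W0" using W(4) x by auto
    moreover have "0 = k y" if "y \<in> V \<inter> W0" for y
      using that assms(5,6)[of y] W(5) by (cases "y \<in> W") auto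
    ultimately show ?thesis
      using smooth_at_cong[OF smooth_at_const[OF x] openin_Int[OF assms(2) W(3)]] assms(3) by blast
  qed
qed

lemma cutoff_extend:
  assumes "cutoff M W \<rho>" "\<And>y. y \<in> W \<Longrightarrow> smooth_at M f y"
  shows "(\<lambda>y. if y \<in> W then \<rho> y * f y else 0) \<in> smooth_functions M"
proof -
  have "W \<subseteq> pts M" using assms(1) openin_T by (auto simp: cutoff_def)
  moreover have "smooth_at M (\<lambda>y. if y \<in> W then \<rho> y * f y else 0) x" if "x \<in> pts M" for x
    by (rule cutoff_smooth_at[OF assms(1) openin_pts that assms(2)]) auto
  ultimately show ?thesis by (auto simp: smooth_functions_iff)
qed

lemma cutoff_zero:
  assumes "cutoff M W \<rho>" "y \<notin> W" shows "\<rho> y = 0"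
  using assms by (cases "y \<in> pts M") (auto simp: cutoff_def smooth_functions_iff)

end

locale hausdorff_mfd = atlas_mfd M for M :: "('m, 'e::euclidean_space) mfd" +
  assumes Hausdorff: "Hausdorff_space (mfd_topology M)"

text \<open>The last clause is the relation \<open>[[D, f], g] = 0\<close> evaluated at
  \<open>x\<close>. The values lie in an arbitrary vector space, so that tangent vectors and
  functionals on sections are covered alike.\<close>

definition first_order_function_at ::
    "('m, 'e::euclidean_space) mfd \<Rightarrow> 'm \<Rightarrow> (('m \<Rightarrow> real) \<Rightarrow> 'w::real_vector) \<Rightarrow> bool" where
  "first_order_function_at M x D \<longleftrightarrow>
     (\<forall>f\<in>smooth_functions M. \<forall>g\<in>smooth_functions M. D (\<lambda>y. f y + g y) = D f + D g) \<and>
     (\<forall>c. \<forall>f\<in>smooth_functions M. D (\<lambda>y. c * f y) = c *\<^sub>R D f) \<and>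
     (\<forall>f\<in>smooth_functions M. \<forall>g\<in>smooth_functions M. \<forall>h\<in>smooth_functions M.
        D (\<lambda>y. f y * (g y * h y)) = f x *\<^sub>R D (\<lambda>y. g y * h y) + g x *\<^sub>R D (\<lambda>y. f y * h y)
          - (f x * g x) *\<^sub>R D h)"

context hausdorff_mfd
begin

text \<open>The ball is compact in the chart, so its preimage is compact, hence closed by the
  Hausdorff property. This is what makes a bump function of a chart, extended by 0, smooth on the
  whole manifold.\<close>

lemma closedin_chart_cball:
  assumes U: "(U, \<phi>) \<in> charts M" and r: "E \<inter> cball p r \<subseteq> \<phi> ` U"
  shows "closedin T {y \<in> U. \<phi> y \<in> cball p r}"
proof -
  have "continuous_map (top_of_set (\<phi> ` U)) T (inv_into U \<phi>)"
    unfolding continuous_map_def topspace_T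
  proof (intro conjI allI impI)
    show "inv_into U \<phi> \<in> topspace (top_of_set (\<phi> ` U)) \<rightarrow> pts M"
      using chart_subset[OF U] chart_inj[OF U] by auto
    fix W assume W: "openin T W"
    have eq: "{y \<in> topspace (top_of_set (\<phi> ` U)). inv_into U \<phi> y \<in> W} = \<phi> ` (W \<inter> U)"
      using chart_inj[OF U] by auto
    show "openin (top_of_set (\<phi> ` U)) {y \<in> topspace (top_of_set (\<phi> ` U)). inv_into U \<phi> y \<in> W}"
      unfolding eq
      by (rule openin_subset_trans[OF openin_chart_image[OF W U]]) (use chart_image[OF U] in auto)
  qed
  moreover have "compact (E \<inter> cball p r)"
    by (intro closed_Int_compact closed_subspace subspace_span compact_cball)
  then have "compactin (top_of_set (\<phi> ` U)) (E \<inter> cball p r)"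
    using r by (simp add: compactin_subtopology)
  ultimately have "compactin T (inv_into U \<phi> ` (E \<inter> cball p r))"
    using image_compactin by blast
  moreover have "inv_into U \<phi> ` (E \<inter> cball p r) = {y \<in> U. \<phi> y \<in> cball p r}"
  proof safe
    fix w assume w: "w \<in> E" "w \<in> cball p r"
    then obtain y where "y \<in> U" "w = \<phi> y" using r by auto
    with w show "inv_into U \<phi> w \<in> U" "\<phi> (inv_into U \<phi> w) \<in> cball p r"
      using chart_inj[OF U] by auto
  next
    fix y assume "y \<in> U" "\<phi> y \<in> cball p r"
    then show "y \<in> inv_into U \<phi> ` (E \<inter> cball p r)"
      using chart_inj[OF U] chart_image[OF U] by (auto intro!: image_eqI[of _ _ "\<phi> y"])
  qed
  ultimately show ?thesis using compactin_imp_closedin[OF Hausdorff] by simp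
qed

lemma cutoff_exists:
  assumes W: "openin T W" "x \<in> W"
  obtains \<rho> W1 where "cutoff M W \<rho>" "openin T W1" "x \<in> W1" "W1 \<subseteq> W" "\<And>y. y \<in> W1 \<Longrightarrow> \<rho> y = 1"
proof -
  have "x \<in> pts M" using W openin_T by auto
  then obtain U \<phi> where U: "(U, \<phi>) \<in> charts M" "x \<in> U" by (rule chart_at)
  obtain N where N: "open N" "\<phi> x \<in> N" "\<And>y. y \<in> U \<Longrightarrow> \<phi> y \<in> N \<Longrightarrow> y \<in> W"
    using chart_nbhd[OF W(1) U(1) W(2) U(2)] by metis
  obtain N3 where N3: "open N3" "\<phi> ` U = E \<inter> N3"
    using chart_openin[OF U(1)] openin_open by metis
  have "\<phi> x \<in> N \<inter> N3" using N N3 U by auto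
  then obtain r where r: "r > 0" "cball (\<phi> x) r \<subseteq> N \<inter> N3"
    using open_contains_cball[of "N \<inter> N3"] open_Int[OF N(1) N3(1)] by metis
  define C where "C = {y \<in> U. \<phi> y \<in> cball (\<phi> x) r}"
  have C: "closedin T C" unfolding C_def
    by (rule closedin_chart_cball[OF U(1)]) (use r N3 in auto)
  have CW: "C \<subseteq> W" unfolding C_def using r N(3) by auto
  obtain \<beta> :: "'e \<Rightarrow> real" where \<beta>: "Cinf UNIV \<beta>" "\<And>y. y \<notin> ball (\<phi> x) r \<Longrightarrow> \<beta> y = 0"
    "\<And>y. y \<in> ball (\<phi> x) (r / 2) \<Longrightarrow> \<beta> y = 1"
    using bump_exists[OF r(1)] by metis
  define \<rho> where "\<rho> y = (if y \<in> U then \<beta> (\<phi> y) else 0)" for y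
  have W0: "openin T (pts M - C)" using C topspace_T openin_diff[OF openin_pts] by blast
  have \<rho>0: "\<rho> y = 0" if "y \<notin> C" for y
    using that \<beta>(2)[of "\<phi> y"] by (auto simp: \<rho>_def C_def)
  have "smooth_at M \<rho> y" if y: "y \<in> pts M" for y
  proof (cases "y \<in> U")
    case True
    have "smooth_at M (\<lambda>y. \<beta> (\<phi> y)) y"
      by (rule smooth_at_compose[OF smooth_at_chart[OF U(1) True] open_UNIV \<beta>(1)]) simp
    then show ?thesis
      by (rule smooth_at_cong[OF _ openin_chart[OF U(1)] True]) (simp add: \<rho>_def)
  next
    case False
    then have "y \<in> pts M - C" using y by (simp add: C_def)
    then show ?thesis
      by (rule smooth_at_cong[OF smooth_at_const[OF y] W0]) (simp add: \<rho>0)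
  qed
  moreover have "\<rho> y = 0" if "y \<notin> pts M" for y
    using that chart_subset[OF U(1)] by (auto simp: \<rho>_def)
  ultimately have "cutoff M W \<rho>"
    unfolding cutoff_def smooth_functions_iff
    using W(1) W0 \<rho>0 CW openin_T by (intro conjI exI[of _ "pts M - C"]) auto
  moreover have "{y \<in> U. \<phi> y \<in> ball (\<phi> x) (r / 2)} \<subseteq> W"
  proof clarify
    fix y assume "y \<in> U" "\<phi> y \<in> ball (\<phi> x) (r / 2)"
    then have "y \<in> C" using r(1) by (auto simp: C_def)
    then show "y \<in> W" using CW by auto
  qed
  ultimately show thesis
    using that[OF _ openin_chart_preimage[OF U(1) open_ball[of "\<phi> x" "r / 2"]]] U(2) r(1) \<beta>(3)
    by (simp add: \<rho>_def)
qed

text \<open>By Hadamard's lemma, a function with vanishing 1-jet at \<open>x\<close> is, up to cut-offs, a sum of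
  products of two functions vanishing at \<open>x\<close>.\<close>

lemma first_order_function_vanish:
  assumes D: "first_order_function_at M x D"
    and U: "(U, \<phi>) \<in> charts M" "x \<in> U"
    and f: "f \<in> smooth_functions M" "f x = 0" "gradM U \<phi> f x = 0"
  shows "D f = 0"
proof -
  have x: "x \<in> pts M" using U chart_subset by auto
  have Dadd: "D (\<lambda>y. f y + g y) = D f + D g"
    if "f \<in> smooth_functions M" "g \<in> smooth_functions M" for f g
    using D that by (simp add: first_order_function_at_def)
  have D0: "D (\<lambda>y. 0) = 0"
  proof -
    have "\<forall>c. \<forall>f\<in>smooth_functions M. D (\<lambda>y. c * f y) = c *\<^sub>R D f"
      using D by (simp add: first_order_function_at_def)
    from this[rule_format, OF f(1), of 0] show ?thesis by simp
  qed
  have Dmult: "D (\<lambda>y. k y * (h y * g y)) = 0"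
    if "k \<in> smooth_functions M" "h \<in> smooth_functions M" "g \<in> smooth_functions M" "k x = 0" "h x = 0"
    for k h g
    using D that by (simp add: first_order_function_at_def)
  obtain N G W where 1: "open N" "Cinf N G" "openin T W" "x \<in> W" "W \<subseteq> U" "\<phi> ` W \<subseteq> N"
    "\<And>y. y \<in> W \<Longrightarrow> f y = G (\<phi> y)"
    using smooth_atE[OF smooth_functions_smooth_at[OF f(1) x] U] by metis
  let ?p = "\<phi> x"
  have "?p \<in> N" using 1 by auto
  then obtain r where r: "r > 0" "ball ?p r \<subseteq> N"
    using 1(1) open_contains_ball by metis
  obtain H where H: "\<And>b. Cinf (ball ?p r) (H b)" "\<And>b. H b ?p = frechet_derivative G (at ?p) b"
    "\<And>y. y \<in> ball ?p r \<Longrightarrow> G y = G ?p + (\<Sum>b\<in>Basis. ((y - ?p) \<bullet> b) * H b y)"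
    using Hadamard[OF Cinf_subset[OF 1(2) r(2)]] by metis
  define W1 where "W1 = W \<inter> {y \<in> U. \<phi> y \<in> ball ?p r}"
  have W1: "openin T W1" "x \<in> W1"
    unfolding W1_def using openin_Int[OF 1(3) openin_chart_preimage[OF U(1) open_ball]] 1(4) U r by auto
  obtain \<rho> W2 where \<rho>: "cutoff M W1 \<rho>" "x \<in> W2" "\<And>y. y \<in> W2 \<Longrightarrow> \<rho> y = 1"
    using cutoff_exists[OF W1] by metis
  have \<rho>s: "\<rho> \<in> smooth_functions M" using \<rho>(1) by (simp add: cutoff_def)
  have \<rho>x: "\<rho> x = 1" using \<rho> by simp
  have sm\<phi>: "smooth_at M \<phi> y" if "y \<in> W1" for y
    using smooth_at_chart[OF U(1)] that by (simp add: W1_def)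
  define k where "k b y = (if y \<in> W1 then \<rho> y * ((\<phi> y - ?p) \<bullet> b) else 0)" for b y
  define h where "h b y = (if y \<in> W1 then \<rho> y * H b (\<phi> y) else 0)" for b y
  have k: "k b \<in> smooth_functions M" for b
    unfolding k_def
  proof (rule cutoff_extend[OF \<rho>(1)])
    fix y assume y: "y \<in> W1"
    then have "y \<in> U" by (simp add: W1_def)
    from smooth_at_affine[OF U(1) this, of 0 b ?p]
    show "smooth_at M (\<lambda>y. (\<phi> y - ?p) \<bullet> b) y" by (simp add: inner_commute)
  qed
  have h: "h b \<in> smooth_functions M" for b
    unfolding h_def
  proof (rule cutoff_extend[OF \<rho>(1)])
    fix y assume y: "y \<in> W1"
    show "smooth_at M (\<lambda>y. H b (\<phi> y)) y"
      by (rule smooth_at_compose[OF sm\<phi>[OF y] open_ball H(1)]) (use y in \<open>simp add: W1_def\<close>)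
  qed
  have kx: "k b x = 0" for b by (simp add: k_def)
  \<comment> \<open>For \<open>b\<close> outside the model nothing is known about \<open>H b\<close>
    at \<open>x\<close>, since \<open>G\<close> is an arbitrary extension. Such terms are removed
    below: \<open>\<phi> y - ?p\<close> has no components in these directions.\<close>
  have hx: "h b x = 0" if b: "b \<in> model M" for b
  proof -
    have "partial U \<phi> b f x = frechet_derivative G (at ?p) b"
      by (rule partial_eq[OF U(1) 1(3-6) 1(1,2,7) b])
    moreover have "partial U \<phi> b f x = 0"
      using grad_inner[OF b, of U \<phi> f x] f(3) by simp
    ultimately show ?thesis using H(2)[of b] W1(2) by (simp add: h_def)
  qed
  \<comment> \<open>Both factors \<open>k b\<close> and \<open>h b\<close> carry the cut-off
    function, hence the square.\<close>
  let ?q = "\<lambda>y. \<rho> y * \<rho> y"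
  have q: "?q \<in> smooth_functions M" using smooth_functions_mult[OF \<rho>s \<rho>s] .
  have sum: "?q y * f y = (\<Sum>b\<in>model M. k b y * h b y)" for y
  proof (cases "y \<in> W1")
    case True
    then have y: "y \<in> W" "y \<in> U" "\<phi> y \<in> ball ?p r" by (auto simp: W1_def)
    have "G ?p = 0" using 1(7)[OF 1(4)] f(2) by simp
    then have "f y = (\<Sum>b\<in>Basis. ((\<phi> y - ?p) \<bullet> b) * H b (\<phi> y))"
      using H(3)[OF y(3)] 1(7)[OF y(1)] by simp
    also have "\<dots> = (\<Sum>b\<in>model M. ((\<phi> y - ?p) \<bullet> b) * H b (\<phi> y))"
    proof (rule sum.mono_neutral_right[OF finite_Basis model_Basis], rule ballI)
      fix b assume b: "b \<in> Basis - model M"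
      have "\<phi> y - ?p \<in> E" using chart_image[OF U(1)] y(2) U(2) by (simp add: span_diff)
      then show "((\<phi> y - ?p) \<bullet> b) * H b (\<phi> y) = 0"
        using span_Basis_subset_inner[OF model_Basis] b by simp
    qed
    finally show ?thesis
      using True by (simp add: k_def h_def sum_distrib_left mult_ac)
  next
    case False
    then show ?thesis using cutoff_zero[OF \<rho>(1) False] by (simp add: k_def)
  qed
  have zero: "D (\<lambda>y. ?q y * (f y * g y)) = 0" if g: "g \<in> smooth_functions M" for g
  proof -
    have "D (\<lambda>y. \<Sum>b\<in>A. k b y * (h b y * g y)) = 0" if "finite A" "A \<subseteq> model M" for A
      using that
    proof (induction A rule: finite_induct)
      case empty then show ?case by (simp add: D0)
    next
      case (insert b A)
      have s: "(\<lambda>y. k b y * (h b y * g y)) \<in> smooth_functions M" for b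
        by (intro smooth_functions_mult k h g)
      have "D (\<lambda>y. k b y * (h b y * g y) + (\<Sum>b\<in>A. k b y * (h b y * g y)))
          = D (\<lambda>y. k b y * (h b y * g y)) + D (\<lambda>y. \<Sum>b\<in>A. k b y * (h b y * g y))"
        by (rule Dadd[OF s smooth_functions_sum[OF s]])
      also have "\<dots> = 0" using insert Dmult[OF k h g kx hx] by simp
      finally show ?case using insert by simp
    qed
    from this[OF finite_model subset_refl]
    have "D (\<lambda>y. \<Sum>b\<in>model M. k b y * (h b y * g y)) = 0" .
    moreover have "(\<Sum>b\<in>model M. k b y * (h b y * g y)) = ?q y * (f y * g y)" for y
      using sum[of y] by (simp add: sum_distrib_right flip: mult.assoc)
    ultimately show ?thesis by simp
  qed
  define one where "one y = (if y \<in> pts M then 1 else 0 :: real)" for y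
  have one: "one \<in> smooth_functions M" using smooth_functions_one[of 1] by (simp add: one_def[abs_def])
  \<comment> \<open>With \<open>q = ?q\<close>, the choices \<open>a = 1 - q\<close> and
    \<open>g = 2 - q\<close> satisfy \<open>a^2 + q g = 1\<close>. This splits \<open>f\<close> into
    \<open>a a f\<close>, whose factor \<open>a\<close> vanishes at \<open>x\<close>, and the term
    \<open>q f g\<close> treated in \<open>zero\<close>.\<close>
  define a where "a y = one y + (- 1) * ?q y" for y
  have a: "a \<in> smooth_functions M"
    unfolding a_def[abs_def] by (intro smooth_functions_add one smooth_functions_cmult q)
  define g where "g y = 2 * one y + (- 1) * ?q y" for y
  have g: "g \<in> smooth_functions M"
    unfolding g_def[abs_def] by (intro smooth_functions_add one smooth_functions_cmult q)
  have ax: "a x = 0" using x \<rho>x by (simp add: a_def one_def)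
  have "f y = a y * (a y * f y) + ?q y * (f y * g y)" for y
  proof (cases "y \<in> pts M")
    case True
    then show ?thesis by (simp add: a_def g_def one_def) (simp add: algebra_simps)
  next
    case False
    then have "f y = 0" using f(1) by (simp add: smooth_functions_iff)
    then show ?thesis by simp
  qed
  then have "D f = D (\<lambda>y. a y * (a y * f y) + ?q y * (f y * g y))" by presburger
  also have "\<dots> = D (\<lambda>y. a y * (a y * f y)) + D (\<lambda>y. ?q y * (f y * g y))"
    by (intro Dadd smooth_functions_mult a f q g \<rho>s)
  also have "\<dots> = 0" using Dmult[OF a a f(1) ax ax] zero[OF g] by simp
  finally show ?thesis .
qed

lemma first_order_function_eq:
  assumes D: "first_order_function_at M x D"
    and U: "(U, \<phi>) \<in> charts M" "x \<in> U"
    and f: "f \<in> smooth_functions M" and g: "g \<in> smooth_functions M"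
    and eq: "f x = g x" "gradM U \<phi> f x = gradM U \<phi> g x"
  shows "D f = D g"
proof -
  have x: "x \<in> pts M" using U chart_subset by auto
  have sm: "smooth_at M f x" "smooth_at M g x" using f g x by (auto simp: smooth_functions_iff)
  have mg: "(\<lambda>y. - 1 * g y) \<in> smooth_functions M" by (rule smooth_functions_cmult[OF g])
  have "D (\<lambda>y. f y + - 1 * g y) = 0"
  proof (rule first_order_function_vanish[OF D U smooth_functions_add[OF f mg]])
    have "smooth_at M (\<lambda>y. - 1 * g y) x" using mg x by (simp add: smooth_functions_iff)
    then show "gradM U \<phi> (\<lambda>y. f y + - 1 * g y) x = 0"
      using sm eq(2) grad_cmult[OF U sm(2), of "- 1"] grad_add[OF U sm(1), of "\<lambda>y. - 1 * g y"] by simp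
  qed (simp add: eq)
  moreover have "D (\<lambda>y. f y + - 1 * g y) = D f + D (\<lambda>y. - 1 * g y)"
    by (rule bspec[OF bspec[OF D[unfolded first_order_function_at_def, THEN conjunct1] f] mg])
  moreover have "D (\<lambda>y. - 1 * g y) = - 1 *\<^sub>R D g"
    using D[unfolded first_order_function_at_def, THEN conjunct2, THEN conjunct1] g by blast
  ultimately show ?thesis by simp
qed

end

section \<open>Line bundles, derivations and jets\<close>

lemma coef_scaleR: "e \<noteq> 0 \<Longrightarrow> coef e (c *\<^sub>R e) = c"
  unfolding coef_def by (rule the_equality) auto

lemma coef_zero: "e \<noteq> 0 \<Longrightarrow> coef e 0 = 0"
  using coef_scaleR[of e 0] by simp

lemma line_coef:
  assumes "subspace F" "dim F = 1" "e \<in> F" "e \<noteq> 0" "v \<in> F"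
  shows "coef e v *\<^sub>R e = v"
proof -
  obtain B where B: "B \<subseteq> F" "independent B" "F \<subseteq> span B" "card B = dim F"
    using basis_exists by blast
  then obtain b where b: "B = {b}" using assms(2) card_1_singletonE by metis
  have "e \<in> span {b}" "v \<in> span {b}" using B b assms by auto
  then obtain c d where cd: "e = c *\<^sub>R b" "v = d *\<^sub>R b" by (auto simp: span_singleton)
  then have "v = (d / c) *\<^sub>R e" using assms(4) by auto
  then show ?thesis using coef_scaleR[OF assms(4), of "d / c"] by simp
qed

text \<open>The conditions of \<open>line_bundle\<close> over a \<open>hausdorff_mfd\<close>. This
  form is inherited by \<open>restrict_bundle\<close> and \<open>jet_lbundle\<close>, so the theory
  below can be instantiated at all bundles that occur.\<close>

locale hausdorff_lbundle =
  fixes L :: "('m, 'e::euclidean_space, 'v::real_vector) lbundle"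
  assumes hausdorff_mfd_base: "hausdorff_mfd (base L)"
    and fibre_subspace: "\<And>x. x \<in> pts (base L) \<Longrightarrow> subspace (fibre L x)"
    and fibre_dim: "\<And>x. x \<in> pts (base L) \<Longrightarrow> dim (fibre L x) = 1"
    and frame_open: "\<And>U e. (U, e) \<in> frames L \<Longrightarrow> openin (mfd_topology (base L)) U"
    and frame_fibre: "\<And>U e x. (U, e) \<in> frames L \<Longrightarrow> x \<in> U \<Longrightarrow> e x \<in> fibre L x"
    and frame_nz: "\<And>U e x. (U, e) \<in> frames L \<Longrightarrow> x \<in> U \<Longrightarrow> e x \<noteq> 0"
    and frame_cover: "(\<Union>c\<in>frames L. fst c) = pts (base L)"
    and frame_transition: "\<And>U e V e'. (U, e) \<in> frames L \<Longrightarrow> (V, e') \<in> frames L \<Longrightarrow>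
        smooth_fun_on (base L) (U \<inter> V) (\<lambda>x. coef (e x) (e' x))"

lemma manifold_hausdorff_mfd: "manifold M \<Longrightarrow> hausdorff_mfd M"
  unfolding manifold_def by unfold_locales auto

lemma line_bundle_hausdorff_lbundle: "line_bundle L \<Longrightarrow> hausdorff_lbundle L"
  unfolding line_bundle_def hausdorff_lbundle_def by (auto simp: manifold_hausdorff_mfd split: prod.splits)

text \<open>The common property of elements of \<open>der_space\<close>, of Jacobi brackets with one
  argument fixed and of commutators of local derivations, all evaluated at \<open>x\<close>.\<close>

definition first_order_at ::
    "('m, 'e::euclidean_space, 'v::real_vector) lbundle \<Rightarrow> 'm \<Rightarrow> (('m \<Rightarrow> 'v) \<Rightarrow> 'w::real_vector) \<Rightarrow> bool" where
  "first_order_at L x \<Delta> \<longleftrightarrow>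
     (\<forall>s\<in>sections L. \<forall>r\<in>sections L. \<Delta> (\<lambda>y. s y + r y) = \<Delta> s + \<Delta> r) \<and>
     (\<forall>c. \<forall>s\<in>sections L. \<Delta> (\<lambda>y. c *\<^sub>R s y) = c *\<^sub>R \<Delta> s) \<and>
     (\<forall>f\<in>smooth_functions (base L). \<forall>g\<in>smooth_functions (base L). \<forall>s\<in>sections L.
        \<Delta> (\<lambda>y. f y *\<^sub>R g y *\<^sub>R s y) = f x *\<^sub>R \<Delta> (\<lambda>y. g y *\<^sub>R s y) + g x *\<^sub>R \<Delta> (\<lambda>y. f y *\<^sub>R s y)
          - f x *\<^sub>R g x *\<^sub>R \<Delta> s)"

definition frame_section :: "'m set \<Rightarrow> ('m \<Rightarrow> real) \<Rightarrow> ('m \<Rightarrow> 'v::real_vector) \<Rightarrow> ('m \<Rightarrow> real) \<Rightarrow> 'm \<Rightarrow> 'v" where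
  "frame_section W \<rho> e g y = (if y \<in> W then (\<rho> y * g y) *\<^sub>R e y else 0)"

text \<open>The derivation \<open>k + w . grad\<close> in the trivialisation by \<open>e\<close>:
  \<open>k\<close> is its part of order zero, \<open>w\<close> its symbol.\<close>

definition der_comb ::
    "('m, 'e::euclidean_space, 'v::real_vector) lbundle \<Rightarrow> 'm set \<Rightarrow> ('m \<Rightarrow> 'e) \<Rightarrow> ('m \<Rightarrow> 'v) \<Rightarrow> 'm \<Rightarrow>
      real \<Rightarrow> 'e \<Rightarrow> ('m \<Rightarrow> 'v) \<Rightarrow> 'v" where
  "der_comb L U \<phi> e x k w s = (if s \<in> sections L
     then (k * coef (e x) (s x) + w \<bullet> grad (model (base L)) U \<phi> (\<lambda>y. coef (e y) (s y)) x) *\<^sub>R e x else 0)"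

definition tangent_comb ::
    "('m, 'e::euclidean_space) mfd \<Rightarrow> 'm set \<Rightarrow> ('m \<Rightarrow> 'e) \<Rightarrow> 'm \<Rightarrow> 'e \<Rightarrow> ('m \<Rightarrow> real) \<Rightarrow> real" where
  "tangent_comb M U \<phi> x w f = (if f \<in> smooth_functions M then w \<bullet> grad (model M) U \<phi> f x else 0)"

context hausdorff_mfd
begin

lemma tangent_comb_in:
  assumes U: "(U, \<phi>) \<in> charts M" "x \<in> U"
  shows "tangent_comb M U \<phi> x w \<in> tangent_space M x"
proof -
  have x: "x \<in> pts M" using U chart_subset by auto
  have sm: "smooth_at M f x" if "f \<in> smooth_functions M" for f
    using that x by (simp add: smooth_functions_iff)
  show ?thesis
    unfolding tangent_space_def tangent_comb_def
    by (auto simp: smooth_functions_add smooth_functions_cmult smooth_functions_mult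
        grad_add[OF U sm sm] grad_cmult[OF U sm] grad_mult[OF U sm sm] inner_add_right)
qed

lemma tangent_first_order:
  assumes v: "v \<in> tangent_space M x" shows "first_order_function_at M x v"
proof -
  have m: "v (\<lambda>y. f y * g y) = f x * v g + g x * v f"
    if "f \<in> smooth_functions M" "g \<in> smooth_functions M" for f g
    using v that unfolding tangent_space_def by blast
  have "v (\<lambda>y. f y * (g y * h y)) = f x *\<^sub>R v (\<lambda>y. g y * h y) + g x *\<^sub>R v (\<lambda>y. f y * h y)
      - (f x * g x) *\<^sub>R v h"
    if "f \<in> smooth_functions M" "g \<in> smooth_functions M" "h \<in> smooth_functions M" for f g h
    using that by (simp add: m smooth_functions_mult algebra_simps)
  then show ?thesis
    using v unfolding first_order_function_at_def tangent_space_def by auto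
qed

text \<open>By \<open>first_order_function_eq\<close> a tangent vector sees only value and gradient
  at \<open>x\<close>. It kills constants, so it is a linear functional of the gradient.\<close>

lemma tangent_space_comb:
  assumes U: "(U, \<phi>) \<in> charts M" "x \<in> U" and v: "v \<in> tangent_space M x"
  obtains w where "w \<in> E" "v = tangent_comb M U \<phi> x w"
proof -
  have x: "x \<in> pts M" using U chart_subset by auto
  have v0: "v f = 0" if "f \<notin> smooth_functions M" for f
    using v that unfolding tangent_space_def by blast
  have vadd: "v (\<lambda>y. f y + g y) = v f + v g" if "f \<in> smooth_functions M" "g \<in> smooth_functions M" for f g
    using v that unfolding tangent_space_def by blast
  have vcm: "v (\<lambda>y. c * f y) = c * v f" if "f \<in> smooth_functions M" for c f
    using v that unfolding tangent_space_def by blast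
  have vm: "v (\<lambda>y. f y * g y) = f x * v g + g x * v f"
    if "f \<in> smooth_functions M" "g \<in> smooth_functions M" for f g
    using v that unfolding tangent_space_def by blast
  obtain \<rho> W1 where \<rho>: "cutoff M U \<rho>" "openin T W1" "x \<in> W1" "W1 \<subseteq> U" "\<And>y. y \<in> W1 \<Longrightarrow> \<rho> y = 1"
    using cutoff_exists[OF openin_chart[OF U(1)] U(2)] by metis
  \<comment> \<open>Coordinates are not globally defined, so affine functions of the chart are cut
    off. \<open>F u w\<close> has value \<open>u\<close> at \<open>x\<close> and, for
    \<open>w\<close> in \<open>E\<close>, gradient \<open>w\<close>.\<close>
  define F where "F u w = (\<lambda>y. if y \<in> U then \<rho> y * (u + w \<bullet> (\<phi> y - \<phi> x)) else 0)" for u w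
  have F: "F u w \<in> smooth_functions M" for u w
    unfolding F_def by (rule cutoff_extend[OF \<rho>(1) smooth_at_affine[OF U(1)]])
  have Fx: "F u w x = u" for u w using U(2) \<rho>(3,5) by (simp add: F_def)
  have Fg: "gradM U \<phi> (F u w) x = w" if "w \<in> E" for u w
  proof -
    have "gradM U \<phi> (F u w) x = gradM U \<phi> (\<lambda>y. u + w \<bullet> (\<phi> y - \<phi> x)) x"
      by (rule grad_cong[OF U smooth_at_affine[OF U] \<rho>(2,3)]) (use \<rho>(4,5) in \<open>auto simp: F_def\<close>)
    then show ?thesis using grad_affine[OF U that] by simp
  qed
  have lin: "linear (\<lambda>w. v (F 0 w))"
  proof (rule linearI)
    fix w w'
    have "F 0 (w + w') = (\<lambda>y. F 0 w y + F 0 w' y)"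
      by (auto simp: F_def fun_eq_iff inner_add_left algebra_simps)
    then show "v (F 0 (w + w')) = v (F 0 w) + v (F 0 w')" using vadd[OF F F] by simp
  next
    fix c w
    have "F 0 (c *\<^sub>R w) = (\<lambda>y. c * F 0 w y)" by (auto simp: F_def fun_eq_iff)
    then show "v (F 0 (c *\<^sub>R w)) = c *\<^sub>R v (F 0 w)" using vcm[OF F] by simp
  qed
  define w0 where "w0 = (\<Sum>b\<in>Basis. v (F 0 b) *\<^sub>R b)"
  have w0: "v (F 0 w) = w0 \<bullet> w" for w
    unfolding w0_def by (rule linear_functional_inner[OF lin])
  let ?o = "\<lambda>y. if y \<in> pts M then 1 else 0"
  have one: "?o \<in> smooth_functions M" by (rule smooth_functions_one)
  have "v ?o = 0"
    using vm[OF one one] x by (simp add: if_distrib cong: if_cong)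
  have "v f = proj (model M) w0 \<bullet> gradM U \<phi> f x" if f: "f \<in> smooth_functions M" for f
  proof -
    let ?g = "gradM U \<phi> f x"
    have co: "(\<lambda>y. f x * ?o y) \<in> smooth_functions M" by (rule smooth_functions_cmult[OF one])
    have gco: "gradM U \<phi> (\<lambda>y. f x * ?o y) x = 0"
      using grad_cong[OF U smooth_at_const[OF x] openin_pts x, of "f x" "\<lambda>y. f x * ?o y"] grad_const[OF U]
      by simp
    have "v f = v (\<lambda>y. f x * ?o y + F 0 ?g y)"
    proof (rule first_order_function_eq[OF tangent_first_order[OF v] U f smooth_functions_add[OF co F]])
      show "f x = f x * ?o x + F 0 ?g x" using x by (simp add: Fx)
      have "gradM U \<phi> (\<lambda>y. f x * ?o y + F 0 ?g y) x = gradM U \<phi> (\<lambda>y. f x * ?o y) x + gradM U \<phi> (F 0 ?g) x"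
        using co F x by (intro grad_add[OF U]) (auto simp: smooth_functions_iff simp del: mult_cancel_left)
      then show "?g = gradM U \<phi> (\<lambda>y. f x * ?o y + F 0 ?g y) x"
        by (simp only: gco Fg[OF grad_in_span] add_0)
    qed
    also have "\<dots> = v (F 0 ?g)"
      using vadd[OF co F] vcm[OF one] \<open>v ?o = 0\<close> by simp
    finally show ?thesis
      using w0[of ?g] proj_inner[OF model_Basis grad_in_span[of _ U \<phi> f x], of w0] by simp
  qed
  then have "v = tangent_comb M U \<phi> x (proj (model M) w0)"
    using v0 by (auto simp: tangent_comb_def fun_eq_iff)
  then show thesis using that proj_in_span by blast
qed

end

sublocale hausdorff_lbundle \<subseteq> hausdorff_mfd "base L" by (rule hausdorff_mfd_base)

context hausdorff_lbundle
begin

abbreviation "M \<equiv> base L"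
abbreviation "loc e s \<equiv> (\<lambda>y. coef (e y) (s y))"

lemma frame_subset: "(V, e) \<in> frames L \<Longrightarrow> V \<subseteq> pts M"
  using frame_open openin_T by auto

lemma frame_at:
  assumes "x \<in> pts M" obtains V e where "(V, e) \<in> frames L" "x \<in> V"
  using assms frame_cover by fastforce

lemma fibre_coef:
  assumes "(V, e) \<in> frames L" "x \<in> V" "v \<in> fibre L x"
  shows "coef (e x) v *\<^sub>R e x = v"
proof -
  have p: "x \<in> pts M" using frame_subset assms by auto
  show ?thesis
    by (rule line_coef[OF fibre_subspace[OF p] fibre_dim[OF p] frame_fibre[OF assms(1,2)]
          frame_nz[OF assms(1,2)] assms(3)])
qed

lemma frame_coef_scaleR: "(V, e) \<in> frames L \<Longrightarrow> x \<in> V \<Longrightarrow> coef (e x) (c *\<^sub>R e x) = c"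
  using coef_scaleR frame_nz by metis

lemma section_fibre: "s \<in> sections L \<Longrightarrow> x \<in> pts M \<Longrightarrow> s x \<in> fibre L x"
  by (simp add: sections_def)

lemma section_outside: "s \<in> sections L \<Longrightarrow> x \<notin> pts M \<Longrightarrow> s x = 0"
  by (simp add: sections_def)

lemma section_coef: "s \<in> sections L \<Longrightarrow> (V, e) \<in> frames L \<Longrightarrow> x \<in> V \<Longrightarrow> coef (e x) (s x) *\<^sub>R e x = s x"
  using fibre_coef section_fibre frame_subset by blast

lemma section_smooth_at:
  assumes "s \<in> sections L" "(V, e) \<in> frames L" "x \<in> V"
  shows "smooth_at M (loc e s) x"
proof -
  have "smooth_fun_on M V (loc e s)" using assms by (auto simp: sections_def)
  then show ?thesis using smooth_fun_onD[OF frame_open[OF assms(2)]] assms(3) by auto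
qed

lemma transition_smooth_at:
  assumes "(V, e) \<in> frames L" "(V', e') \<in> frames L" "x \<in> V" "x \<in> V'"
  shows "smooth_at M (\<lambda>y. coef (e y) (e' y)) x"
  by (rule smooth_fun_onD[OF openin_Int[OF frame_open[OF assms(1)] frame_open[OF assms(2)]]
        frame_transition[OF assms(1,2)]]) (use assms in auto)

lemma coef_change:
  assumes "(V, e) \<in> frames L" "(V', e') \<in> frames L" "x \<in> V" "x \<in> V'" "v \<in> fibre L x"
  shows "coef (e' x) v = coef (e' x) (e x) * coef (e x) v"
proof -
  have "v = (coef (e x) v * coef (e' x) (e x)) *\<^sub>R e' x"
    using fibre_coef[OF assms(1,3,5)] fibre_coef[OF assms(2,4) frame_fibre[OF assms(1,3)]] by (metis scaleR_scaleR)
  then show ?thesis using frame_coef_scaleR[OF assms(2,4)] by (metis mult.commute)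
qed

text \<open>One frame around each point suffices, because frame transitions are smooth.\<close>

lemma sectionI:
  assumes "\<And>x. x \<in> pts M \<Longrightarrow> s x \<in> fibre L x" "\<And>x. x \<notin> pts M \<Longrightarrow> s x = 0"
    "\<And>x. x \<in> pts M \<Longrightarrow> \<exists>V e. (V, e) \<in> frames L \<and> x \<in> V \<and> smooth_at M (loc e s) x"
  shows "s \<in> sections L"
proof -
  have "smooth_fun_on M V' (loc e' s)" if V': "(V', e') \<in> frames L" for V' e'
    unfolding smooth_fun_on_iff[OF frame_open[OF V']]
  proof
    fix x assume x: "x \<in> V'"
    then have "x \<in> pts M" using frame_subset[OF V'] by auto
    then obtain V e where V: "(V, e) \<in> frames L" "x \<in> V" "smooth_at M (loc e s) x"
      using assms(3) by blast
    have "smooth_at M (\<lambda>y. coef (e' y) (e y) * coef (e y) (s y)) x"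
      by (rule smooth_at_mult[OF transition_smooth_at[OF V' V(1) x V(2)] V(3)])
    then show "smooth_at M (loc e' s) x"
    proof (rule smooth_at_cong[OF _ openin_Int[OF frame_open[OF V(1)] frame_open[OF V']]])
      show "x \<in> V \<inter> V'" using x V by simp
      fix y assume "y \<in> V \<inter> V'"
      then show "coef (e' y) (e y) * coef (e y) (s y) = coef (e' y) (s y)"
        using coef_change[OF V(1) V', of y "s y"] assms(1)[of y] frame_subset[OF V'] by auto
    qed
  qed
  then show ?thesis using assms(1,2) by (auto simp: sections_def)
qed

lemma loc_add:
  assumes "(V, e) \<in> frames L" "x \<in> V" "u \<in> fibre L x" "v \<in> fibre L x"
  shows "coef (e x) (u + v) = coef (e x) u + coef (e x) v"
proof -
  have "u + v = (coef (e x) u + coef (e x) v) *\<^sub>R e x"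
    using fibre_coef[OF assms(1,2,3)] fibre_coef[OF assms(1,2,4)] by (simp add: scaleR_add_left)
  then show ?thesis using frame_coef_scaleR[OF assms(1,2)] by metis
qed

lemma loc_scaleR:
  assumes "(V, e) \<in> frames L" "x \<in> V" "v \<in> fibre L x"
  shows "coef (e x) (c *\<^sub>R v) = c * coef (e x) v"
proof -
  have "c *\<^sub>R v = (c * coef (e x) v) *\<^sub>R e x"
    using fibre_coef[OF assms] by (metis scaleR_scaleR)
  then show ?thesis using frame_coef_scaleR[OF assms(1,2)] by metis
qed

lemma section_add:
  assumes "s \<in> sections L" "r \<in> sections L" shows "(\<lambda>y. s y + r y) \<in> sections L"
proof (rule sectionI)
  fix x assume x: "x \<in> pts M"
  show "s x + r x \<in> fibre L x"
    using fibre_subspace[OF x] section_fibre[OF _ x] assms by (simp add: subspace_add)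
  obtain V e where V: "(V, e) \<in> frames L" "x \<in> V" using frame_at[OF x] .
  have "smooth_at M (\<lambda>y. coef (e y) (s y) + coef (e y) (r y)) x"
    by (intro smooth_at_add section_smooth_at[OF _ V] assms)
  then have "smooth_at M (\<lambda>y. coef (e y) (s y + r y)) x"
    by (rule smooth_at_cong[OF _ frame_open[OF V(1)] V(2)])
      (use loc_add[OF V(1)] section_fibre assms frame_subset[OF V(1)] in auto)
  then show "\<exists>V e. (V, e) \<in> frames L \<and> x \<in> V \<and> smooth_at M (\<lambda>y. coef (e y) (s y + r y)) x"
    using V by blast
qed (simp add: section_outside[OF assms(1)] section_outside[OF assms(2)])

lemma section_mult:
  assumes "f \<in> smooth_functions M" "s \<in> sections L" shows "(\<lambda>y. f y *\<^sub>R s y) \<in> sections L"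
proof (rule sectionI)
  fix x assume x: "x \<in> pts M"
  show "f x *\<^sub>R s x \<in> fibre L x"
    using fibre_subspace[OF x] section_fibre[OF _ x] assms by (simp add: subspace_scale)
  obtain V e where V: "(V, e) \<in> frames L" "x \<in> V" using frame_at[OF x] .
  have "smooth_at M (\<lambda>y. f y * coef (e y) (s y)) x"
    by (intro smooth_at_mult section_smooth_at[OF _ V] smooth_functions_smooth_at[OF _ x] assms)
  then have "smooth_at M (\<lambda>y. coef (e y) (f y *\<^sub>R s y)) x"
    by (rule smooth_at_cong[OF _ frame_open[OF V(1)] V(2)])
      (use loc_scaleR[OF V(1)] section_fibre assms frame_subset[OF V(1)] in auto)
  then show "\<exists>V e. (V, e) \<in> frames L \<and> x \<in> V \<and> smooth_at M (\<lambda>y. coef (e y) (f y *\<^sub>R s y)) x"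
    using V by blast
qed (simp add: section_outside[OF assms(2)])

lemma section_scale:
  assumes "s \<in> sections L" shows "(\<lambda>y. c *\<^sub>R s y) \<in> sections L"
proof -
  have "(\<lambda>y. (if y \<in> pts M then c else 0) *\<^sub>R s y) \<in> sections L"
    by (rule section_mult[OF smooth_functions_one assms])
  moreover have "(\<lambda>y. (if y \<in> pts M then c else 0) *\<^sub>R s y) = (\<lambda>y. c *\<^sub>R s y)"
    using section_outside[OF assms] by auto
  ultimately show ?thesis by simp
qed

lemma frame_section_in:
  assumes \<rho>: "cutoff M W \<rho>" and V: "(V, e) \<in> frames L" and W: "W \<subseteq> V"
    and g: "\<And>y. y \<in> W \<Longrightarrow> smooth_at M g y"
  shows "frame_section W \<rho> e g \<in> sections L"
proof (rule sectionI)
  fix x assume x: "x \<in> pts M"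
  show "frame_section W \<rho> e g x \<in> fibre L x"
    using frame_fibre[OF V] W fibre_subspace[OF x] by (auto simp: frame_section_def subspace_scale subspace_0)
  obtain V' e' where V': "(V', e') \<in> frames L" "x \<in> V'" using frame_at[OF x] .
  have "smooth_at M (loc e' (frame_section W \<rho> e g)) x"
  proof (rule cutoff_smooth_at[OF \<rho> frame_open[OF V'(1)] V'(2)])
    assume xW: "x \<in> W"
    show "smooth_at M (\<lambda>y. g y * coef (e' y) (e y)) x"
      by (rule smooth_at_mult[OF g[OF xW] transition_smooth_at[OF V'(1) V]]) (use xW W V' in auto)
  next
    fix y assume y: "y \<in> V'" "y \<in> W"
    then show "coef (e' y) (frame_section W \<rho> e g y) = \<rho> y * (g y * coef (e' y) (e y))"
      using loc_scaleR[OF V'(1) y(1) frame_fibre[OF V]] W by (auto simp: frame_section_def)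
  next
    fix y assume y: "y \<in> V'" "y \<notin> W"
    then show "coef (e' y) (frame_section W \<rho> e g y) = 0"
      using coef_zero[OF frame_nz[OF V'(1) y(1)]] by (simp add: frame_section_def)
  qed
  then show "\<exists>V e'. (V, e') \<in> frames L \<and> x \<in> V \<and> smooth_at M (loc e' (frame_section W \<rho> e g)) x"
    using V' by blast
qed (use frame_subset[OF V] W in \<open>auto simp: frame_section_def\<close>)

lemma loc_frame_section:
  "(V, e) \<in> frames L \<Longrightarrow> W \<subseteq> V \<Longrightarrow> y \<in> W \<Longrightarrow> loc e (frame_section W \<rho> e g) y = \<rho> y * g y"
  using frame_coef_scaleR by (auto simp: frame_section_def)

section \<open>First-order functionals and 1-jets in a fixed chart and frame\<close>

context
  fixes U \<phi> V e x
  assumes U: "(U, \<phi>) \<in> charts M" "x \<in> U" and V: "(V, e) \<in> frames L" "x \<in> V"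
begin

abbreviation "jgrad s \<equiv> gradM U \<phi> (loc e s) x"

lemma base_point: "x \<in> pts M" using U chart_subset by auto

lemma jgrad_add: "s \<in> sections L \<Longrightarrow> r \<in> sections L \<Longrightarrow> jgrad (\<lambda>y. s y + r y) = jgrad s + jgrad r"
proof -
  assume s: "s \<in> sections L" "r \<in> sections L"
  have sm: "smooth_at M (loc e s) x" "smooth_at M (loc e r) x" using s section_smooth_at V by auto
  have "jgrad (\<lambda>y. s y + r y) = gradM U \<phi> (\<lambda>y. coef (e y) (s y) + coef (e y) (r y)) x"
    by (rule grad_cong[OF U smooth_at_add[OF sm] frame_open[OF V(1)] V(2)])
      (use loc_add[OF V(1)] section_fibre s frame_subset[OF V(1)] in auto)
  then show ?thesis by (simp add: grad_add[OF U sm])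
qed

lemma jgrad_mult:
  assumes "f \<in> smooth_functions M" "s \<in> sections L"
  shows "jgrad (\<lambda>y. f y *\<^sub>R s y) = f x *\<^sub>R jgrad s + coef (e x) (s x) *\<^sub>R gradM U \<phi> f x"
proof -
  have sm: "smooth_at M f x" "smooth_at M (loc e s) x"
    using assms section_smooth_at V smooth_functions_smooth_at base_point by auto
  have "jgrad (\<lambda>y. f y *\<^sub>R s y) = gradM U \<phi> (\<lambda>y. f y * coef (e y) (s y)) x"
    by (rule grad_cong[OF U smooth_at_mult[OF sm] frame_open[OF V(1)] V(2)])
      (use loc_scaleR[OF V(1)] section_fibre assms frame_subset[OF V(1)] in auto)
  then show ?thesis by (simp add: grad_mult[OF U sm])
qed

lemma jgrad_scale:
  assumes "s \<in> sections L" shows "jgrad (\<lambda>y. c *\<^sub>R s y) = c *\<^sub>R jgrad s"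
proof -
  have sm: "smooth_at M (loc e s) x"
    using assms section_smooth_at V by auto
  have "jgrad (\<lambda>y. c *\<^sub>R s y) = gradM U \<phi> (\<lambda>y. c * coef (e y) (s y)) x"
    by (rule grad_cong[OF U smooth_at_mult[OF smooth_at_const[OF base_point] sm] frame_open[OF V(1)] V(2)])
      (use loc_scaleR[OF V(1)] section_fibre assms frame_subset[OF V(1)] in auto)
  then show ?thesis by (simp add: grad_cmult[OF U sm])
qed

text \<open>Near \<open>x\<close> the section is a function times the frame. With the frame cut off
  to a global section \<open>e0\<close>, the functional that takes a function \<open>h\<close> to
  \<open>\<Delta> (h e0)\<close> falls under the Hadamard argument for functions. The splitting
  \<open>a^2 + q g = 1\<close> used there removes the cut-offs again.\<close>

lemma first_order_section_vanish:
  assumes \<Delta>: "first_order_at L x \<Delta>" and s: "s \<in> sections L" "coef (e x) (s x) = 0" "jgrad s = 0"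
  shows "\<Delta> s = 0"
proof -
  have \<Delta>add: "\<Delta> (\<lambda>y. s y + r y) = \<Delta> s + \<Delta> r" if "s \<in> sections L" "r \<in> sections L" for s r
    using \<Delta> that by (simp add: first_order_at_def)
  have \<Delta>scale: "\<Delta> (\<lambda>y. c *\<^sub>R s y) = c *\<^sub>R \<Delta> s" if "s \<in> sections L" for c s
    using \<Delta> that unfolding first_order_at_def by blast
  have \<Delta>mult: "\<Delta> (\<lambda>y. f y *\<^sub>R g y *\<^sub>R s y) = f x *\<^sub>R \<Delta> (\<lambda>y. g y *\<^sub>R s y) + g x *\<^sub>R \<Delta> (\<lambda>y. f y *\<^sub>R s y)
          - f x *\<^sub>R g x *\<^sub>R \<Delta> s"
    if "f \<in> smooth_functions M" "g \<in> smooth_functions M" "s \<in> sections L" for f g s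
    using \<Delta> that by (simp add: first_order_at_def)
  obtain \<rho> W1 where \<rho>: "cutoff M V \<rho>" "x \<in> W1" "\<And>y. y \<in> W1 \<Longrightarrow> \<rho> y = 1"
    using cutoff_exists[OF frame_open[OF V(1)] V(2)] by metis
  have \<rho>s: "\<rho> \<in> smooth_functions M" using \<rho>(1) by (simp add: cutoff_def)
  have \<rho>x: "\<rho> x = 1" using \<rho> by simp
  define e0 where "e0 = frame_section V \<rho> e (\<lambda>y. 1)"
  have e0: "e0 \<in> sections L"
    unfolding e0_def
    by (rule frame_section_in[OF \<rho>(1) V(1) subset_refl]) (use smooth_at_const frame_subset[OF V(1)] in auto)
  define f where "f y = (if y \<in> V then \<rho> y * coef (e y) (s y) else 0)" for y
  have f: "f \<in> smooth_functions M"
    unfolding f_def by (rule cutoff_extend[OF \<rho>(1) section_smooth_at[OF s(1) V(1)]])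
  have fx: "f x = 0" using s(2) by (simp add: f_def)
  have fg: "gradM U \<phi> f x = 0"
  proof -
    have sm: "smooth_at M \<rho> x" "smooth_at M (loc e s) x"
      using smooth_functions_smooth_at[OF \<rho>s base_point] section_smooth_at[OF s(1) V] by auto
    have "gradM U \<phi> f x = gradM U \<phi> (\<lambda>y. \<rho> y * coef (e y) (s y)) x"
      by (rule grad_cong[OF U smooth_at_mult[OF sm] frame_open[OF V(1)] V(2)]) (simp add: f_def)
    then show ?thesis using s(2,3) by (simp add: grad_mult[OF U sm])
  qed
  have D: "first_order_function_at M x (\<lambda>g. \<Delta> (\<lambda>y. g y *\<^sub>R e0 y))"
    unfolding first_order_function_at_def
  proof (intro conjI ballI allI)
    fix f g assume "f \<in> smooth_functions M" "g \<in> smooth_functions M"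
    then show "\<Delta> (\<lambda>y. (f y + g y) *\<^sub>R e0 y) = \<Delta> (\<lambda>y. f y *\<^sub>R e0 y) + \<Delta> (\<lambda>y. g y *\<^sub>R e0 y)"
      using \<Delta>add[OF section_mult[OF _ e0] section_mult[OF _ e0]] by (simp add: scaleR_add_left)
  next
    fix c f assume "f \<in> smooth_functions M"
    then show "\<Delta> (\<lambda>y. (c * f y) *\<^sub>R e0 y) = c *\<^sub>R \<Delta> (\<lambda>y. f y *\<^sub>R e0 y)"
      using \<Delta>scale[OF section_mult[OF _ e0]] by (simp flip: scaleR_scaleR)
  next
    fix f g h assume fgh: "f \<in> smooth_functions M" "g \<in> smooth_functions M" "h \<in> smooth_functions M"
    show "\<Delta> (\<lambda>y. (f y * (g y * h y)) *\<^sub>R e0 y) = f x *\<^sub>R \<Delta> (\<lambda>y. (g y * h y) *\<^sub>R e0 y) +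
        g x *\<^sub>R \<Delta> (\<lambda>y. (f y * h y) *\<^sub>R e0 y) - (f x * g x) *\<^sub>R \<Delta> (\<lambda>y. h y *\<^sub>R e0 y)"
      using \<Delta>mult[OF fgh(1,2) section_mult[OF fgh(3) e0]] by simp
  qed
  let ?q = "\<lambda>y. \<rho> y * \<rho> y"
  have qs: "?q y *\<^sub>R s y = f y *\<^sub>R e0 y" for y
  proof (cases "y \<in> V")
    case True
    have "f y *\<^sub>R e0 y = ?q y *\<^sub>R (coef (e y) (s y) *\<^sub>R e y)"
      using True by (simp add: f_def e0_def frame_section_def)
    then show ?thesis by (simp only: section_coef[OF s(1) V(1) True])
  qed (simp add: f_def cutoff_zero[OF \<rho>(1)])
  have zero: "\<Delta> (\<lambda>y. g y *\<^sub>R ?q y *\<^sub>R s y) = 0" if g: "g \<in> smooth_functions M" for g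
  proof -
    have sm: "smooth_at M g x" "smooth_at M f x" using g f base_point smooth_functions_smooth_at by auto
    have "\<Delta> (\<lambda>y. (g y * f y) *\<^sub>R e0 y) = 0"
      by (rule first_order_function_vanish[OF D U smooth_functions_mult[OF g f]])
        (simp_all add: fx fg grad_mult[OF U sm])
    moreover have "(\<lambda>y. (g y * f y) *\<^sub>R e0 y) = (\<lambda>y. g y *\<^sub>R ?q y *\<^sub>R s y)"
      by (simp add: qs)
    ultimately show ?thesis by simp
  qed
  define one where "one y = (if y \<in> pts M then 1 else 0 :: real)" for y
  have one: "one \<in> smooth_functions M" using smooth_functions_one[of 1] by (simp add: one_def[abs_def])
  have q: "?q \<in> smooth_functions M" using smooth_functions_mult[OF \<rho>s \<rho>s] .
  define a where "a y = one y + (- 1) * ?q y" for y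
  have a: "a \<in> smooth_functions M"
    unfolding a_def[abs_def] by (intro smooth_functions_add one smooth_functions_cmult q)
  define g where "g y = 2 * one y + (- 1) * ?q y" for y
  have g: "g \<in> smooth_functions M"
    unfolding g_def[abs_def] by (intro smooth_functions_add one smooth_functions_cmult q)
  have ax: "a x = 0" using base_point \<rho>x by (simp add: a_def one_def)
  have "s y = a y *\<^sub>R a y *\<^sub>R s y + g y *\<^sub>R ?q y *\<^sub>R s y" for y
  proof (cases "y \<in> pts M")
    case True
    have "a y * a y + g y * ?q y = 1"
      using True by (simp add: a_def g_def one_def) (simp add: algebra_simps)
    then show ?thesis by (metis scaleR_add_left scaleR_one scaleR_scaleR)
  qed (simp add: section_outside[OF s(1)])
  then have "\<Delta> s = \<Delta> (\<lambda>y. a y *\<^sub>R a y *\<^sub>R s y + g y *\<^sub>R ?q y *\<^sub>R s y)" by presburger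
  also have "\<dots> = \<Delta> (\<lambda>y. a y *\<^sub>R a y *\<^sub>R s y) + \<Delta> (\<lambda>y. g y *\<^sub>R ?q y *\<^sub>R s y)"
    by (intro \<Delta>add section_mult a g q s(1))
  also have "\<dots> = 0" using \<Delta>mult[OF a a s(1)] zero[OF g] by (simp add: ax)
  finally show ?thesis .
qed

lemma first_order_eq:
  assumes \<Delta>: "first_order_at L x \<Delta>" and s: "s \<in> sections L" and r: "r \<in> sections L"
    and eq: "coef (e x) (s x) = coef (e x) (r x)" "jgrad s = jgrad r"
  shows "\<Delta> s = \<Delta> r"
proof -
  have mr: "(\<lambda>y. - 1 *\<^sub>R r y) \<in> sections L" by (rule section_scale[OF r])
  have "\<Delta> (\<lambda>y. s y + - 1 *\<^sub>R r y) = 0"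
  proof (rule first_order_section_vanish[OF \<Delta> section_add[OF s mr]])
    show "jgrad (\<lambda>y. s y + - 1 *\<^sub>R r y) = 0"
      using jgrad_add[OF s mr] jgrad_scale[OF r, of "- 1"] eq(2) by simp
    show "coef (e x) (s x + - 1 *\<^sub>R r x) = 0"
      using loc_add[OF V section_fibre[OF s base_point] section_fibre[OF mr base_point]]
        loc_scaleR[OF V section_fibre[OF r base_point], of "- 1"] eq(1) by simp
  qed
  moreover have "\<Delta> (\<lambda>y. s y + - 1 *\<^sub>R r y) = \<Delta> s + \<Delta> (\<lambda>y. - 1 *\<^sub>R r y)"
    by (rule bspec[OF bspec[OF \<Delta>[unfolded first_order_at_def, THEN conjunct1] s] mr])
  moreover have "\<Delta> (\<lambda>y. - 1 *\<^sub>R r y) = - 1 *\<^sub>R \<Delta> r"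
    using \<Delta>[unfolded first_order_at_def, THEN conjunct2, THEN conjunct1] r by blast
  ultimately show ?thesis by simp
qed

text \<open>For every value \<open>u\<close> and gradient \<open>w\<close> a section with this jet.
  For a fixed cut-off function the section depends linearly on \<open>(u, w)\<close>, which
  \<open>first_order_der_comb\<close> exploits.\<close>

lemma affine_section:
  assumes \<rho>: "cutoff M W \<rho>" "W \<subseteq> U \<inter> V" "openin T W1" "x \<in> W1" "W1 \<subseteq> W" "\<And>y. y \<in> W1 \<Longrightarrow> \<rho> y = 1"
  shows "frame_section W \<rho> e (\<lambda>y. u + w \<bullet> (\<phi> y - \<phi> x)) \<in> sections L"
    and "coef (e x) (frame_section W \<rho> e (\<lambda>y. u + w \<bullet> (\<phi> y - \<phi> x)) x) = u"
    and "w \<in> E \<Longrightarrow> jgrad (frame_section W \<rho> e (\<lambda>y. u + w \<bullet> (\<phi> y - \<phi> x))) = w"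
proof -
  let ?a = "\<lambda>y. u + w \<bullet> (\<phi> y - \<phi> x)" and ?s = "frame_section W \<rho> e (\<lambda>y. u + w \<bullet> (\<phi> y - \<phi> x))"
  have W: "W \<subseteq> V" using \<rho>(2) by auto
  show "?s \<in> sections L"
    by (rule frame_section_in[OF \<rho>(1) V(1) W]) (rule smooth_at_affine[OF U(1)], use \<rho>(2) in auto)
  have l: "coef (e y) (?s y) = ?a y" if "y \<in> W1" for y
    using loc_frame_section[OF V(1) W, of y] \<rho>(5) \<rho>(6)[OF that] that by auto
  show "coef (e x) (?s x) = u" using l[OF \<rho>(4)] by simp
  assume w: "w \<in> E"
  have "jgrad ?s = gradM U \<phi> ?a x"
    by (rule grad_cong[OF U smooth_at_affine[OF U] \<rho>(3,4)]) (rule l[symmetric])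
  then show "jgrad ?s = w" by (simp add: grad_affine[OF U w])
qed

lemma cutoff_at:
  obtains W \<rho> W1 where "cutoff M W \<rho>" "W \<subseteq> U \<inter> V" "openin T W1" "x \<in> W1" "W1 \<subseteq> W" "\<And>y. y \<in> W1 \<Longrightarrow> \<rho> y = 1"
  using cutoff_exists[OF openin_Int[OF openin_chart[OF U(1)] frame_open[OF V(1)]], of x] U(2) V(2)
  by (metis IntI subset_refl)

lemma section_with_jet:
  assumes "w \<in> E" obtains s where "s \<in> sections L" "coef (e x) (s x) = u" "jgrad s = w"
proof -
  obtain W \<rho> W1 where \<rho>: "cutoff M W \<rho>" "W \<subseteq> U \<inter> V" "openin T W1" "x \<in> W1" "W1 \<subseteq> W"
    "\<And>y. y \<in> W1 \<Longrightarrow> \<rho> y = 1"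
    using cutoff_at by metis
  show thesis
    by (rule that[of "frame_section W \<rho> e (\<lambda>y. u + w \<bullet> (\<phi> y - \<phi> x))"])
      (use affine_section[OF \<rho>(1-5)] \<rho>(6) assms in blast)+
qed

abbreviation "dc \<equiv> der_comb L U \<phi> e x"

text \<open>The functional is determined by its values on the affine sections, and these depend
  linearly on the jet. Together with \<open>der_comb_in\<close> this shows that a fibre-valued
  first-order functional acts on sections as a derivation, without exhibiting its symbol; brackets
  and commutators are treated in this way.\<close>

lemma first_order_der_comb:
  assumes \<Delta>: "first_order_at L x \<Delta>" and fib: "\<And>s. s \<in> sections L \<Longrightarrow> \<Delta> s \<in> fibre L x"
  obtains k w where "w \<in> E" "\<And>s. s \<in> sections L \<Longrightarrow> \<Delta> s = dc k w s"
proof -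
  have \<Delta>add: "\<Delta> (\<lambda>y. s y + r y) = \<Delta> s + \<Delta> r" if "s \<in> sections L" "r \<in> sections L" for s r
    using \<Delta> that by (simp add: first_order_at_def)
  have \<Delta>scale: "\<Delta> (\<lambda>y. c *\<^sub>R s y) = c *\<^sub>R \<Delta> s" if "s \<in> sections L" for c s
    using \<Delta> that unfolding first_order_at_def by blast
  obtain W \<rho> W1 where \<rho>: "cutoff M W \<rho>" "W \<subseteq> U \<inter> V" "openin T W1" "x \<in> W1" "W1 \<subseteq> W" "\<And>y. y \<in> W1 \<Longrightarrow> \<rho> y = 1"
    using cutoff_at by metis
  define F where "F u w = frame_section W \<rho> e (\<lambda>y. u + w \<bullet> (\<phi> y - \<phi> x))" for u w
  have F: "F u w \<in> sections L" "coef (e x) (F u w x) = u" "w \<in> E \<Longrightarrow> jgrad (F u w) = w" for u w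
    unfolding F_def using affine_section[OF \<rho>(1-5)] \<rho>(6) by blast+
  have Fadd: "F (u + u') (w + w') = (\<lambda>y. F u w y + F u' w' y)" for u u' w w'
    by (auto simp: F_def frame_section_def fun_eq_iff inner_add_left algebra_simps)
  have Fscale: "F (c * u) (c *\<^sub>R w) = (\<lambda>y. c *\<^sub>R F u w y)" for c u w
    by (auto simp: F_def frame_section_def fun_eq_iff algebra_simps)
  have lin: "linear (\<lambda>w. coef (e x) (\<Delta> (F 0 w)))"
  proof (rule linearI)
    fix w w'
    show "coef (e x) (\<Delta> (F 0 (w + w'))) = coef (e x) (\<Delta> (F 0 w)) + coef (e x) (\<Delta> (F 0 w'))"
      using \<Delta>add[OF F(1)[of 0 w] F(1)[of 0 w']] Fadd[of 0 0 w w'] loc_add[OF V fib[OF F(1)] fib[OF F(1)]] by simp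
  next
    fix c w
    show "coef (e x) (\<Delta> (F 0 (c *\<^sub>R w))) = c *\<^sub>R coef (e x) (\<Delta> (F 0 w))"
      using \<Delta>scale[OF F(1)[of 0 w], of c] Fscale[of c 0 w] loc_scaleR[OF V fib[OF F(1)]] by simp
  qed
  define w0 where "w0 = (\<Sum>b\<in>Basis. coef (e x) (\<Delta> (F 0 b)) *\<^sub>R b)"
  have w0: "coef (e x) (\<Delta> (F 0 w)) = w0 \<bullet> w" for w
    unfolding w0_def by (rule linear_functional_inner[OF lin])
  \<comment> \<open>\<open>?k\<close> is the response to the section that is constant in the frame
    near \<open>x\<close>. The vector \<open>w0\<close> may be projected to the model, because it is
    paired with gradients only.\<close>
  let ?k = "coef (e x) (\<Delta> (F 1 0))" and ?w = "proj (model M) w0"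
  have "\<Delta> s = dc ?k ?w s" if s: "s \<in> sections L" for s
  proof -
    let ?u = "coef (e x) (s x)" and ?g = "jgrad s"
    have "\<Delta> s = \<Delta> (F ?u ?g)"
      by (rule first_order_eq[OF \<Delta> s F(1)]) (simp_all only: F(2) F(3)[OF grad_in_span])
    also have "\<dots> = ?u *\<^sub>R \<Delta> (F 1 0) + \<Delta> (F 0 ?g)"
      using \<Delta>add[OF F(1) F(1), of ?u 0 0 ?g] Fadd[of ?u 0 0 ?g] Fscale[of ?u 1 0] \<Delta>scale[OF F(1), of ?u 1 0] by simp
    also have "\<dots> = ?u *\<^sub>R (?k *\<^sub>R e x) + (w0 \<bullet> ?g) *\<^sub>R e x"
      using fibre_coef[OF V fib[OF F(1)]] w0[of ?g] by metis
    also have "\<dots> = dc ?k ?w s"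
      using s by (simp add: der_comb_def proj_inner[OF model_Basis grad_in_span] scaleR_add_left mult.commute)
    finally show ?thesis .
  qed
  then show thesis using that proj_in_span by blast
qed

section \<open>The spaces \<open>D_xL\<close> and \<open>J^1_xL\<close> in coordinates\<close>

lemma der_comb_in: "dc k w \<in> der_space L x"
proof -
  have "dc k w (\<lambda>y. f y *\<^sub>R s y) = f x *\<^sub>R dc k w s + tangent_comb M U \<phi> x w f *\<^sub>R s x"
    if f: "f \<in> smooth_functions M" and s: "s \<in> sections L" for f s
  proof -
    have "tangent_comb M U \<phi> x w f *\<^sub>R s x = ((w \<bullet> gradM U \<phi> f x) * coef (e x) (s x)) *\<^sub>R e x"
      using section_coef[OF s V] f by (metis scaleR_scaleR tangent_comb_def)
    then show ?thesis
      using s section_mult[OF f s] loc_scaleR[OF V section_fibre[OF s base_point], of "f x"]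
      by (simp add: der_comb_def jgrad_mult[OF f s] inner_add_right flip: scaleR_add_left)
        (simp add: algebra_simps)
  qed
  moreover have "dc k w s \<in> fibre L x" for s
    using frame_fibre[OF V] fibre_subspace[OF base_point] by (simp add: der_comb_def subspace_scale subspace_0)
  moreover have "dc k w (\<lambda>y. s y + r y) = dc k w s + dc k w r"
    if s: "s \<in> sections L" "r \<in> sections L" for s r
    using s section_add[OF s] loc_add[OF V section_fibre[OF s(1) base_point] section_fibre[OF s(2) base_point]]
    by (simp add: der_comb_def jgrad_add[OF s] inner_add_right) (simp add: algebra_simps)
  moreover have "dc k w (\<lambda>y. c *\<^sub>R s y) = c *\<^sub>R dc k w s"
    if s: "s \<in> sections L" for c s
    using s section_scale[OF s] loc_scaleR[OF V section_fibre[OF s base_point]]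
    by (simp add: der_comb_def jgrad_scale[OF s] algebra_simps)
  moreover have "dc k w s = 0" if "s \<notin> sections L" for s
    using that by (simp add: der_comb_def)
  ultimately show ?thesis
    unfolding der_space_def mem_Collect_eq using tangent_comb_in[OF U, of w] by blast
qed

lemma der_space_first_order:
  assumes "a \<in> der_space L x" shows "first_order_at L x a"
proof -
  obtain \<delta> where \<delta>: "\<And>f s. f \<in> smooth_functions M \<Longrightarrow> s \<in> sections L \<Longrightarrow>
      a (\<lambda>y. f y *\<^sub>R s y) = f x *\<^sub>R a s + \<delta> f *\<^sub>R s x"
    using assms unfolding der_space_def by blast
  have "a (\<lambda>y. f y *\<^sub>R g y *\<^sub>R s y) = f x *\<^sub>R a (\<lambda>y. g y *\<^sub>R s y) + g x *\<^sub>R a (\<lambda>y. f y *\<^sub>R s y)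
          - f x *\<^sub>R g x *\<^sub>R a s"
    if "f \<in> smooth_functions M" "g \<in> smooth_functions M" "s \<in> sections L" for f g s
    unfolding \<delta>[OF that(1) section_mult[OF that(2,3)]] \<delta>[OF that(2,3)] \<delta>[OF that(1,3)]
    by (simp add: algebra_simps)
  then show ?thesis
    using assms unfolding first_order_at_def der_space_def by blast
qed

lemma der_space_comb:
  assumes "a \<in> der_space L x" obtains k w where "w \<in> E" "a = dc k w"
proof -
  have "\<And>s. s \<in> sections L \<Longrightarrow> a s \<in> fibre L x" "\<And>s. s \<notin> sections L \<Longrightarrow> a s = 0"
    using assms by (auto simp: der_space_def)
  moreover from this(1) obtain k w where "w \<in> E" "\<And>s. s \<in> sections L \<Longrightarrow> a s = dc k w s"
    using first_order_der_comb[OF der_space_first_order[OF assms]] by metis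
  ultimately have "a = dc k w" by (auto simp: der_comb_def fun_eq_iff)
  then show thesis using that \<open>w \<in> E\<close> by blast
qed

text \<open>The derivations \<open>dc k w\<close> separate values and gradients; conversely,
  derivations are first-order functionals and so depend on nothing else.\<close>

lemma jet_of_eq_iff:
  assumes s: "s \<in> sections L" and r: "r \<in> sections L"
  shows "jet_of L x s = jet_of L x r \<longleftrightarrow> coef (e x) (s x) = coef (e x) (r x) \<and> jgrad s = jgrad r"
proof
  assume eq: "jet_of L x s = jet_of L x r"
  have "dc k w s = dc k w r" for k w
    using fun_cong[OF eq, of "dc k w"] der_comb_in by (simp add: jet_of_def)
  then have *: "k * coef (e x) (s x) + w \<bullet> jgrad s = k * coef (e x) (r x) + w \<bullet> jgrad r" for k w
    using s r frame_nz[OF V] by (simp add: der_comb_def)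
  then have "w \<bullet> jgrad s = w \<bullet> jgrad r" for w using *[of 0 w] by simp
  then have "jgrad s = jgrad r" by (metis euclidean_eqI inner_commute)
  then show "coef (e x) (s x) = coef (e x) (r x) \<and> jgrad s = jgrad r" using *[of 1 0] by simp
next
  assume *: "coef (e x) (s x) = coef (e x) (r x) \<and> jgrad s = jgrad r"
  then have "a s = a r" if "a \<in> der_space L x" for a
    using first_order_eq[OF der_space_first_order[OF that] s r] by simp
  then show "jet_of L x s = jet_of L x r" by (auto simp: jet_of_def)
qed

lemma jet_of_in: "s \<in> sections L \<Longrightarrow> jet_of L x s \<in> jet_space L x"
proof -
  assume s: "s \<in> sections L"
  have add: "(\<lambda>s. a s + b s) \<in> der_space L x" if ab: "a \<in> der_space L x" "b \<in> der_space L x" for a b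
  proof -
    obtain k w k' w' where "a = dc k w" "b = dc k' w'"
      using der_space_comb ab by metis
    then have "(\<lambda>s. a s + b s) = dc (k + k') (w + w')"
      by (auto simp: der_comb_def fun_eq_iff algebra_simps)
    then show ?thesis using der_comb_in by simp
  qed
  have scale: "(\<lambda>s. c *\<^sub>R a s) \<in> der_space L x" if a: "a \<in> der_space L x" for c a
  proof -
    obtain k w where "a = dc k w" using der_space_comb a by metis
    then have "(\<lambda>s. c *\<^sub>R a s) = dc (c * k) (c *\<^sub>R w)"
      by (auto simp: der_comb_def fun_eq_iff algebra_simps)
    then show ?thesis using der_comb_in by simp
  qed
  show ?thesis
    unfolding jet_space_def jet_of_def using s add scale by (auto simp: der_space_def[of L x])
qed

text \<open>A linear map from \<open>D_xL\<close> to the fibre is determined by its values on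
  \<open>dc 1 0\<close> and \<open>dc 0 b\<close>; these are taken as value and gradient of a
  section. This makes the choice in \<open>section_of_jet\<close> meaningful.\<close>

lemma jet_space_section:
  assumes \<alpha>: "\<alpha> \<in> jet_space L x" obtains s where "s \<in> sections L" "\<alpha> = jet_of L x s"
proof -
  have fib: "\<alpha> a \<in> fibre L x" if "a \<in> der_space L x" for a
    using \<alpha> that by (simp add: jet_space_def)
  have \<alpha>add: "\<alpha> (\<lambda>s. a s + b s) = \<alpha> a + \<alpha> b" if "a \<in> der_space L x" "b \<in> der_space L x" for a b
    using \<alpha> that by (simp add: jet_space_def)
  have \<alpha>scale: "\<alpha> (\<lambda>s. c *\<^sub>R a s) = c *\<^sub>R \<alpha> a" if "a \<in> der_space L x" for c a
    using \<alpha> that unfolding jet_space_def by blast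
  have add: "dc (k + k') (w + w') = (\<lambda>s. dc k w s + dc k' w' s)" for k k' w w'
    by (auto simp: der_comb_def fun_eq_iff algebra_simps)
  have scale: "dc (c * k) (c *\<^sub>R w) = (\<lambda>s. c *\<^sub>R dc k w s)" for c k w
    by (auto simp: der_comb_def fun_eq_iff algebra_simps)
  have lin: "linear (\<lambda>w. coef (e x) (\<alpha> (dc 0 w)))"
  proof (rule linearI)
    fix w w'
    show "coef (e x) (\<alpha> (dc 0 (w + w'))) = coef (e x) (\<alpha> (dc 0 w)) + coef (e x) (\<alpha> (dc 0 w'))"
      using \<alpha>add[OF der_comb_in der_comb_in, of 0 w 0 w'] add[of 0 0 w w']
        loc_add[OF V fib[OF der_comb_in] fib[OF der_comb_in]] by simp
  next
    fix c w
    show "coef (e x) (\<alpha> (dc 0 (c *\<^sub>R w))) = c *\<^sub>R coef (e x) (\<alpha> (dc 0 w))"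
      using \<alpha>scale[OF der_comb_in, of c 0 w] scale[of c 0 w] loc_scaleR[OF V fib[OF der_comb_in]] by simp
  qed
  define w0 where "w0 = (\<Sum>b\<in>Basis. coef (e x) (\<alpha> (dc 0 b)) *\<^sub>R b)"
  have w0: "coef (e x) (\<alpha> (dc 0 w)) = w0 \<bullet> w" for w
    unfolding w0_def by (rule linear_functional_inner[OF lin])
  let ?u = "coef (e x) (\<alpha> (dc 1 0))"
  obtain s where s: "s \<in> sections L" "coef (e x) (s x) = ?u" "jgrad s = proj (model M) w0"
    using section_with_jet[OF proj_in_span] by metis
  have "\<alpha> a = jet_of L x s a" for a
  proof (cases "a \<in> der_space L x")
    case True
    then obtain k w where a: "w \<in> E" "a = dc k w" by (rule der_space_comb)
    have "\<alpha> a = k *\<^sub>R \<alpha> (dc 1 0) + \<alpha> (dc 0 w)"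
      using \<alpha>add[OF der_comb_in der_comb_in, of k 0 0 w] add[of k 0 0 w] scale[of k 1 0]
        \<alpha>scale[OF der_comb_in, of k 1 0] a(2) by simp
    also have "\<dots> = k *\<^sub>R (?u *\<^sub>R e x) + (w0 \<bullet> w) *\<^sub>R e x"
      using fibre_coef[OF V fib[OF der_comb_in]] w0[of w] by metis
    also have "\<dots> = a s"
      using s a by (simp add: der_comb_def inner_commute[of w] proj_inner[OF model_Basis a(1)] scaleR_add_left)
    finally show ?thesis using True by (simp add: jet_of_def)
  next
    case False
    then show ?thesis using \<alpha> by (simp add: jet_of_def jet_space_def)
  qed
  then show thesis using that s(1) by blast
qed

lemma section_of_jet:
  assumes "\<alpha> \<in> jet_space L x"
  shows "section_of_jet L x \<alpha> \<in> sections L" "jet_of L x (section_of_jet L x \<alpha>) = \<alpha>"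
proof -
  have "\<exists>s. s \<in> sections L \<and> jet_of L x s = \<alpha>" using jet_space_section[OF assms] by metis
  from someI_ex[OF this]
  show "section_of_jet L x \<alpha> \<in> sections L" "jet_of L x (section_of_jet L x \<alpha>) = \<alpha>"
    by (simp_all add: section_of_jet_def)
qed

text \<open>\<open>jet_coords\<close> is defined through the chosen \<open>section_of_jet\<close>.
  Any other representative of the jet gives the same coordinates, since equal jets have equal values
  and gradients.\<close>

lemma jet_coords_eq:
  assumes s: "s \<in> sections L"
  shows "jet_coords L U \<phi> e (x, jet_of L x s) = (\<phi> x, coef (e x) (s x), jgrad s)"
proof -
  let ?s = "section_of_jet L x (jet_of L x s)"
  note s' = section_of_jet[OF jet_of_in[OF s]]
  have *: "coef (e x) (?s x) = coef (e x) (s x)" "jgrad ?s = jgrad s"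
    using jet_of_eq_iff[OF s'(1) s] s'(2) by auto
  have "inv_into U \<phi> (\<phi> x) = x" using chart_inj[OF U(1)] U(2) by simp
  then have "jet_coords L U \<phi> e (x, jet_of L x s) = (\<phi> x, coef (e x) (?s x), jgrad ?s)"
    by (simp add: jet_coords_def Let_def grad_def partial_def comp_def)
  then show ?thesis by (simp add: *)
qed

end

end

section \<open>Submanifolds\<close>

lemma submfd_simps [simp]:
  "pts (submfd M K S) = S" "model (submfd M K S) = K"
  "atlas (submfd M K S) = (\<lambda>(U, \<phi>). (U \<inter> S, \<phi>)) ` slice_charts M K S"
  by (simp_all add: submfd_def)

context atlas_mfd
begin

context
  fixes K S assumes S: "embedded_submanifold M K S"
begin

lemma S_subset: "S \<subseteq> pts M" and K_subset: "K \<subseteq> model M"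
  using S by (auto simp: embedded_submanifold_def)

lemma K_Basis: "K \<subseteq> Basis"
  using K_subset model_Basis by auto

lemma slice_chart: "(U, \<phi>) \<in> slice_charts M K S \<Longrightarrow> (U, \<phi>) \<in> charts M"
  by (simp add: slice_charts_def)

lemma slice_chart_iff:
  assumes "(U, \<phi>) \<in> slice_charts M K S" "y \<in> U" shows "\<phi> y \<in> span K \<longleftrightarrow> y \<in> S"
proof -
  have "\<phi> ` (U \<inter> S) = \<phi> ` U \<inter> span K" using assms by (simp add: slice_charts_def)
  then have "\<phi> y \<in> span K \<longleftrightarrow> \<phi> y \<in> \<phi> ` (U \<inter> S)" using assms(2) by auto
  also have "\<dots> \<longleftrightarrow> y \<in> S"
    using inj_on_image_mem_iff[OF chart_inj[OF slice_chart[OF assms(1)]] assms(2), of "U \<inter> S"] assms(2) by auto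
  finally show ?thesis .
qed

lemma slice_chart_at:
  assumes "x \<in> S" obtains U \<phi> where "(U, \<phi>) \<in> slice_charts M K S" "x \<in> U"
  using S assms unfolding embedded_submanifold_def by fastforce

lemma openin_slice_image:
  assumes U: "(U, \<phi>) \<in> slice_charts M K S" and A: "openin (top_of_set E) (\<phi> ` A)" "A \<subseteq> U"
  shows "openin (top_of_set (span K)) (\<phi> ` (A \<inter> S))"
proof -
  obtain N where N: "open N" "\<phi> ` A = E \<inter> N" using A(1) openin_open by metis
  have "\<phi> ` (A \<inter> S) = \<phi> ` A \<inter> span K"
    using slice_chart_iff[OF U] A(2) by auto
  also have "\<dots> = span K \<inter> N" using N(2) span_mono[OF K_subset] by auto
  finally show ?thesis using N(1) by auto
qed

lemma atlas_mfd_submfd: "atlas_mfd (submfd M K S)"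
proof
  show "model (submfd M K S) \<subseteq> Basis" using K_Basis by simp
  show "is_chart (submfd M K S) c" if "c \<in> atlas (submfd M K S)" for c
  proof -
    obtain U \<phi> where c: "c = (U \<inter> S, \<phi>)" "(U, \<phi>) \<in> slice_charts M K S" using \<open>c \<in> _\<close> by auto
    show ?thesis
      using inj_on_subset[OF chart_inj[OF slice_chart[OF c(2)]], of "U \<inter> S"]
        openin_slice_image[OF c(2) chart_openin[OF slice_chart[OF c(2)]] subset_refl]
      by (simp add: is_chart_def c(1))
  qed
  show "compatible (submfd M K S) c d" if cd: "c \<in> atlas (submfd M K S)" "d \<in> atlas (submfd M K S)" for c d
  proof -
    have half: "openin (top_of_set (span K)) (\<phi> ` (U \<inter> S \<inter> (V \<inter> S))) \<and>
        smooth_on (\<phi> ` (U \<inter> S \<inter> (V \<inter> S))) (\<psi> \<circ> inv_into (U \<inter> S) \<phi>)"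
      if U: "(U, \<phi>) \<in> slice_charts M K S" and V: "(V, \<psi>) \<in> slice_charts M K S" for U \<phi> V \<psi>
    proof
      have c: "compatible M (U, \<phi>) (V, \<psi>)"
        by (rule charts_compatible[OF slice_chart[OF U] slice_chart[OF V]])
      have eq: "U \<inter> S \<inter> (V \<inter> S) = U \<inter> V \<inter> S" by auto
      show "openin (top_of_set (span K)) (\<phi> ` (U \<inter> S \<inter> (V \<inter> S)))"
        unfolding eq by (rule openin_slice_image[OF U]) (use c in \<open>auto simp: compatible_def\<close>)
      have inj: "inj_on \<phi> U" "inj_on \<phi> (U \<inter> S)"
        using chart_inj[OF slice_chart[OF U]] by (auto simp: inj_on_def)
      have sm: "smooth_on (\<phi> ` (U \<inter> V)) (\<psi> \<circ> inv_into U \<phi>)"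
        using c by (simp add: compatible_def)
      show "smooth_on (\<phi> ` (U \<inter> S \<inter> (V \<inter> S))) (\<psi> \<circ> inv_into (U \<inter> S) \<phi>)"
        unfolding smooth_on_def eq
      proof
        fix p assume p: "p \<in> \<phi> ` (U \<inter> V \<inter> S)"
        then obtain W g where W: "open W" "p \<in> W" "\<forall>k. C_diff k W g"
          "\<forall>y\<in>\<phi> ` (U \<inter> V) \<inter> W. g y = (\<psi> \<circ> inv_into U \<phi>) y"
          using sm unfolding smooth_on_def by blast
        have "g y = (\<psi> \<circ> inv_into (U \<inter> S) \<phi>) y" if "y \<in> \<phi> ` (U \<inter> V \<inter> S) \<inter> W" for y
          using that W(4) inj by auto
        then show "\<exists>W g. open W \<and> p \<in> W \<and> (\<forall>k. C_diff k W g) \<and>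
            (\<forall>y\<in>\<phi> ` (U \<inter> V \<inter> S) \<inter> W. g y = (\<psi> \<circ> inv_into (U \<inter> S) \<phi>) y)"
          using W by blast
      qed
    qed
    obtain U \<phi> where "c = (U \<inter> S, \<phi>)" "(U, \<phi>) \<in> slice_charts M K S" using cd(1) by auto
    moreover obtain V \<psi> where "d = (V \<inter> S, \<psi>)" "(V, \<psi>) \<in> slice_charts M K S" using cd(2) by auto
    ultimately show ?thesis
      using half[of U \<phi> V \<psi>] half[of V \<psi> U \<phi>] by (simp add: compatible_def Int_commute)
  qed
  show "(\<Union>c\<in>atlas (submfd M K S). fst c) = pts (submfd M K S)"
  proof (intro equalityI subsetI)
    fix x assume "x \<in> pts (submfd M K S)"
    then obtain U \<phi> where "(U, \<phi>) \<in> slice_charts M K S" "x \<in> U \<inter> S"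
      using slice_chart_at by (metis Int_iff submfd_simps(1))
    then show "x \<in> (\<Union>c\<in>atlas (submfd M K S). fst c)" by force
  qed auto
qed

interpretation N: atlas_mfd "submfd M K S" by (rule atlas_mfd_submfd)

lemma slice_chart_restrict: "(U, \<phi>) \<in> slice_charts M K S \<Longrightarrow> (U \<inter> S, \<phi>) \<in> charts (submfd M K S)"
  by (rule N.atlas_subset_charts) force

lemma openin_restrict: "openin T W \<Longrightarrow> openin (mfd_topology (submfd M K S)) (W \<inter> S)"
proof (rule N.openin_local)
  fix x assume W: "openin T W" and x: "x \<in> W \<inter> S"
  then obtain U \<phi> where U: "(U, \<phi>) \<in> slice_charts M K S" "x \<in> U" using slice_chart_at by auto
  obtain O' where "open O'" "\<phi> x \<in> O'" "\<And>y. y \<in> U \<Longrightarrow> \<phi> y \<in> O' \<Longrightarrow> y \<in> W"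
    using chart_nbhd[OF W slice_chart[OF U(1)] _ U(2)] x by (metis IntD1)
  then show "\<exists>U \<phi> O'. (U, \<phi>) \<in> charts (submfd M K S) \<and> x \<in> U \<and> open O' \<and> \<phi> x \<in> O' \<and>
      (\<forall>y\<in>U. \<phi> y \<in> O' \<longrightarrow> y \<in> W \<inter> S)"
    using slice_chart_restrict[OF U(1)] U(2) x
    by (intro exI[of _ "U \<inter> S"] exI[of _ \<phi>] exI[of _ O']) auto
qed

lemma smooth_at_restrict:
  assumes "smooth_at M f x" "x \<in> S" "\<And>y. y \<in> S \<Longrightarrow> g y = f y"
  shows "smooth_at (submfd M K S) g x"
proof -
  obtain U \<phi> where U: "(U, \<phi>) \<in> slice_charts M K S" "x \<in> U" using slice_chart_at assms(2) by auto
  obtain O' G W where 1: "open O'" "Cinf O' G" "openin T W" "x \<in> W" "W \<subseteq> U" "\<phi> ` W \<subseteq> O'"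
    "\<And>y. y \<in> W \<Longrightarrow> f y = G (\<phi> y)" using smooth_atE[OF assms(1) slice_chart[OF U(1)] U(2)] by metis
  show ?thesis
    by (rule N.smooth_atI[OF slice_chart_restrict[OF U(1)] 1(1,2) openin_restrict[OF 1(3)]])
      (use 1(4-7) assms(2,3) in auto)
qed

lemma partial_restrict:
  assumes "smooth_at M f x" "x \<in> S" "\<And>y. y \<in> S \<Longrightarrow> g y = f y"
    and U: "(U, \<phi>) \<in> slice_charts M K S" "x \<in> U" and b: "b \<in> K"
  shows "partial (U \<inter> S) \<phi> b g x = partial U \<phi> b f x"
proof -
  obtain O' G W where 1: "open O'" "Cinf O' G" "openin T W" "x \<in> W" "W \<subseteq> U" "\<phi> ` W \<subseteq> O'"
    "\<And>y. y \<in> W \<Longrightarrow> f y = G (\<phi> y)" using smooth_atE[OF assms(1) slice_chart[OF U(1)] U(2)] by metis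
  have "partial U \<phi> b f x = frechet_derivative G (at (\<phi> x)) b"
    by (rule partial_eq[OF slice_chart[OF U(1)] 1(3-6) 1(1,2,7)]) (use b K_subset in auto)
  moreover have "partial (U \<inter> S) \<phi> b g x = frechet_derivative G (at (\<phi> x)) b"
    by (rule N.partial_eq[OF slice_chart_restrict[OF U(1)] openin_restrict[OF 1(3)] _ _ _ 1(1,2)])
      (use 1(4-7) assms(2,3) b in auto)
  ultimately show ?thesis by simp
qed

text \<open>An extension \<open>G\<close> that represents \<open>f\<close> in a slice chart also
  represents its restriction, so the partial derivatives along \<open>K\<close> agree and the others
  are lost.\<close>

lemma grad_restrict:
  assumes "smooth_at M f x" "x \<in> S" "\<And>y. y \<in> S \<Longrightarrow> g y = f y"
    and U: "(U, \<phi>) \<in> slice_charts M K S" "x \<in> U"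
  shows "grad K (U \<inter> S) \<phi> g x = proj K (gradM U \<phi> f x)"
proof (rule span_Basis_eqI[OF K_Basis grad_in_span proj_in_span])
  fix b assume b: "b \<in> K"
  have "proj K (gradM U \<phi> f x) \<bullet> b = gradM U \<phi> f x \<bullet> b"
    using proj_inner[OF K_Basis span_base[OF b]] .
  also have "\<dots> = partial U \<phi> b f x" using grad_inner[of b U \<phi> f x] K_subset b by auto
  also have "\<dots> = grad K (U \<inter> S) \<phi> g x \<bullet> b"
    using N.grad_inner[of b "U \<inter> S" \<phi> g x] b partial_restrict[OF assms b] by simp
  finally show "grad K (U \<inter> S) \<phi> g x \<bullet> b = proj K (gradM U \<phi> f x) \<bullet> b" by simp
qed

lemma smooth_functions_restrict:
  assumes "f \<in> smooth_functions M"
  shows "(\<lambda>y. if y \<in> S then f y else 0) \<in> smooth_functions (submfd M K S)"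
  unfolding N.smooth_functions_iff
  using smooth_at_restrict[OF smooth_functions_smooth_at[OF assms]] S_subset by auto

text \<open>Cut-off functions on \<open>S\<close> are obtained by restriction and not chosen anew,
  so that local derivations on \<open>M\<close> can restrict to local derivations on
  \<open>S\<close>.\<close>

lemma cutoff_restrict:
  assumes "cutoff M W \<rho>"
  shows "cutoff (submfd M K S) (W \<inter> S) (\<lambda>y. if y \<in> S then \<rho> y else 0)"
proof -
  obtain W0 where W: "openin T W" "\<rho> \<in> smooth_functions M" "openin T W0" "W \<union> W0 = pts M"
    "\<forall>y\<in>W0. \<rho> y = 0" using assms(1) unfolding cutoff_def by blast
  have "W \<inter> S \<union> W0 \<inter> S = S" using W(4) S_subset by auto
  then show ?thesis
    unfolding cutoff_def
    using openin_restrict[OF W(1)] openin_restrict[OF W(3)] smooth_functions_restrict[OF W(2)] W(5)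
    by (intro conjI exI[of _ "W0 \<inter> S"]) auto
qed

end

end

lemma (in hausdorff_mfd) hausdorff_mfd_submfd:
  assumes S: "embedded_submanifold M K S" shows "hausdorff_mfd (submfd M K S)"
proof -
  interpret N: atlas_mfd "submfd M K S" by (rule atlas_mfd_submfd[OF S])
  show ?thesis
  proof
    show "Hausdorff_space N.T"
      unfolding Hausdorff_space_def
    proof (intro allI impI)
      fix x y assume "x \<in> topspace N.T \<and> y \<in> topspace N.T \<and> x \<noteq> y"
      then have xy: "x \<in> S" "y \<in> S" "x \<noteq> y" using N.topspace_T by auto
      then have "x \<in> topspace T \<and> y \<in> topspace T \<and> x \<noteq> y" using topspace_T S_subset[OF S] by auto
      then obtain A B where "openin T A" "openin T B" "x \<in> A" "y \<in> B" "disjnt A B"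
        using Hausdorff unfolding Hausdorff_space_def by blast
      then show "\<exists>A B. openin N.T A \<and> openin N.T B \<and> x \<in> A \<and> y \<in> B \<and> disjnt A B"
        using openin_restrict[OF S] xy
        by (intro exI[of _ "A \<inter> S"] exI[of _ "B \<inter> S"]) (auto simp: disjnt_def)
    qed
  qed
qed

lemma restrict_bundle_simps [simp]:
  "base (restrict_bundle L K S) = submfd (base L) K S"
  "fibre (restrict_bundle L K S) = fibre L"
  "frames (restrict_bundle L K S) = (\<lambda>(U, e). (S \<inter> U, e)) ` frames L"
  by (auto simp: restrict_bundle_def pullback_bundle_def comp_def)

context hausdorff_lbundle
begin

context
  fixes K S assumes S: "embedded_submanifold M K S"
begin

abbreviation "LS \<equiv> restrict_bundle L K S"

lemma hausdorff_lbundle_restrict: "hausdorff_lbundle LS"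
proof (rule hausdorff_lbundle.intro)
  interpret N: hausdorff_mfd "submfd M K S" by (rule hausdorff_mfd_submfd[OF S])
  have SM: "S \<subseteq> pts M" by (rule S_subset[OF S])
  show "hausdorff_mfd (base LS)" by (simp add: N.hausdorff_mfd_axioms)
  show "subspace (fibre LS x)" "dim (fibre LS x) = 1" if "x \<in> pts (base LS)" for x
    using that fibre_subspace fibre_dim SM by auto
  show "openin (mfd_topology (base LS)) U" if "(U, e) \<in> frames LS" for U e
    using that openin_restrict[OF S frame_open] by (auto simp: Int_commute)
  show "e x \<in> fibre LS x" "e x \<noteq> 0" if "(U, e) \<in> frames LS" "x \<in> U" for U e x
    using that frame_fibre frame_nz by auto
  show "(\<Union>c\<in>frames LS. fst c) = pts (base LS)"
  proof (intro equalityI subsetI)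
    fix x assume "x \<in> pts (base LS)"
    then have x: "x \<in> S" by simp
    then obtain V e where "(V, e) \<in> frames L" "x \<in> V" using frame_at SM by blast
    then show "x \<in> (\<Union>c\<in>frames LS. fst c)" using x by force
  qed auto
  show "smooth_fun_on (base LS) (U \<inter> V) (\<lambda>x. coef (e x) (e' x))"
    if "(U, e) \<in> frames LS" "(V, e') \<in> frames LS" for U e V e'
  proof -
    obtain U' V' where U: "(U', e) \<in> frames L" "U = S \<inter> U'" "(V', e') \<in> frames L" "V = S \<inter> V'"
      using \<open>(U, e) \<in> _\<close> \<open>(V, e') \<in> _\<close> by auto
    have "smooth_fun_on (submfd M K S) (U \<inter> V) (\<lambda>x. coef (e x) (e' x))"
    proof (rule N.smooth_fun_onI)
      fix x assume x: "x \<in> U \<inter> V"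
      show "smooth_at (submfd M K S) (\<lambda>x. coef (e x) (e' x)) x"
        by (rule smooth_at_restrict[OF S transition_smooth_at[OF U(1,3)]]) (use x U in auto)
    qed (use U in auto)
    then show ?thesis by simp
  qed
qed

interpretation LS: hausdorff_lbundle LS by (rule hausdorff_lbundle_restrict)

lemma frame_restrict: "(V, e) \<in> frames L \<Longrightarrow> (S \<inter> V, e) \<in> frames LS"
  by force

lemma restrict_section_in:
  assumes s: "s \<in> sections L" shows "restrict_section S s \<in> sections LS"
proof (rule LS.sectionI)
  fix x assume x: "x \<in> pts (base LS)"
  then have xS: "x \<in> S" and xM: "x \<in> pts M" using S_subset[OF S] by auto
  show "restrict_section S s x \<in> fibre LS x"
    using section_fibre[OF s xM] xS by (simp add: restrict_section_def)
  obtain V e where V: "(V, e) \<in> frames L" "x \<in> V" using frame_at[OF xM] .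
  have "smooth_at (submfd M K S) (\<lambda>y. coef (e y) (restrict_section S s y)) x"
    by (rule smooth_at_restrict[OF S section_smooth_at[OF s V] xS]) (simp add: restrict_section_def)
  then show "\<exists>V e. (V, e) \<in> frames LS \<and> x \<in> V \<and>
      smooth_at (base LS) (\<lambda>y. coef (e y) (restrict_section S s y)) x"
    using frame_restrict[OF V(1)] V(2) xS
    by (intro exI[of _ "S \<inter> V"] exI[of _ e]) (simp del: restrict_bundle_simps(3))
qed (simp add: restrict_section_def)

context
  fixes U \<phi> V e x
  assumes U: "(U, \<phi>) \<in> slice_charts M K S" "x \<in> U" and V: "(V, e) \<in> frames L" "x \<in> V" and x: "x \<in> S"
begin

lemma charts_at: "(U, \<phi>) \<in> charts M" "x \<in> U" "(V, e) \<in> frames L" "x \<in> V"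
  using U V slice_chart[OF S] by auto

lemma restricted_charts_at: "(U \<inter> S, \<phi>) \<in> charts (base LS)" "x \<in> U \<inter> S" "(S \<inter> V, e) \<in> frames LS" "x \<in> S \<inter> V"
  using U V x slice_chart_restrict[OF S] frame_restrict by auto

lemma jgrad_restrict:
  assumes s: "s \<in> sections L"
  shows "grad K (U \<inter> S) \<phi> (\<lambda>y. coef (e y) (restrict_section S s y)) x = proj K (gradM U \<phi> (loc e s) x)"
  by (rule grad_restrict[OF S section_smooth_at[OF s V] x _ U]) (simp add: restrict_section_def)

text \<open>Pairing with a vector \<open>w\<close> of \<open>span K\<close> does not see the
  difference between a gradient and its projection to \<open>span K\<close>.\<close>

lemma push_der_comb:
  assumes w: "w \<in> span K"
  shows "push_der L S (der_comb LS (U \<inter> S) \<phi> e x k w) = der_comb L U \<phi> e x k w"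
proof
  fix s
  show "push_der L S (der_comb LS (U \<inter> S) \<phi> e x k w) s = der_comb L U \<phi> e x k w s"
  proof (cases "s \<in> sections L")
    case True
    then show ?thesis
      using jgrad_restrict[OF True] restrict_section_in[OF True] x proj_inner[OF K_Basis[OF S] w]
      by (simp add: push_der_def der_comb_def inner_commute[of w]) (simp add: restrict_section_def)
  qed (simp add: push_der_def der_comb_def)
qed

text \<open>Derivations along the submanifold are those with tangent symbol, the part of order zero
  being free. This description is used for \<open>S\<close> in \<open>M\<close> and again for the
  jets over \<open>S\<close> in the jet manifold.\<close>

lemma sub_der_space_comb: "sub_der_space L K S x = {der_comb L U \<phi> e x k w |k w. w \<in> span K}"
  unfolding sub_der_space_def
proof (intro equalityI subsetI)
  fix a assume "a \<in> push_der L S ` der_space LS x"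
  then obtain a' where a': "a' \<in> der_space LS x" "a = push_der L S a'" by blast
  obtain k w where "w \<in> LS.E" "a' = der_comb LS (U \<inter> S) \<phi> e x k w"
    using LS.der_space_comb[OF restricted_charts_at a'(1)] by metis
  then have "w \<in> span K" "a' = der_comb LS (U \<inter> S) \<phi> e x k w" by simp_all
  then show "a \<in> {der_comb L U \<phi> e x k w |k w. w \<in> span K}"
    using push_der_comb a'(2) by blast
next
  fix a assume "a \<in> {der_comb L U \<phi> e x k w |k w. w \<in> span K}"
  then obtain k w where "w \<in> span K" "a = der_comb L U \<phi> e x k w" by blast
  then have "a = push_der L S (der_comb LS (U \<inter> S) \<phi> e x k w)" using push_der_comb by simp
  then show "a \<in> push_der L S ` der_space LS x" using LS.der_comb_in[OF restricted_charts_at] by (rule image_eqI)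
qed

lemma push_der_in:
  assumes "a \<in> der_space LS x" shows "push_der L S a \<in> der_space L x"
proof -
  have "push_der L S a \<in> sub_der_space L K S x" using assms by (simp add: sub_der_space_def)
  then obtain k w where "push_der L S a = der_comb L U \<phi> e x k w" unfolding sub_der_space_comb by blast
  then show ?thesis using der_comb_in[OF charts_at] by simp
qed

lemma jet_restrict_jet_of:
  assumes s: "s \<in> sections L"
  shows "jet_restrict L K S x (jet_of L x s) = jet_of LS x (restrict_section S s)"
  unfolding jet_restrict_def jet_of_def
  using s push_der_in by (auto simp: push_der_def fun_eq_iff)

lemma jet_restrict_image: "jet_restrict L K S x ` jet_space L x = jet_space LS x"
proof (intro equalityI subsetI)
  fix \<beta> assume "\<beta> \<in> jet_restrict L K S x ` jet_space L x"
  then obtain \<alpha> where \<alpha>: "\<alpha> \<in> jet_space L x" "\<beta> = jet_restrict L K S x \<alpha>" by blast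
  obtain s where s: "s \<in> sections L" "\<alpha> = jet_of L x s" using jet_space_section[OF charts_at \<alpha>(1)] .
  then show "\<beta> \<in> jet_space LS x"
    using \<alpha>(2) jet_restrict_jet_of[OF s(1)] LS.jet_of_in[OF restricted_charts_at restrict_section_in[OF s(1)]] by simp
next
  fix \<beta> assume "\<beta> \<in> jet_space LS x"
  then obtain r where r: "r \<in> sections LS" "\<beta> = jet_of LS x r" using LS.jet_space_section[OF restricted_charts_at] by metis
  \<comment> \<open>A jet on \<open>S\<close> is lifted by keeping its value and gradient and taking
    0 in the transverse directions: \<open>?w\<close> lies in \<open>span K\<close>, so it is its
    own projection.\<close>
  let ?w = "grad K (U \<inter> S) \<phi> (\<lambda>y. coef (e y) (r y)) x"
  have wK: "?w \<in> span K" by (rule grad_in_span)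
  then have "?w \<in> E" using span_mono[OF K_subset[OF S]] by auto
  then obtain s where s: "s \<in> sections L" "coef (e x) (s x) = coef (e x) (r x)" "gradM U \<phi> (loc e s) x = ?w"
    using section_with_jet[OF charts_at] by metis
  have "proj K ?w = ?w"
    unfolding proj_def by (rule span_Basis_expand[OF K_Basis[OF S] wK])
  then have "jet_of LS x (restrict_section S s) = jet_of LS x r"
    unfolding LS.jet_of_eq_iff[OF restricted_charts_at restrict_section_in[OF s(1)] r(1)]
    using s jgrad_restrict[OF s(1)] x by (simp add: restrict_section_def)
  then have "\<beta> = jet_restrict L K S x (jet_of L x s)"
    using r(2) jet_restrict_jet_of[OF s(1)] by simp
  then show "\<beta> \<in> jet_restrict L K S x ` jet_space L x" using jet_of_in[OF charts_at s(1)] by blast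
qed

end

text \<open>Surjectivity is the clause with content. Linearity and the kernel come from unfolding,
  since \<open>annihilator\<close> tests jets on the image of \<open>push_der\<close>.\<close>

lemma jet_restrict_quotient:
  assumes x: "x \<in> S" shows "induces_quotient_iso L K S x (jet_restrict L K S x)"
proof -
  obtain U \<phi> where U: "(U, \<phi>) \<in> slice_charts M K S" "x \<in> U" using slice_chart_at[OF S x] .
  have "x \<in> pts M" using x S_subset[OF S] by auto
  then obtain V e where V: "(V, e) \<in> frames L" "x \<in> V" by (rule frame_at)
  have ann: "{\<alpha> \<in> jet_space L x. jet_restrict L K S x \<alpha> = (\<lambda>a. 0)} = annihilator L K S x"
    unfolding annihilator_def sub_der_space_def jet_restrict_def by (auto simp: fun_eq_iff)
  show ?thesis
    unfolding induces_quotient_iso_def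
  proof (intro conjI ballI allI ann jet_restrict_image[OF U V x])
    fix \<alpha> \<beta> show "jet_restrict L K S x (\<lambda>a. \<alpha> a + \<beta> a) = (\<lambda>a. jet_restrict L K S x \<alpha> a + jet_restrict L K S x \<beta> a)"
      by (auto simp: jet_restrict_def fun_eq_iff)
  next
    fix c \<alpha> show "jet_restrict L K S x (\<lambda>a. c *\<^sub>R \<alpha> a) = (\<lambda>a. c *\<^sub>R jet_restrict L K S x \<alpha> a)"
      by (auto simp: jet_restrict_def fun_eq_iff)
  qed
qed

end

end

section \<open>The jet manifold\<close>

lemma smooth_on_cong: "smooth_on A f \<Longrightarrow> (\<And>x. x \<in> A \<Longrightarrow> g x = f x) \<Longrightarrow> smooth_on A g"
  unfolding smooth_on_def by (metis IntD1)

lemma smooth_on_Cinf: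
  assumes "Cinf UNIV f" shows "smooth_on A f"
  unfolding smooth_on_def using assms by (auto simp: Cinf_def intro!: exI[of _ UNIV])

lemma smooth_on_compose_Cinf:
  assumes g: "smooth_on B g" and f: "Cinf UNIV f" "f ` A \<subseteq> B"
  shows "smooth_on A (\<lambda>x. g (f x))"
  unfolding smooth_on_def
proof
  fix x assume "x \<in> A"
  then have "f x \<in> B" using f(2) by auto
  then obtain W h where W: "open W" "f x \<in> W" "\<forall>k. C_diff k W h" "\<forall>y\<in>B \<inter> W. h y = g y"
    using g unfolding smooth_on_def by blast
  have o: "open (f -` W)"
    using continuous_open_preimage[OF Cinf_continuous_on[OF f(1)] open_UNIV W(1)] by simp
  have "Cinf (f -` W) (\<lambda>x. h (f x))"
    by (rule Cinf_compose[OF o Cinf_subset[OF f(1)], of W]) (use W(3) in \<open>auto simp: Cinf_def\<close>)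
  then show "\<exists>W h. open W \<and> x \<in> W \<and> (\<forall>k. C_diff k W h) \<and> (\<forall>y\<in>A \<inter> W. h y = g (f y))"
    using o W(2,4) f(2) by (intro exI[of _ "f -` W"] exI[of _ "\<lambda>x. h (f x)"]) (auto simp: Cinf_def)
qed

lemma smooth_on_combine:
  fixes A :: "'a::euclidean_space set"
  assumes f: "smooth_on A f" and g: "smooth_on A g"
    and B: "\<And>(W :: 'a set) F G. open W \<Longrightarrow> Cinf W F \<Longrightarrow> Cinf W G \<Longrightarrow> Cinf W (\<lambda>x. B (F x) (G x))"
  shows "smooth_on A (\<lambda>x. B (f x) (g x))"
  unfolding smooth_on_def
proof
  fix x assume x: "x \<in> A"
  obtain W F where W: "open W" "x \<in> W" "\<forall>k. C_diff k W F" "\<forall>y\<in>A \<inter> W. F y = f y"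
    using f x unfolding smooth_on_def by blast
  obtain W' G where W': "open W'" "x \<in> W'" "\<forall>k. C_diff k W' G" "\<forall>y\<in>A \<inter> W'. G y = g y"
    using g x unfolding smooth_on_def by blast
  have "Cinf (W \<inter> W') F" "Cinf (W \<inter> W') G"
    using W(3) W'(3) by (auto simp: Cinf_def intro: C_diff_subset)
  from B[OF open_Int[OF W(1) W'(1)] this]
  show "\<exists>W h. open W \<and> x \<in> W \<and> (\<forall>k. C_diff k W h) \<and> (\<forall>y\<in>A \<inter> W. h y = B (f y) (g y))"
    using W W' by (intro exI[of _ "W \<inter> W'"] exI[of _ "\<lambda>x. B (F x) (G x)"]) (auto simp: Cinf_def)
qed

lemma smooth_on_add: "smooth_on A f \<Longrightarrow> smooth_on A g \<Longrightarrow> smooth_on A (\<lambda>x. f x + g x)"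
  by (rule smooth_on_combine[where B = "(+)"]) (auto intro: Cinf_add)

lemma smooth_on_bilinear:
  "bounded_bilinear B \<Longrightarrow> smooth_on A f \<Longrightarrow> smooth_on A g \<Longrightarrow> smooth_on A (\<lambda>x. B (f x) (g x))"
  by (rule smooth_on_combine[where B = B]) (auto intro: Cinf_bilinear)

lemma Cinf_Pair:
  assumes "open W" "Cinf W f" "Cinf W g" shows "Cinf W (\<lambda>x. (f x, g x))"
proof -
  have "Cinf W (\<lambda>x. (f x, 0) + (0, g x))"
    by (intro Cinf_add assms(1) Cinf_compose[OF assms(1) assms(2) Cinf_linear[OF open_UNIV]]
        Cinf_compose[OF assms(1) assms(3) Cinf_linear[OF open_UNIV]])
      (auto intro!: bounded_linear_Pair bounded_linear_ident bounded_linear_zero)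
  then show ?thesis by simp
qed

lemma smooth_on_Pair: "smooth_on A f \<Longrightarrow> smooth_on A g \<Longrightarrow> smooth_on A (\<lambda>x. (f x, g x))"
  by (rule smooth_on_combine[where B = Pair]) (auto intro: Cinf_Pair)

lemma smooth_on_sum:
  assumes "\<And>i. i \<in> I \<Longrightarrow> smooth_on A (f i)" shows "smooth_on A (\<lambda>x. \<Sum>i\<in>I. f i x)"
  using assms
proof (induction I rule: infinite_finite_induct)
  case (insert i I)
  then show ?case by (simp add: smooth_on_add)
qed (simp_all add: smooth_on_Cinf Cinf_const)

lemma jet_model_Basis:
  assumes "A \<subseteq> Basis" "B \<subseteq> Basis" shows "jet_model A B \<subseteq> Basis"
  using assms unfolding jet_model_def by (auto simp: Basis_prod_def zero_prod_def)

lemma span_jet_model: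
  assumes "A \<subseteq> Basis" "B \<subseteq> Basis"
  shows "span (jet_model A B) = span A \<times> UNIV \<times> span B"
proof -
  have "(v, u, w) \<in> span (jet_model A B) \<longleftrightarrow> v \<in> span A \<and> w \<in> span B" for v w u
  proof -
    have "(v, u, w) \<in> span (jet_model A B) \<longleftrightarrow>
        (\<forall>c\<in>Basis. c \<in> jet_model A B \<or> (v, u, w) \<bullet> c = 0)"
      unfolding span_Basis_subset_iff[OF jet_model_Basis[OF assms]] by blast
    also have "\<dots> \<longleftrightarrow> (\<forall>b\<in>Basis. b \<in> A \<or> v \<bullet> b = 0) \<and> (\<forall>b\<in>Basis. b \<in> B \<or> w \<bullet> b = 0)"
    proof -
      have "(b, 0, 0) \<in> jet_model A B \<longleftrightarrow> b \<in> A" if "b \<in> Basis" for b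
        using nonzero_Basis[OF that] by (auto simp: jet_model_def)
      moreover have "(0, 0, b) \<in> jet_model A B \<longleftrightarrow> b \<in> B" if "b \<in> Basis" for b
        using nonzero_Basis[OF that] by (auto simp: jet_model_def)
      moreover have "(0, 1, 0) \<in> jet_model A B" by (simp add: jet_model_def)
      ultimately show ?thesis
        unfolding Basis_prod_def by (simp add: ball_Un zero_prod_def)
    qed
    also have "\<dots> \<longleftrightarrow> v \<in> span A \<and> w \<in> span B"
      unfolding span_Basis_subset_iff[OF assms(1)] span_Basis_subset_iff[OF assms(2)] by blast
    finally show ?thesis .
  qed
  then show ?thesis by auto
qed

lemma jet_mfd_simps [simp]:
  "pts (jet_mfd L) = jets_over L (pts (base L))"
  "model (jet_mfd L) = jet_model (model (base L)) (model (base L))"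
  "atlas (jet_mfd L) = {(jets_over L (U \<inter> V), jet_coords L U \<phi> e) |U \<phi> V e.
       (U, \<phi>) \<in> charts (base L) \<and> (V, e) \<in> frames L}"
  by (simp_all add: jet_mfd_def)

lemma jets_over_iff: "(q, \<alpha>) \<in> jets_over L A \<longleftrightarrow> q \<in> A \<and> \<alpha> \<in> jet_space L q"
  by (simp add: jets_over_def)

lemma jets_over_Int: "jets_over L A \<inter> jets_over L B = jets_over L (A \<inter> B)"
  by (auto simp: jets_over_def)

context hausdorff_lbundle
begin

lemma jets_overE:
  assumes "z \<in> jets_over L A" "A \<subseteq> pts M"
  obtains q s where "z = (q, jet_of L q s)" "q \<in> A" "s \<in> sections L"
proof -
  obtain q \<alpha> where z: "z = (q, \<alpha>)" "q \<in> A" "\<alpha> \<in> jet_space L q" using assms(1) by (auto simp: jets_over_def)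
  have q: "q \<in> pts M" using z assms(2) by auto
  obtain U \<phi> where U: "(U, \<phi>) \<in> charts M" "q \<in> U" using chart_at[OF q] .
  obtain V e where V: "(V, e) \<in> frames L" "q \<in> V" using frame_at[OF q] .
  obtain s where "s \<in> sections L" "\<alpha> = jet_of L q s" using jet_space_section[OF U V z(3)] .
  then show thesis using that z by blast
qed

lemma jet_of_mem:
  assumes "q \<in> pts M" "s \<in> sections L" shows "jet_of L q s \<in> jet_space L q"
proof -
  obtain U \<phi> where U: "(U, \<phi>) \<in> charts M" "q \<in> U" using chart_at[OF assms(1)] .
  obtain V e where V: "(V, e) \<in> frames L" "q \<in> V" using frame_at[OF assms(1)] .
  show ?thesis by (rule jet_of_in[OF U V assms(2)])
qed

context
  fixes U \<phi> V e assumes U: "(U, \<phi>) \<in> charts M" and V: "(V, e) \<in> frames L"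
begin

abbreviation "JC \<equiv> jet_coords L U \<phi> e"
abbreviation "JD \<equiv> jets_over L (U \<inter> V)"

lemma JC_eq: "q \<in> U \<inter> V \<Longrightarrow> s \<in> sections L \<Longrightarrow>
    JC (q, jet_of L q s) = (\<phi> q, coef (e q) (s q), gradM U \<phi> (loc e s) q)"
  using jet_coords_eq[OF U _ V] by simp

lemma JD_E:
  assumes "z \<in> JD" obtains q s where "z = (q, jet_of L q s)" "q \<in> U \<inter> V" "s \<in> sections L"
  by (rule jets_overE[OF assms]) (use chart_subset[OF U] in \<open>auto intro: that\<close>)

lemma JC_inj: "inj_on JC JD"
proof (rule inj_onI)
  fix z z' assume z: "z \<in> JD" "z' \<in> JD" "JC z = JC z'"
  obtain q s where q: "z = (q, jet_of L q s)" "q \<in> U \<inter> V" "s \<in> sections L" using JD_E[OF z(1)] .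
  obtain q' s' where q': "z' = (q', jet_of L q' s')" "q' \<in> U \<inter> V" "s' \<in> sections L" using JD_E[OF z(2)] .
  have eq: "\<phi> q = \<phi> q'" "coef (e q) (s q) = coef (e q') (s' q')"
    "gradM U \<phi> (loc e s) q = gradM U \<phi> (loc e s') q'"
    using z(3) q q' by (simp_all add: JC_eq)
  have "q = q'" using eq(1) q(2) q'(2) chart_inj[OF U] by (auto simp: inj_on_def)
  then have "jet_of L q s = jet_of L q s'"
    using jet_of_eq_iff[OF U _ V _ q(3) q'(3)] q(2) eq by auto
  then show "z = z'" using q(1) q'(1) \<open>q = q'\<close> by simp
qed

text \<open>The fibre coordinates are unconstrained within \<open>UNIV\<close> and \<open>E\<close>,
  because every value and every gradient in \<open>E\<close> is realised by a section.\<close>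

lemma JC_image:
  assumes A: "A \<subseteq> U \<inter> V" shows "JC ` jets_over L A = \<phi> ` A \<times> UNIV \<times> E"
proof (intro equalityI subsetI)
  fix p assume "p \<in> JC ` jets_over L A"
  then obtain z where z: "z \<in> jets_over L A" "p = JC z" by auto
  have "A \<subseteq> pts M" using A chart_subset[OF U] by auto
  then obtain q s where "z = (q, jet_of L q s)" "q \<in> A" "s \<in> sections L" using jets_overE[OF z(1)] by metis
  then show "p \<in> \<phi> ` A \<times> UNIV \<times> E" using z(2) A grad_in_span by (auto simp: JC_eq subset_iff)
next
  fix p :: "'e \<times> real \<times> 'e" assume "p \<in> \<phi> ` A \<times> UNIV \<times> E"
  then obtain q u w where p: "p = (\<phi> q, u, w)" "q \<in> A" "w \<in> E" by auto
  have q: "q \<in> U" "q \<in> V" "q \<in> pts M" using p A chart_subset[OF U] by auto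
  obtain s where s: "s \<in> sections L" "coef (e q) (s q) = u" "gradM U \<phi> (loc e s) q = w"
    using section_with_jet[OF U q(1) V q(2) p(3)] by metis
  have "(q, jet_of L q s) \<in> jets_over L A"
    using p(2) jet_of_mem[OF q(3) s(1)] by (simp add: jets_over_def)
  moreover have "p = JC (q, jet_of L q s)" using s p q by (simp add: JC_eq)
  ultimately show "p \<in> JC ` jets_over L A" by blast
qed

lemma jet_model_span: "span (jet_model (model M) (model M)) = E \<times> UNIV \<times> E"
  by (rule span_jet_model[OF model_Basis model_Basis])

lemma JC_image_open:
  assumes A: "openin T A" "A \<subseteq> U \<inter> V"
  shows "openin (top_of_set (span (model (jet_mfd L)))) (JC ` jets_over L A)"
proof -
  have "A \<inter> U = A" using A by auto
  then obtain N where N: "open N" "\<phi> ` A = E \<inter> N"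
    using openin_chart_image[OF A(1) U] openin_open by metis
  have "\<phi> ` A \<times> (UNIV :: real set) \<times> E = (E \<times> UNIV \<times> E) \<inter> (N \<times> UNIV)"
    using N(2) by auto
  moreover have "open (N \<times> (UNIV :: (real \<times> 'e) set))" using N(1) by (simp add: open_Times)
  ultimately show ?thesis
    unfolding JC_image[OF A(2)] jet_mfd_simps jet_model_span by (metis openin_open_Int)
qed

end

lemma chart_frame_open: "(U, \<phi>) \<in> charts M \<Longrightarrow> (V, e) \<in> frames L \<Longrightarrow> openin T (U \<inter> V)"
  by (intro openin_Int openin_chart frame_open)

text \<open>The Leibniz rule for the change of frame \<open>h\<close> and the chain rule for the
  change of chart. The result is linear in the fibre coordinates, with coefficients that are smooth
  in the base point; this makes the jet charts compatible.\<close>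

lemma jet_transition:
  assumes U: "(U, \<phi>) \<in> charts M" and V: "(V, e) \<in> frames L"
    and U': "(U', \<phi>') \<in> charts M" and V': "(V', e') \<in> frames L"
    and q: "q \<in> U \<inter> V \<inter> (U' \<inter> V')" and s: "s \<in> sections L"
  defines "h \<equiv> \<lambda>y. coef (e' y) (e y)"
  defines "P \<equiv> \<lambda>c. gradM U' \<phi>' (\<lambda>y. c \<bullet> \<phi> y)"
  shows "coef (e' q) (s q) = h q * coef (e q) (s q)"
    and "gradM U' \<phi>' (loc e' s) q =
      h q *\<^sub>R (\<Sum>c\<in>model M. (gradM U \<phi> (loc e s) q \<bullet> c) *\<^sub>R P c q) + coef (e q) (s q) *\<^sub>R gradM U' \<phi>' h q"
proof -
  have q': "q \<in> U" "q \<in> V" "q \<in> U'" "q \<in> V'" "q \<in> pts M" using q chart_subset[OF U] by auto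
  have ch: "coef (e' y) (s y) = h y * coef (e y) (s y)" if "y \<in> V \<inter> V'" for y
    using coef_change[OF V V', of y "s y"] that section_fibre[OF s] frame_subset[OF V] by (auto simp: h_def)
  show "coef (e' q) (s q) = h q * coef (e q) (s q)" using ch q' by simp
  have sm: "smooth_at M h q" "smooth_at M (loc e s) q"
    unfolding h_def using transition_smooth_at[OF V' V q'(4,2)] section_smooth_at[OF s V q'(2)] by auto
  have "gradM U' \<phi>' (loc e' s) q = gradM U' \<phi>' (\<lambda>y. h y * coef (e y) (s y)) q"
    by (rule grad_cong[OF U' q'(3) smooth_at_mult[OF sm] openin_Int[OF frame_open[OF V] frame_open[OF V']]])
      (use q' ch in auto)
  also have "\<dots> = h q *\<^sub>R gradM U' \<phi>' (loc e s) q + coef (e q) (s q) *\<^sub>R gradM U' \<phi>' h q"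
    by (rule grad_mult[OF U' q'(3) sm])
  also have "gradM U' \<phi>' (loc e s) q = (\<Sum>c\<in>model M. (gradM U \<phi> (loc e s) q \<bullet> c) *\<^sub>R P c q)"
  proof (rule grad_eqI)
    show "(\<Sum>c\<in>model M. (gradM U \<phi> (loc e s) q \<bullet> c) *\<^sub>R P c q) \<in> E"
      unfolding P_def by (intro span_sum span_scale grad_in_span)
    fix b assume b: "b \<in> model M"
    have "partial U' \<phi>' b (loc e s) q =
        (\<Sum>c\<in>model M. partial U \<phi> c (loc e s) q * partial U' \<phi>' b (\<lambda>y. c \<bullet> \<phi> y) q)"
      by (rule partial_change[OF U q'(1) U' q'(3) b sm(2)])
    also have "\<dots> = (\<Sum>c\<in>model M. (gradM U \<phi> (loc e s) q \<bullet> c) *\<^sub>R P c q) \<bullet> b"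
      unfolding inner_sum_left by (rule sum.cong[OF refl]) (simp add: P_def grad_inner[OF b] grad_inner)
    finally show "partial U' \<phi>' b (loc e s) q = (\<Sum>c\<in>model M. (gradM U \<phi> (loc e s) q \<bullet> c) *\<^sub>R P c q) \<bullet> b" .
  qed
  finally show "gradM U' \<phi>' (loc e' s) q =
      h q *\<^sub>R (\<Sum>c\<in>model M. (gradM U \<phi> (loc e s) q \<bullet> c) *\<^sub>R P c q) + coef (e q) (s q) *\<^sub>R gradM U' \<phi>' h q" .
qed

lemma jet_transition_smooth_on:
  assumes U: "(U, \<phi>) \<in> charts M" and V: "(V, e) \<in> frames L"
    and U': "(U', \<phi>') \<in> charts M" and V': "(V', e') \<in> frames L"
  shows "smooth_on (jet_coords L U \<phi> e ` jets_over L (U \<inter> V \<inter> (U' \<inter> V')))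
    (jet_coords L U' \<phi>' e' \<circ> inv_into (jets_over L (U \<inter> V)) (jet_coords L U \<phi> e))"
proof -
  let ?B = "U \<inter> V \<inter> (U' \<inter> V')" and ?JC = "jet_coords L U \<phi> e" and ?JC' = "jet_coords L U' \<phi>' e'"
  let ?A = "?JC ` jets_over L ?B"
  let ?i = "inv_into U \<phi>"
  define h where "h y = coef (e' y) (e y)" for y
  define P where "P c = gradM U' \<phi>' (\<lambda>y. c \<bullet> \<phi> y)" for c
  have A: "?A = \<phi> ` ?B \<times> UNIV \<times> E" by (rule JC_image[OF U V]) auto
  \<comment> \<open>Functions of the base point are functions of the first jet coordinate alone,
    which runs over the chart image of \<open>?B\<close>.\<close>
  have base: "smooth_on ?A (\<lambda>p. f (?i (fst p)))"
    if "\<And>x. x \<in> ?B \<Longrightarrow> smooth_at M f x" for f :: "'m \<Rightarrow> 'b::euclidean_space"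
  proof -
    have "smooth_on (\<phi> ` ?B) (f \<circ> ?i)"
      by (rule smooth_at_smooth_on[OF U _ that]) auto
    then have "smooth_on ?A (\<lambda>p. (f \<circ> ?i) (fst p))"
      by (rule smooth_on_compose_Cinf[OF _ Cinf_linear[OF open_UNIV bounded_linear_fst]]) (auto simp: A)
    then show ?thesis by simp
  qed
  have s\<phi>': "smooth_at M \<phi>' x" if "x \<in> ?B" for x using smooth_at_chart[OF U'] that by auto
  have sh: "smooth_at M h x" if "x \<in> ?B" for x
    unfolding h_def by (rule transition_smooth_at[OF V' V]) (use that in auto)
  have sgh: "smooth_at M (gradM U' \<phi>' h) x" if "x \<in> ?B" for x
    by (rule smooth_at_grad[OF U' _ sh[OF that]]) (use that in auto)
  have sP: "smooth_at M (P c) x" if "x \<in> ?B" for x c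
    unfolding P_def
    by (intro smooth_at_grad[OF U'] smooth_at_inner smooth_at_const smooth_at_chart[OF U])
      (use that chart_subset[OF U] in auto)
  have u: "smooth_on ?A (\<lambda>p. fst (snd p))" "smooth_on ?A (\<lambda>p. snd (snd p))"
    by (intro smooth_on_Cinf Cinf_linear open_UNIV bounded_linear_fst_comp bounded_linear_snd_comp
        bounded_linear_snd bounded_linear_ident)+
  have k: "smooth_on ?A (\<lambda>p. c)" for c :: 'e by (intro smooth_on_Cinf Cinf_const open_UNIV)
  \<comment> \<open>The formulas of \<open>jet_transition\<close>, read as a function of the old jet
    coordinates \<open>p\<close>: position, value and gradient.\<close>
  let ?F = "\<lambda>p. (\<phi>' (?i (fst p)), h (?i (fst p)) * fst (snd p),
      h (?i (fst p)) *\<^sub>R (\<Sum>c\<in>model M. (snd (snd p) \<bullet> c) *\<^sub>R P c (?i (fst p))) +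
      fst (snd p) *\<^sub>R gradM U' \<phi>' h (?i (fst p)))"
  have "smooth_on ?A ?F"
    by (intro smooth_on_Pair smooth_on_add smooth_on_sum
        smooth_on_bilinear[OF bounded_bilinear_scaleR] smooth_on_bilinear[OF bounded_bilinear_mult]
        smooth_on_bilinear[OF bounded_bilinear_inner] base[OF s\<phi>'] base[OF sh] base[OF sgh] base[OF sP] u k)
  then show ?thesis
  proof (rule smooth_on_cong)
    fix p assume "p \<in> ?A"
    then obtain z where z: "z \<in> jets_over L ?B" "p = ?JC z" by auto
    have "?B \<subseteq> pts M" using chart_subset[OF U] by auto
    then obtain q s where q: "z = (q, jet_of L q s)" "q \<in> ?B" "s \<in> sections L"
      using jets_overE[OF z(1)] by metis
    have zD: "z \<in> jets_over L (U \<inter> V)" using z(1) by (auto simp: jets_over_def)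
    have p: "p = (\<phi> q, coef (e q) (s q), gradM U \<phi> (loc e s) q)"
      using z(2) q JC_eq[OF U V, of q s] by simp
    have i: "?i (\<phi> q) = q" using chart_inj[OF U] q(2) by simp
    have "(?JC' \<circ> inv_into (jets_over L (U \<inter> V)) ?JC) p = ?JC' z"
      using z(2) inv_into_f_f[OF JC_inj[OF U V] zD] by simp
    also have "\<dots> = (\<phi>' q, coef (e' q) (s q), gradM U' \<phi>' (loc e' s) q)"
      using q JC_eq[OF U' V', of q s] by simp
    also have "\<dots> = ?F p"
      using jet_transition[OF U V U' V' q(2,3), folded h_def P_def] by (simp add: p i)
    finally show "(?JC' \<circ> inv_into (jets_over L (U \<inter> V)) ?JC) p = ?F p" .
  qed
qed

lemma atlas_mfd_jet: "atlas_mfd (jet_mfd L)"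
proof (rule atlas_mfd.intro)
  show "model (jet_mfd L) \<subseteq> Basis" using jet_model_Basis[OF model_Basis model_Basis] by simp
  fix c assume c: "c \<in> atlas (jet_mfd L)"
  then obtain U \<phi> V e where cc: "c = (jets_over L (U \<inter> V), jet_coords L U \<phi> e)"
    "(U, \<phi>) \<in> charts M" "(V, e) \<in> frames L" by auto
  show "is_chart (jet_mfd L) c"
    unfolding is_chart_def cc(1) prod.case
  proof (intro conjI)
    show "jets_over L (U \<inter> V) \<subseteq> pts (jet_mfd L)"
      using chart_subset[OF cc(2)] by (auto simp: jets_over_def)
  qed (rule JC_inj[OF cc(2,3)] JC_image_open[OF cc(2,3) chart_frame_open[OF cc(2,3)] subset_refl])+
  fix d assume d: "d \<in> atlas (jet_mfd L)"
  then obtain U' \<phi>' V' e' where dd: "d = (jets_over L (U' \<inter> V'), jet_coords L U' \<phi>' e')"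
    "(U', \<phi>') \<in> charts M" "(V', e') \<in> frames L" by auto
  have o: "openin T (U \<inter> V \<inter> (U' \<inter> V'))"
    by (rule openin_Int[OF chart_frame_open[OF cc(2,3)] chart_frame_open[OF dd(2,3)]])
  have comm: "U' \<inter> V' \<inter> (U \<inter> V) = U \<inter> V \<inter> (U' \<inter> V')" by auto
  show "compatible (jet_mfd L) c d"
    unfolding compatible_def cc(1) dd(1) prod.case jets_over_Int
    using JC_image_open[OF cc(2,3) o] JC_image_open[OF dd(2,3) o]
      jet_transition_smooth_on[OF cc(2,3) dd(2,3)] jet_transition_smooth_on[OF dd(2,3) cc(2,3)]
    unfolding comm by blast
next
  show "(\<Union>c\<in>atlas (jet_mfd L). fst c) = pts (jet_mfd L)"
  proof (intro equalityI subsetI)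
    fix z assume "z \<in> pts (jet_mfd L)"
    then obtain q \<alpha> where z: "z = (q, \<alpha>)" "q \<in> pts M" "\<alpha> \<in> jet_space L q" by (auto simp: jets_over_def)
    obtain U \<phi> where U: "(U, \<phi>) \<in> charts M" "q \<in> U" using chart_at[OF z(2)] .
    obtain V e where V: "(V, e) \<in> frames L" "q \<in> V" using frame_at[OF z(2)] .
    have "(jets_over L (U \<inter> V), jet_coords L U \<phi> e) \<in> atlas (jet_mfd L)" using U V by auto
    moreover have "z \<in> jets_over L (U \<inter> V)" using z U V by (simp add: jets_over_def)
    ultimately show "z \<in> (\<Union>c\<in>atlas (jet_mfd L). fst c)" by (metis UN_I fst_conv)
  next
    fix z assume "z \<in> (\<Union>c\<in>atlas (jet_mfd L). fst c)"
    then show "z \<in> pts (jet_mfd L)" using chart_subset by (auto simp: jets_over_def)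
  qed
qed

interpretation J: atlas_mfd "jet_mfd L" by (rule atlas_mfd_jet)

lemma jet_chart:
  "(U, \<phi>) \<in> charts M \<Longrightarrow> (V, e) \<in> frames L \<Longrightarrow>
    (jets_over L (U \<inter> V), jet_coords L U \<phi> e) \<in> charts (jet_mfd L)"
  by (rule J.atlas_subset_charts) auto

lemma jet_chart_at:
  assumes "z \<in> pts (jet_mfd L)"
  obtains U \<phi> V e where "(U, \<phi>) \<in> charts M" "(V, e) \<in> frames L" "z \<in> jets_over L (U \<inter> V)"
proof -
  have q: "fst z \<in> pts M" using assms by (auto simp: jets_over_def)
  obtain U \<phi> where U: "(U, \<phi>) \<in> charts M" "fst z \<in> U" using chart_at[OF q] .
  obtain V e where V: "(V, e) \<in> frames L" "fst z \<in> V" using frame_at[OF q] .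
  show thesis by (rule that[OF U(1) V(1)]) (use assms U V in \<open>auto simp: jets_over_def\<close>)
qed

lemma JC_fst:
  assumes U: "(U, \<phi>) \<in> charts M" and V: "(V, e) \<in> frames L" and z: "z \<in> jets_over L (U \<inter> V)"
  shows "fst (jet_coords L U \<phi> e z) = \<phi> (fst z)"
proof -
  obtain q s where "z = (q, jet_of L q s)" "q \<in> U \<inter> V" "s \<in> sections L" using JD_E[OF U V z] .
  then show ?thesis by (simp add: JC_eq[OF U V])
qed

lemma fst_smooth_map_at:
  assumes "z \<in> pts (jet_mfd L)" shows "smooth_map_at (jet_mfd L) M fst z"
proof -
  obtain U \<phi> V e where U: "(U, \<phi>) \<in> charts M" and V: "(V, e) \<in> frames L"
    and z: "z \<in> jets_over L (U \<inter> V)" using jet_chart_at[OF assms] .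
  have "smooth_at (jet_mfd L) (\<lambda>y. fst (jet_coords L U \<phi> e y)) z"
    by (rule J.smooth_at_linear[OF bounded_linear_fst J.smooth_at_chart[OF jet_chart[OF U V] z]])
  then have "smooth_at (jet_mfd L) (\<lambda>y. \<phi> (fst y)) z"
    by (rule J.smooth_at_cong[OF _ J.openin_chart[OF jet_chart[OF U V]] z]) (rule JC_fst[OF U V])
  moreover have "fst ` jets_over L (U \<inter> V) \<subseteq> U" by (auto simp: jets_over_def)
  ultimately show ?thesis
    unfolding smooth_map_at_def using U J.openin_chart[OF jet_chart[OF U V]] z by blast
qed

lemma smooth_at_fst:
  assumes "z \<in> pts (jet_mfd L)" "smooth_at M f (fst z)"
  shows "smooth_at (jet_mfd L) (\<lambda>y. f (fst y)) z"
  by (rule smooth_at_pullback[OF atlas_mfd_jet atlas_mfd_axioms fst_smooth_map_at[OF assms(1)] assms(2)])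

lemma openin_jets_over:
  assumes A: "openin T A" shows "openin J.T (jets_over L A)"
  unfolding openin_subopen[of _ "jets_over L A"]
proof
  fix z assume z: "z \<in> jets_over L A"
  have AM: "A \<subseteq> pts M" using A openin_T by auto
  have zp: "z \<in> pts (jet_mfd L)" and zA: "fst z \<in> A" using z AM by (auto simp: jets_over_def)
  obtain W where W: "openin J.T W" "z \<in> W" "fst ` W \<subseteq> A"
    using smooth_map_at_preimage[OF atlas_mfd_jet atlas_mfd_axioms fst_smooth_map_at[OF zp] A zA] by metis
  have "W \<subseteq> pts (jet_mfd L)" using W(1) J.openin_T by auto
  then have "W \<subseteq> jets_over L A" using W(3) by (auto simp: jets_over_def)
  then show "\<exists>W. openin J.T W \<and> z \<in> W \<and> W \<subseteq> jets_over L A" using W by blast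
qed

text \<open>Jets over different base points are separated by preimages of open sets of the base.
  Jets over the same base point lie in a common chart, since the domains of jet charts contain whole
  fibres.\<close>

lemma hausdorff_mfd_jet: "hausdorff_mfd (jet_mfd L)"
proof
  show "Hausdorff_space J.T"
    unfolding Hausdorff_space_def
  proof (intro allI impI)
    fix z z' assume "z \<in> topspace J.T \<and> z' \<in> topspace J.T \<and> z \<noteq> z'"
    then have z: "z \<in> pts (jet_mfd L)" "z' \<in> pts (jet_mfd L)" "z \<noteq> z'" using J.topspace_T by auto
    show "\<exists>A B. openin J.T A \<and> openin J.T B \<and> z \<in> A \<and> z' \<in> B \<and> disjnt A B"
    proof (cases "fst z = fst z'")
      case False
      moreover have "fst z \<in> pts M" "fst z' \<in> pts M" using z by (auto simp: jets_over_def)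
      ultimately obtain A B where AB: "openin T A" "openin T B" "fst z \<in> A" "fst z' \<in> B" "disjnt A B"
        using Hausdorff topspace_T unfolding Hausdorff_space_def by metis
      then have "z \<in> jets_over L A" "z' \<in> jets_over L B" "disjnt (jets_over L A) (jets_over L B)"
        using z by (auto simp: jets_over_def disjnt_def)
      then show ?thesis using openin_jets_over AB(1,2) by blast
    next
      case True
      obtain U \<phi> V e where U: "(U, \<phi>) \<in> charts M" and V: "(V, e) \<in> frames L"
        and zD: "z \<in> jets_over L (U \<inter> V)" using jet_chart_at[OF z(1)] .
      let ?D = "jets_over L (U \<inter> V)" and ?F = "jet_coords L U \<phi> e"
      have zD': "z' \<in> ?D" using zD z(2) True by (auto simp: jets_over_def)
      have "?F z \<noteq> ?F z'" using JC_inj[OF U V] zD zD' z(3) by (auto simp: inj_on_def)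
      then obtain N N' where N: "open N" "open N'" "?F z \<in> N" "?F z' \<in> N'" "N \<inter> N' = {}"
        using hausdorff by metis
      let ?A = "{y \<in> ?D. ?F y \<in> N}" and ?B = "{y \<in> ?D. ?F y \<in> N'}"
      have "openin J.T ?A" "openin J.T ?B"
        using J.openin_chart_preimage[OF jet_chart[OF U V]] N by auto
      moreover have "disjnt ?A ?B" using N(5) by (auto simp: disjnt_def)
      ultimately show ?thesis using zD zD' N(3,4) by blast
    qed
  qed
qed

lemma jet_lbundle_simps:
  "base (jet_lbundle L) = jet_mfd L"
  "fibre (jet_lbundle L) z = fibre L (fst z)"
  "frames (jet_lbundle L) = (\<lambda>(V, e). (jets_over L V, e \<circ> fst)) ` frames L"
proof -
  have "pts (jet_mfd L) \<inter> fst -` V = jets_over L V" if "(V, e) \<in> frames L" for V e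
    using frame_subset[OF that] by (auto simp: jets_over_def)
  then show "frames (jet_lbundle L) = (\<lambda>(V, e). (jets_over L V, e \<circ> fst)) ` frames L"
    unfolding jet_lbundle_def pullback_bundle_def by (auto intro!: image_cong simp del: jet_mfd_simps)
qed (simp_all add: jet_lbundle_def pullback_bundle_def)

lemma hausdorff_lbundle_jet: "hausdorff_lbundle (jet_lbundle L)"
proof (rule hausdorff_lbundle.intro, unfold jet_lbundle_simps)
  show "hausdorff_mfd (jet_mfd L)" by (rule hausdorff_mfd_jet)
  show "subspace (fibre L (fst z))" "dim (fibre L (fst z)) = 1" if "z \<in> pts (jet_mfd L)" for z
    using that fibre_subspace fibre_dim by (auto simp: jets_over_def)
  show "openin J.T U" if "(U, e) \<in> (\<lambda>(V, e). (jets_over L V, e \<circ> fst)) ` frames L" for U e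
    using that openin_jets_over[OF frame_open] by auto
  show "e x \<in> fibre L (fst x)" "e x \<noteq> 0"
    if "(U, e) \<in> (\<lambda>(V, e). (jets_over L V, e \<circ> fst)) ` frames L" "x \<in> U" for U e x
    using that frame_fibre frame_nz by (auto simp: jets_over_def)
  show "(\<Union>c\<in>(\<lambda>(V, e). (jets_over L V, e \<circ> fst)) ` frames L. fst c) = pts (jet_mfd L)"
  proof (intro equalityI subsetI)
    fix z assume z: "z \<in> pts (jet_mfd L)"
    then have "fst z \<in> pts M" by (auto simp: jets_over_def)
    then obtain V e where V: "(V, e) \<in> frames L" "fst z \<in> V" by (rule frame_at)
    then have "z \<in> jets_over L V" using z by (auto simp: jets_over_def)
    then show "z \<in> (\<Union>c\<in>(\<lambda>(V, e). (jets_over L V, e \<circ> fst)) ` frames L. fst c)" using V(1) by force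
  next
    fix z assume "z \<in> (\<Union>c\<in>(\<lambda>(V, e). (jets_over L V, e \<circ> fst)) ` frames L. fst c)"
    then obtain V e where V: "(V, e) \<in> frames L" "z \<in> jets_over L V" by auto
    then show "z \<in> pts (jet_mfd L)" using frame_subset[OF V(1)] by (auto simp: jets_over_def)
  qed
  show "smooth_fun_on (jet_mfd L) (U \<inter> V) (\<lambda>x. coef (e x) (e' x))"
    if UV: "(U, e) \<in> (\<lambda>(V, e). (jets_over L V, e \<circ> fst)) ` frames L"
      "(V, e') \<in> (\<lambda>(V, e). (jets_over L V, e \<circ> fst)) ` frames L" for U e V e'
  proof -
    obtain U0 e0 where U: "(U0, e0) \<in> frames L" "U = jets_over L U0" "e = e0 \<circ> fst" using UV(1) by auto
    obtain V0 e0' where V: "(V0, e0') \<in> frames L" "V = jets_over L V0" "e' = e0' \<circ> fst" using UV(2) by auto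
    show ?thesis
    proof (rule J.smooth_fun_onI)
      show "U \<inter> V \<subseteq> pts (jet_mfd L)" using frame_subset[OF U(1)] by (auto simp: U(2) jets_over_def)
      fix z assume z: "z \<in> U \<inter> V"
      have "smooth_at (jet_mfd L) (\<lambda>y. coef (e0 (fst y)) (e0' (fst y))) z"
        by (rule smooth_at_fst[where f = "\<lambda>x. coef (e0 x) (e0' x)"])
          (use z frame_subset[OF U(1)] transition_smooth_at[OF U(1) V(1)] in
            \<open>auto simp: U(2) V(2) jets_over_def\<close>)
      then show "smooth_at (jet_mfd L) (\<lambda>x. coef (e x) (e' x)) z" by (simp add: U(3) V(3) comp_def)
    qed
  qed
qed

end

section \<open>Brackets on the jet bundle\<close>

lemma jet_lbundle_base [simp]: "base (jet_lbundle L) = jet_mfd L"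
  and jet_lbundle_fibre [simp]: "fibre (jet_lbundle L) = (\<lambda>z. fibre L (fst z))"
  by (simp_all add: jet_lbundle_def pullback_bundle_def)

text \<open>The derivation \<open>k + w . grad\<close> with constant coefficients in the chart and
  frame, made global by the cut-off function \<open>\<rho>\<close>. Off the sections it is 0, as the
  convention of \<open>derivations\<close> demands.\<close>

definition local_der ::
    "('m, 'e::euclidean_space, 'v::real_vector) lbundle \<Rightarrow> 'm set \<Rightarrow> ('m \<Rightarrow> 'e) \<Rightarrow> 'm set \<Rightarrow> ('m \<Rightarrow> real) \<Rightarrow>
      ('m \<Rightarrow> 'v) \<Rightarrow> real \<Rightarrow> 'e \<Rightarrow> ('m \<Rightarrow> 'v) \<Rightarrow> 'm \<Rightarrow> 'v" where
  "local_der L U \<phi> W \<rho> e k w s = (if s \<in> sections L then frame_section W \<rho> e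
     (\<lambda>y. k * coef (e y) (s y) + w \<bullet> grad (model (base L)) U \<phi> (\<lambda>y. coef (e y) (s y)) y) else (\<lambda>y. 0))"

context hausdorff_lbundle
begin

lemma bracket_first_order:
  assumes J: "jacobi_structure L J" and s: "s \<in> sections L"
  shows "first_order_at L x (\<lambda>r. J s r x)" "first_order_at L x (\<lambda>r. J r s x)"
proof -
  have *: "first_order_at L x (\<lambda>r. \<Delta> r x)" if \<Delta>: "first_order_diffop L \<Delta>" for \<Delta>
    unfolding first_order_at_def
  proof (intro conjI ballI allI)
    fix s r assume "s \<in> sections L" "r \<in> sections L"
    then show "\<Delta> (\<lambda>y. s y + r y) x = \<Delta> s x + \<Delta> r x"
      using \<Delta> by (simp add: first_order_diffop_def)
  next
    fix c s assume "s \<in> sections L"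
    then have "\<Delta> (\<lambda>y. c *\<^sub>R s y) = (\<lambda>y. c *\<^sub>R \<Delta> s y)"
      using \<Delta> unfolding first_order_diffop_def by blast
    then show "\<Delta> (\<lambda>y. c *\<^sub>R s y) x = c *\<^sub>R \<Delta> s x" by simp
  next
    fix f g s assume "f \<in> smooth_functions M" "g \<in> smooth_functions M" "s \<in> sections L"
    then have "\<Delta> (\<lambda>y. f y *\<^sub>R g y *\<^sub>R s y) x - f x *\<^sub>R \<Delta> (\<lambda>y. g y *\<^sub>R s y) x
        - g x *\<^sub>R \<Delta> (\<lambda>y. f y *\<^sub>R s y) x + f x *\<^sub>R g x *\<^sub>R \<Delta> s x = 0"
      using \<Delta> unfolding first_order_diffop_def by blast
    then show "\<Delta> (\<lambda>y. f y *\<^sub>R g y *\<^sub>R s y) x = f x *\<^sub>R \<Delta> (\<lambda>y. g y *\<^sub>R s y) x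
        + g x *\<^sub>R \<Delta> (\<lambda>y. f y *\<^sub>R s y) x - f x *\<^sub>R g x *\<^sub>R \<Delta> s x"
      by (simp add: algebra_simps)
  qed
  show "first_order_at L x (\<lambda>r. J s r x)" "first_order_at L x (\<lambda>r. J r s x)"
    by (rule *, use J s in \<open>unfold jacobi_structure_def, blast\<close>)+
qed

lemma bracket_section:
  "jacobi_structure L J \<Longrightarrow> s \<in> sections L \<Longrightarrow> r \<in> sections L \<Longrightarrow> J s r \<in> sections L"
  unfolding jacobi_structure_def first_order_diffop_def by blast

lemma bracket_jets:
  assumes J: "jacobi_structure L J"
    and U: "(U, \<phi>) \<in> charts M" "x \<in> U" and V: "(V, e) \<in> frames L" "x \<in> V"
    and s: "s \<in> sections L" "s' \<in> sections L" "coef (e x) (s x) = coef (e x) (s' x)"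
      "gradM U \<phi> (loc e s) x = gradM U \<phi> (loc e s') x"
    and r: "r \<in> sections L" "r' \<in> sections L" "coef (e x) (r x) = coef (e x) (r' x)"
      "gradM U \<phi> (loc e r) x = gradM U \<phi> (loc e r') x"
  shows "J s r x = J s' r' x"
  using first_order_eq[OF U V bracket_first_order(1)[OF J s(1)] r(1,2,3,4)]
    first_order_eq[OF U V bracket_first_order(2)[OF J r(2)] s(1,2,3,4)] by simp

section \<open>Global derivations with constant local coefficients\<close>

lemma local_der_section:
  assumes \<rho>: "cutoff M W \<rho>" and U: "(U, \<phi>) \<in> charts M" and V: "(V, e) \<in> frames L" and W: "W \<subseteq> U \<inter> V"
    and s: "s \<in> sections L"
  shows "local_der L U \<phi> W \<rho> e k w s \<in> sections L"
proof -
  have "frame_section W \<rho> e (\<lambda>y. k * coef (e y) (s y) + w \<bullet> gradM U \<phi> (loc e s) y) \<in> sections L"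
  proof (rule frame_section_in[OF \<rho> V])
    show "W \<subseteq> V" using W by auto
    fix y assume y: "y \<in> W"
    then have y': "y \<in> U" "y \<in> V" "y \<in> pts M" using W chart_subset[OF U] by auto
    show "smooth_at M (\<lambda>y. k * coef (e y) (s y) + w \<bullet> gradM U \<phi> (loc e s) y) y"
      by (intro smooth_at_add smooth_at_mult smooth_at_inner smooth_at_const smooth_at_grad[OF U y'(1)]
          section_smooth_at[OF s V y'(2)] y'(3))
  qed
  then show ?thesis using s by (simp add: local_der_def)
qed

lemma local_der_at:
  assumes "y \<in> W"
  shows "(\<lambda>s. local_der L U \<phi> W \<rho> e k w s y) = der_comb L U \<phi> e y (\<rho> y * k) (\<rho> y *\<^sub>R w)"
  using assms by (simp add: fun_eq_iff local_der_def der_comb_def frame_section_def distrib_left mult.assoc)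

lemma zero_der: "x \<in> pts M \<Longrightarrow> (\<lambda>s. 0) \<in> der_space L x"
proof -
  assume x: "x \<in> pts M"
  obtain U \<phi> where U: "(U, \<phi>) \<in> charts M" "x \<in> U" using chart_at[OF x] .
  obtain V e where V: "(V, e) \<in> frames L" "x \<in> V" using frame_at[OF x] .
  have *: "der_comb L U \<phi> e x 0 0 = (\<lambda>s. 0)" by (simp add: fun_eq_iff der_comb_def)
  show ?thesis using der_comb_in[OF U V, of 0 0] unfolding * .
qed

lemma local_der_in:
  assumes \<rho>: "cutoff M W \<rho>" and U: "(U, \<phi>) \<in> charts M" and V: "(V, e) \<in> frames L" and W: "W \<subseteq> U \<inter> V"
  shows "local_der L U \<phi> W \<rho> e k w \<in> derivations L"
proof -
  have der: "(\<lambda>s. local_der L U \<phi> W \<rho> e k w s x) \<in> der_space L x" if x: "x \<in> pts M" for x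
  proof (cases "x \<in> W")
    case True
    then have x': "x \<in> U" "x \<in> V" using W by auto
    show ?thesis using der_comb_in[OF U x'(1) V x'(2)] by (simp only: local_der_at[OF True])
  next
    case False
    then have "(\<lambda>s. local_der L U \<phi> W \<rho> e k w s x) = (\<lambda>s. 0)"
      by (simp add: fun_eq_iff local_der_def frame_section_def)
    then show ?thesis using zero_der[OF x] by simp
  qed
  have "local_der L U \<phi> W \<rho> e k w s = (\<lambda>x. 0)" if "s \<notin> sections L" for s
    using that by (simp add: local_der_def)
  then show ?thesis
    unfolding derivations_def mem_Collect_eq
    by (intro conjI allI ballI impI der local_der_section[OF assms])
qed

text \<open>Since the symbol \<open>X\<close> is smooth, the Leibniz rule can be iterated; this makes commutators
  first-order without identifying their symbols as Lie brackets.\<close>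

lemma local_der_mult:
  assumes \<rho>: "cutoff M W \<rho>" and U: "(U, \<phi>) \<in> charts M" and V: "(V, e) \<in> frames L" and W: "W \<subseteq> U \<inter> V"
    and f: "f \<in> smooth_functions M"
  obtains X where "X \<in> smooth_functions M"
    "\<And>s. s \<in> sections L \<Longrightarrow> local_der L U \<phi> W \<rho> e k w (\<lambda>y. f y *\<^sub>R s y) =
      (\<lambda>y. f y *\<^sub>R local_der L U \<phi> W \<rho> e k w s y + X y *\<^sub>R s y)"
proof
  let ?X = "\<lambda>y. if y \<in> W then \<rho> y * (w \<bullet> gradM U \<phi> f y) else 0"
  show "?X \<in> smooth_functions M"
  proof (rule cutoff_extend[OF \<rho>])
    fix y assume y: "y \<in> W"
    then have y': "y \<in> U" "y \<in> pts M" using W chart_subset[OF U] by auto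
    show "smooth_at M (\<lambda>y. w \<bullet> gradM U \<phi> f y) y"
      by (intro smooth_at_inner smooth_at_const smooth_at_grad[OF U] smooth_functions_smooth_at[OF f] y')
  qed
  fix s assume s: "s \<in> sections L"
  show "local_der L U \<phi> W \<rho> e k w (\<lambda>y. f y *\<^sub>R s y) =
      (\<lambda>y. f y *\<^sub>R local_der L U \<phi> W \<rho> e k w s y + ?X y *\<^sub>R s y)"
  proof
    fix y
    show "local_der L U \<phi> W \<rho> e k w (\<lambda>y. f y *\<^sub>R s y) y =
      f y *\<^sub>R local_der L U \<phi> W \<rho> e k w s y + ?X y *\<^sub>R s y"
    proof (cases "y \<in> W")
      case True
      then have y: "y \<in> U" "y \<in> V" "y \<in> pts M" using W chart_subset[OF U] by auto
      have sy: "s y = coef (e y) (s y) *\<^sub>R e y" using section_coef[OF s V y(2)] by simp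
      have "local_der L U \<phi> W \<rho> e k w (\<lambda>y. f y *\<^sub>R s y) y =
          (\<rho> y * (k * (f y * coef (e y) (s y)) + w \<bullet> (f y *\<^sub>R gradM U \<phi> (loc e s) y + coef (e y) (s y) *\<^sub>R gradM U \<phi> f y))) *\<^sub>R e y"
        using True section_mult[OF f s] loc_scaleR[OF V y(2) section_fibre[OF s y(3)]] jgrad_mult[OF U y(1) V y(2) f s]
        by (simp add: local_der_def frame_section_def)
      also have "\<dots> = f y *\<^sub>R local_der L U \<phi> W \<rho> e k w s y + ?X y *\<^sub>R (coef (e y) (s y) *\<^sub>R e y)"
      proof -
        have "\<rho> y * (k * (f y * coef (e y) (s y)) + w \<bullet> (f y *\<^sub>R gradM U \<phi> (loc e s) y + coef (e y) (s y) *\<^sub>R gradM U \<phi> f y)) =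
            f y * (\<rho> y * (k * coef (e y) (s y) + w \<bullet> gradM U \<phi> (loc e s) y)) +
            \<rho> y * (w \<bullet> gradM U \<phi> f y) * coef (e y) (s y)"
          by (simp add: inner_add_right algebra_simps)
        then show ?thesis
          using True s by (simp only: local_der_def frame_section_def if_True scaleR_add_left scaleR_scaleR)
      qed
      finally show ?thesis using sy by simp
    next
      case False
      then show ?thesis using s section_mult[OF f s] by (simp add: local_der_def frame_section_def)
    qed
  qed
qed

lemma local_der_add:
  assumes \<rho>: "cutoff M W \<rho>" and U: "(U, \<phi>) \<in> charts M" and V: "(V, e) \<in> frames L" and W: "W \<subseteq> U \<inter> V"
    and s: "s \<in> sections L" "r \<in> sections L"
  shows "local_der L U \<phi> W \<rho> e k w (\<lambda>y. s y + r y) =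
    (\<lambda>y. local_der L U \<phi> W \<rho> e k w s y + local_der L U \<phi> W \<rho> e k w r y)"
proof
  fix y
  let ?a = "local_der L U \<phi> W \<rho> e k w"
  show "?a (\<lambda>y. s y + r y) y = ?a s y + ?a r y"
  proof (cases "y \<in> W")
    case True
    then have y: "y \<in> pts M" using W chart_subset[OF U] by auto
    have "(\<lambda>s. ?a s y) \<in> der_space L y" using local_der_in[OF \<rho> U V W] y by (simp add: derivations_def)
    then show ?thesis using s by (simp add: der_space_def)
  next
    case False
    then show ?thesis using s section_add[OF s] by (simp add: local_der_def frame_section_def)
  qed
qed

lemma local_der_scale:
  assumes \<rho>: "cutoff M W \<rho>" and U: "(U, \<phi>) \<in> charts M" and V: "(V, e) \<in> frames L" and W: "W \<subseteq> U \<inter> V"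
    and s: "s \<in> sections L"
  shows "local_der L U \<phi> W \<rho> e k w (\<lambda>y. c *\<^sub>R s y) = (\<lambda>y. c *\<^sub>R local_der L U \<phi> W \<rho> e k w s y)"
proof
  fix y
  let ?a = "local_der L U \<phi> W \<rho> e k w"
  show "?a (\<lambda>y. c *\<^sub>R s y) y = c *\<^sub>R ?a s y"
  proof (cases "y \<in> W")
    case True
    then have y: "y \<in> pts M" using W chart_subset[OF U] by auto
    have "(\<lambda>s. ?a s y) \<in> der_space L y" using local_der_in[OF \<rho> U V W] y by (simp add: derivations_def)
    then have "\<forall>c. \<forall>s\<in>sections L. ?a (\<lambda>y. c *\<^sub>R s y) y = c *\<^sub>R ?a s y" unfolding der_space_def by blast
    then show ?thesis using s by blast
  next
    case False
    then show ?thesis using s section_scale[OF s] by (simp add: local_der_def frame_section_def)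
  qed
qed

lemma local_der_zero: "local_der L U \<phi> W \<rho> e k w (\<lambda>y. 0) = (\<lambda>y. 0)"
  if "cutoff M W \<rho>" "(U, \<phi>) \<in> charts M" "(V, e) \<in> frames L" "W \<subseteq> U \<inter> V"
proof (cases "(\<lambda>y. 0) \<in> sections L")
  case True
  then show ?thesis using local_der_scale[OF that True, of k w 0] by simp
qed (simp add: local_der_def)

text \<open>In the commutator applied to \<open>f s\<close> the mixed terms \<open>X b s\<close> and
  \<open>Y a s\<close> cancel. What remains is \<open>f\<close> times the commutator plus a multiple
  of \<open>s\<close>, so the commutator is first-order and \<open>first_order_der_comb\<close>
  applies. Membership in \<open>der_space\<close> matters because restricted jets are 0 off that
  space.\<close>

lemma commutator_in:
  assumes \<rho>: "cutoff M W \<rho>" and U: "(U, \<phi>) \<in> charts M" and V: "(V, e) \<in> frames L" and W: "W \<subseteq> U \<inter> V"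
    and x: "x \<in> W"
  shows "(\<lambda>s. commutator (local_der L U \<phi> W \<rho> e k w) (local_der L U \<phi> W \<rho> e k' w') s x) \<in> der_space L x"
proof -
  let ?a = "local_der L U \<phi> W \<rho> e k w" and ?b = "local_der L U \<phi> W \<rho> e k' w'"
  let ?c = "\<lambda>s. commutator ?a ?b s x"
  have x': "x \<in> U" "x \<in> V" "x \<in> pts M" using W x chart_subset[OF U] by auto
  note add = local_der_add[OF \<rho> U V W] and scale = local_der_scale[OF \<rho> U V W]
    and sec = local_der_section[OF \<rho> U V W]
  \<comment> \<open>The scalar \<open>d\<close> depends on \<open>f\<close> but not on
    \<open>s\<close>. Applying the rule to \<open>g s\<close> as well as to \<open>s\<close>
    therefore gives the relation required of a first-order functional.\<close>
  have mult: "\<exists>d. \<forall>s\<in>sections L. ?c (\<lambda>y. f y *\<^sub>R s y) = f x *\<^sub>R ?c s + d *\<^sub>R s x"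
    if f: "f \<in> smooth_functions M" for f
  proof -
    obtain X where X: "X \<in> smooth_functions M"
      "\<And>s. s \<in> sections L \<Longrightarrow> ?a (\<lambda>y. f y *\<^sub>R s y) = (\<lambda>y. f y *\<^sub>R ?a s y + X y *\<^sub>R s y)"
      using local_der_mult[OF \<rho> U V W f, where k = k and w = w] by metis
    obtain Y where Y: "Y \<in> smooth_functions M"
      "\<And>s. s \<in> sections L \<Longrightarrow> ?b (\<lambda>y. f y *\<^sub>R s y) = (\<lambda>y. f y *\<^sub>R ?b s y + Y y *\<^sub>R s y)"
      using local_der_mult[OF \<rho> U V W f, where k = k' and w = w'] by metis
    obtain Z where Z: "\<And>s. s \<in> sections L \<Longrightarrow> ?a (\<lambda>y. Y y *\<^sub>R s y) = (\<lambda>y. Y y *\<^sub>R ?a s y + Z y *\<^sub>R s y)"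
      using local_der_mult[OF \<rho> U V W Y(1), where k = k and w = w] by metis
    obtain Z' where Z': "\<And>s. s \<in> sections L \<Longrightarrow> ?b (\<lambda>y. X y *\<^sub>R s y) = (\<lambda>y. X y *\<^sub>R ?b s y + Z' y *\<^sub>R s y)"
      using local_der_mult[OF \<rho> U V W X(1), where k = k' and w = w'] by metis
    have "?c (\<lambda>y. f y *\<^sub>R s y) = f x *\<^sub>R ?c s + (Z x - Z' x) *\<^sub>R s x" if s: "s \<in> sections L" for s
    proof -
      have ab: "?a (?b (\<lambda>y. f y *\<^sub>R s y)) =
          (\<lambda>y. (f y *\<^sub>R ?a (?b s) y + X y *\<^sub>R ?b s y) + (Y y *\<^sub>R ?a s y + Z y *\<^sub>R s y))"
        unfolding Y(2)[OF s] add[OF section_mult[OF f sec[OF s]] section_mult[OF Y(1) s]]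
          X(2)[OF sec[OF s]] Z[OF s] ..
      have ba: "?b (?a (\<lambda>y. f y *\<^sub>R s y)) =
          (\<lambda>y. (f y *\<^sub>R ?b (?a s) y + Y y *\<^sub>R ?a s y) + (X y *\<^sub>R ?b s y + Z' y *\<^sub>R s y))"
        unfolding X(2)[OF s] add[OF section_mult[OF f sec[OF s]] section_mult[OF X(1) s]]
          Y(2)[OF sec[OF s]] Z'[OF s] ..
      show ?thesis
        unfolding commutator_def ab ba by (simp add: scaleR_diff_left scaleR_diff_right)
    qed
    then show ?thesis by blast
  qed
  have fo: "first_order_at L x ?c"
    unfolding first_order_at_def
  proof (intro conjI ballI allI)
    fix s r assume s: "s \<in> sections L" "r \<in> sections L"
    show "?c (\<lambda>y. s y + r y) = ?c s + ?c r"
      unfolding commutator_def add[OF s] add[OF sec[OF s(1)] sec[OF s(2)]] by simp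
  next
    fix c s assume s: "s \<in> sections L"
    show "?c (\<lambda>y. c *\<^sub>R s y) = c *\<^sub>R ?c s"
      unfolding commutator_def scale[OF s] scale[OF sec[OF s]] by (simp add: scaleR_diff_right)
  next
    fix f g s assume fgs: "f \<in> smooth_functions M" "g \<in> smooth_functions M" "s \<in> sections L"
    obtain d where d: "\<forall>s\<in>sections L. ?c (\<lambda>y. f y *\<^sub>R s y) = f x *\<^sub>R ?c s + d *\<^sub>R s x"
      using mult[OF fgs(1)] by blast
    have "?c (\<lambda>y. f y *\<^sub>R g y *\<^sub>R s y) = f x *\<^sub>R ?c (\<lambda>y. g y *\<^sub>R s y) + d *\<^sub>R (g x *\<^sub>R s x)"
      using d[rule_format, OF section_mult[OF fgs(2,3)]] .
    then show "?c (\<lambda>y. f y *\<^sub>R g y *\<^sub>R s y) = f x *\<^sub>R ?c (\<lambda>y. g y *\<^sub>R s y) + g x *\<^sub>R ?c (\<lambda>y. f y *\<^sub>R s y)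
        - f x *\<^sub>R g x *\<^sub>R ?c s"
      using d[rule_format, OF fgs(3)] by (simp add: algebra_simps)
  qed
  have fib: "?c s \<in> fibre L x" if "s \<in> sections L" for s
    unfolding commutator_def
    by (intro subspace_diff fibre_subspace section_fibre sec that x'(3))
  obtain k w where kw: "\<And>s. s \<in> sections L \<Longrightarrow> ?c s = der_comb L U \<phi> e x k w s"
    using first_order_der_comb[OF U x'(1) V x'(2) fo fib] by metis
  have "?c s = 0" if "s \<notin> sections L" for s
  proof -
    have "?a s = (\<lambda>y. 0)" "?b s = (\<lambda>y. 0)" using that by (simp_all add: local_der_def)
    then show ?thesis by (simp add: commutator_def local_der_zero[OF \<rho> U V W])
  qed
  then have "?c s = der_comb L U \<phi> e x k w s" for s
    using kw by (cases "s \<in> sections L") (auto simp: der_comb_def)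
  then show ?thesis using der_comb_in[OF U x'(1) V x'(2), of k w] by simp
qed

section \<open>Pulled back and linear sections over the jet manifold\<close>

lemma lift_section_in:
  assumes t: "t \<in> sections L" shows "lift_section L t \<in> sections (jet_lbundle L)"
proof -
  interpret JL: hausdorff_lbundle "jet_lbundle L" by (rule hausdorff_lbundle_jet)
  show ?thesis
  proof (rule JL.sectionI)
    fix z assume "z \<in> pts (base (jet_lbundle L))"
    then have z: "z \<in> pts (jet_mfd L)" "fst z \<in> pts M" by (auto simp: jets_over_def)
    show "lift_section L t z \<in> fibre (jet_lbundle L) z"
      using z section_fibre[OF t z(2)] by (auto simp: lift_section_def split: prod.splits)
    obtain V e where V: "(V, e) \<in> frames L" "fst z \<in> V" using frame_at[OF z(2)] .
    have zV: "z \<in> jets_over L V" using z(1) V(2) by (auto simp: jets_over_def)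
    have "smooth_at (jet_mfd L) (\<lambda>y. coef (e (fst y)) (t (fst y))) z"
      by (rule smooth_at_fst[where f = "loc e t", OF z(1) section_smooth_at[OF t V]])
    then have "smooth_at (jet_mfd L) (\<lambda>y. coef ((e \<circ> fst) y) (lift_section L t y)) z"
      by (rule atlas_mfd.smooth_at_cong[OF atlas_mfd_jet _ openin_jets_over[OF frame_open[OF V(1)]] zV])
        (use frame_subset[OF V(1)] in \<open>auto simp: lift_section_def jets_over_def\<close>)
    moreover have "(jets_over L V, e \<circ> fst) \<in> frames (jet_lbundle L)"
      unfolding jet_lbundle_simps(3) using V(1) by force
    ultimately show "\<exists>V e. (V, e) \<in> frames (jet_lbundle L) \<and> z \<in> V \<and>
        smooth_at (base (jet_lbundle L)) (\<lambda>y. coef (e y) (lift_section L t y)) z"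
      unfolding jet_lbundle_base using zV by (intro exI[of _ "jets_over L V"] exI[of _ "e \<circ> fst"] conjI)
  qed (auto simp: lift_section_def)
qed

abbreviation "lift_fun \<rho> \<equiv> (\<lambda>z. if z \<in> pts (jet_mfd L) then \<rho> (fst z) else (0 :: real))"

lemma cutoff_lift:
  assumes "cutoff M W \<rho>" shows "cutoff (jet_mfd L) (jets_over L W) (lift_fun \<rho>)"
proof -
  interpret J: hausdorff_mfd "jet_mfd L" by (rule hausdorff_mfd_jet)
  obtain W0 where W: "openin T W" "\<rho> \<in> smooth_functions M" "openin T W0" "W \<union> W0 = pts M"
    "\<forall>y\<in>W0. \<rho> y = 0" using assms(1) unfolding cutoff_def by blast
  have "smooth_at (jet_mfd L) (lift_fun \<rho>) z" if z: "z \<in> pts (jet_mfd L)" for z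
  proof -
    have "smooth_at M \<rho> (fst z)" using smooth_functions_smooth_at[OF W(2)] z by (auto simp: jets_over_def)
    from smooth_at_fst[OF z this] show ?thesis
      by (rule J.smooth_at_cong[OF _ J.openin_pts z]) simp
  qed
  then have "lift_fun \<rho> \<in> smooth_functions (jet_mfd L)" by (simp add: J.smooth_functions_iff)
  moreover have "jets_over L W \<union> jets_over L W0 = pts (jet_mfd L)" using W(4) by (auto simp: jets_over_def)
  moreover have "lift_fun \<rho> z = 0" if "z \<in> jets_over L W0" for z
    using that W(5) by (auto simp: jets_over_def)
  ultimately show ?thesis
    unfolding cutoff_def using openin_jets_over[OF W(1)] openin_jets_over[OF W(3)] by blast
qed

context
  fixes U \<phi> V e W \<rho>
  assumes U: "(U, \<phi>) \<in> charts M" and V: "(V, e) \<in> frames L"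
    and \<rho>: "cutoff M W \<rho>" and W: "W \<subseteq> U \<inter> V"
begin

lemma lift_frame_section:
  "lift_section L (frame_section W \<rho> e (\<lambda>y. u + w \<bullet> (\<phi> y - p))) =
    frame_section (jets_over L W) (lift_fun \<rho>) (e \<circ> fst) (\<lambda>z. u + w \<bullet> (fst (jet_coords L U \<phi> e z) - p))"
proof
  fix z
  have WM: "W \<subseteq> pts M" using W chart_subset[OF U] by auto
  show "lift_section L (frame_section W \<rho> e (\<lambda>y. u + w \<bullet> (\<phi> y - p))) z =
    frame_section (jets_over L W) (lift_fun \<rho>) (e \<circ> fst) (\<lambda>z. u + w \<bullet> (fst (jet_coords L U \<phi> e z) - p)) z"
  proof (cases "z \<in> jets_over L W")
    case True
    then have "z \<in> jets_over L (U \<inter> V)" "z \<in> pts (jet_mfd L)" "fst z \<in> W"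
      using W WM by (auto simp: jets_over_def)
    then show ?thesis
      using True JC_fst[OF U V, of z] by (auto simp: lift_section_def frame_section_def split: prod.splits)
  next
    case False
    then show ?thesis by (auto simp: lift_section_def frame_section_def jets_over_def split: prod.splits)
  qed
qed

text \<open>A jet with fibre coordinates \<open>(u, p)\<close>, paired with
  \<open>k + w . grad\<close>, gives \<open>k u + w . p\<close>; so the coefficient is linear in the
  jet coordinates. Cut-off function and frame are those of \<open>lift_frame_section\<close>, so
  that both kinds of sections can be added.\<close>

lemma linear_local_der:
  "linear_section L (local_der L U \<phi> W \<rho> e k w) =
    frame_section (jets_over L W) (lift_fun \<rho>) (e \<circ> fst) (\<lambda>z. (k, w) \<bullet> snd (jet_coords L U \<phi> e z))"
proof
  fix z
  let ?a = "local_der L U \<phi> W \<rho> e k w"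
  have WM: "W \<subseteq> pts M" using W chart_subset[OF U] by auto
  show "linear_section L ?a z =
    frame_section (jets_over L W) (lift_fun \<rho>) (e \<circ> fst) (\<lambda>z. (k, w) \<bullet> snd (jet_coords L U \<phi> e z)) z"
  proof (cases "z \<in> pts (jet_mfd L)")
    case True
    then obtain q s where z: "z = (q, jet_of L q s)" "q \<in> pts M" "s \<in> sections L"
      using jets_overE[of z "pts M"] by (metis jet_mfd_simps(1) subset_refl)
    have j: "jet_of L q s \<in> jet_space L q" using jet_of_mem[OF z(2,3)] .
    have "(\<lambda>s. ?a s q) \<in> der_space L q"
      using local_der_in[OF \<rho> U V W] z(2) by (simp add: derivations_def)
    then have "linear_section L ?a z = ?a s q"
      using True z(1) by (simp add: linear_section_def jet_of_def)
    also have "\<dots> = frame_section (jets_over L W) (lift_fun \<rho>) (e \<circ> fst) (\<lambda>z. (k, w) \<bullet> snd (jet_coords L U \<phi> e z)) z"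
    proof (cases "q \<in> W")
      case qW: True
      then have "q \<in> U \<inter> V" using W by auto
      then show ?thesis
        using qW True z j JC_eq[OF U V, of q s]
        by (simp add: local_der_def frame_section_def jets_over_iff)
    next
      case False
      then show ?thesis using z by (simp add: local_der_def frame_section_def jets_over_iff)
    qed
    finally show ?thesis .
  next
    case False
    then have "z \<notin> jets_over L W" using WM by (auto simp: jets_over_def)
    then show ?thesis using False by (auto simp: linear_section_def frame_section_def split: prod.splits)
  qed
qed

lemma linear_local_der_in: "linear_section L (local_der L U \<phi> W \<rho> e k w) \<in> sections (jet_lbundle L)"
  unfolding linear_local_der
proof -
  interpret JL: hausdorff_lbundle "jet_lbundle L" by (rule hausdorff_lbundle_jet)
  have V': "(jets_over L V, e \<circ> fst) \<in> frames (jet_lbundle L)"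
    unfolding jet_lbundle_simps(3) using V by force
  have \<rho>': "cutoff (base (jet_lbundle L)) (jets_over L W) (lift_fun \<rho>)" using cutoff_lift[OF \<rho>] by simp
  show "frame_section (jets_over L W) (lift_fun \<rho>) (e \<circ> fst) (\<lambda>z. (k, w) \<bullet> snd (jet_coords L U \<phi> e z))
      \<in> sections (jet_lbundle L)"
  proof (rule JL.frame_section_in[OF \<rho>' V'])
    show "jets_over L W \<subseteq> jets_over L V" using W by (auto simp: jets_over_def)
    fix z assume "z \<in> jets_over L W"
    then have z: "z \<in> jets_over L (U \<inter> V)" using W by (auto simp: jets_over_def)
    have c: "(jets_over L (U \<inter> V), jet_coords L U \<phi> e) \<in> charts (base (jet_lbundle L))"
      using jet_chart[OF U V] by simp
    have "smooth_at (base (jet_lbundle L)) (\<lambda>z. snd (jet_coords L U \<phi> e z)) z"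
      by (rule JL.smooth_at_linear[OF bounded_linear_snd JL.smooth_at_chart[OF c z]])
    then show "smooth_at (base (jet_lbundle L)) (\<lambda>z. (k, w) \<bullet> snd (jet_coords L U \<phi> e z)) z"
      using JL.smooth_at_inner[OF JL.smooth_at_const[of z "(k, w)"]] JL.chart_subset[OF c] z by blast
  qed
qed

text \<open>The sections \<open>l\<^sub>a + \<pi>\<^sup>*t\<close> realise every 1-jet at a point of the jet bundle.\<close>

lemma test_section_jet:
  fixes c k :: real and w v :: 'e and q :: 'm and z0 :: "'m \<times> ('m, 'v) jet"
  assumes W1: "openin T W1" "q \<in> W1" "W1 \<subseteq> W" "\<And>y. y \<in> W1 \<Longrightarrow> \<rho> y = 1"
    and z0: "z0 \<in> pts (jet_mfd L)" "fst z0 = q"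
  defines "t \<equiv> frame_section W \<rho> e
      (\<lambda>y. (c - (k, w) \<bullet> snd (jet_coords L U \<phi> e z0)) + v \<bullet> (\<phi> y - \<phi> q))"
  defines "s \<equiv> \<lambda>z. linear_section L (local_der L U \<phi> W \<rho> e k w) z + lift_section L t z"
  shows "t \<in> sections L" and "s \<in> sections (jet_lbundle L)"
    and "coef ((e \<circ> fst) z0) (s z0) = c"
    and "v \<in> E \<Longrightarrow> w \<in> E \<Longrightarrow> grad (model (jet_mfd L)) (jets_over L (U \<inter> V)) (jet_coords L U \<phi> e)
      (\<lambda>y. coef ((e \<circ> fst) y) (s y)) z0 = (v, k, w)"
proof -
  interpret JL: hausdorff_lbundle "jet_lbundle L" by (rule hausdorff_lbundle_jet)
  let ?\<Phi> = "jet_coords L U \<phi> e"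
  have q: "q \<in> U" "q \<in> V" using W W1 by auto
  show t: "t \<in> sections L"
    unfolding t_def by (rule frame_section_in[OF \<rho> V]) (use W in auto, rule smooth_at_affine[OF U], auto)
  show s: "s \<in> sections (jet_lbundle L)"
    unfolding s_def by (rule JL.section_add[OF linear_local_der_in lift_section_in[OF t]])
  have V': "(jets_over L V, e \<circ> fst) \<in> frames (jet_lbundle L)"
    unfolding jet_lbundle_simps(3) using V by force
  have U': "(jets_over L (U \<inter> V), ?\<Phi>) \<in> charts (base (jet_lbundle L))"
    using jet_chart[OF U V] by simp
  have z0U: "z0 \<in> jets_over L (U \<inter> V)" and z0V: "z0 \<in> jets_over L V"
    using z0 q by (auto simp: jets_over_def)
  have \<rho>': "cutoff (base (jet_lbundle L)) (jets_over L W) (lift_fun \<rho>)" using cutoff_lift[OF \<rho>] by simp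
  have sub: "jets_over L W \<subseteq> jets_over L (U \<inter> V) \<inter> jets_over L V" using W by (auto simp: jets_over_def)
  have W1': "openin JL.T (jets_over L W1)" using openin_jets_over[OF W1(1)] by simp
  have z0W1: "z0 \<in> jets_over L W1" and W1W: "jets_over L W1 \<subseteq> jets_over L W"
    using z0 W1 by (auto simp: jets_over_def)
  have one: "lift_fun \<rho> z = 1" if "z \<in> jets_over L W1" for z
    using that W1 W chart_subset[OF U] by (auto simp: jets_over_def)
  have p: "fst (?\<Phi> z0) = \<phi> q" using JC_fst[OF U V z0U] z0(2) by simp
  have eq: "s = frame_section (jets_over L W) (lift_fun \<rho>) (e \<circ> fst) (\<lambda>z. c + (v, k, w) \<bullet> (?\<Phi> z - ?\<Phi> z0))"
  proof
    fix z
    \<comment> \<open>The constant in \<open>t\<close> compensates the value of the linear section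
      at \<open>z0\<close>. The sum thereby becomes affine in the jet coordinates, with value
      \<open>c\<close> and gradient \<open>(v, k, w)\<close>.\<close>
    have num: "c + (v, k, w) \<bullet> (?\<Phi> z - ?\<Phi> z0) =
        (k, w) \<bullet> snd (?\<Phi> z) + ((c - (k, w) \<bullet> snd (?\<Phi> z0)) + v \<bullet> (fst (?\<Phi> z) - \<phi> q))"
      unfolding p[symmetric] by (simp add: inner_prod_def inner_diff_right algebra_simps)
    show "s z = frame_section (jets_over L W) (lift_fun \<rho>) (e \<circ> fst) (\<lambda>z. c + (v, k, w) \<bullet> (?\<Phi> z - ?\<Phi> z0)) z"
      unfolding s_def t_def linear_local_der lift_frame_section frame_section_def num
      by (cases "z \<in> jets_over L W") (simp_all only: if_True if_False distrib_left scaleR_add_left add_0)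
  qed
  note aff = JL.affine_section[OF U' z0U V' z0V \<rho>' sub W1' z0W1 W1W]
  show "coef ((e \<circ> fst) z0) (s z0) = c"
    unfolding eq by (rule aff(2)) (rule one)
  assume "v \<in> E" "w \<in> E"
  then have "(v, k, w) \<in> JL.E" using span_jet_model[OF model_Basis model_Basis] by simp
  then show "grad (model (jet_mfd L)) (jets_over L (U \<inter> V)) ?\<Phi> (\<lambda>y. coef ((e \<circ> fst) y) (s y)) z0 = (v, k, w)"
    using aff(3) one unfolding eq by simp
qed

end

text \<open>Biadditivity and the three defining relations; the term with \<open>B t\<close> gets its
  sign from antisymmetry. That linear sections are smooth is a hypothesis because it is proved for
  local derivations only.\<close>

lemma canonical_bracket:
  assumes J: "canonical_jacobi L J"
    and A: "A \<in> derivations L" "linear_section L A \<in> sections (jet_lbundle L)"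
    and B: "B \<in> derivations L" "linear_section L B \<in> sections (jet_lbundle L)"
    and t: "t \<in> sections L" and r: "r \<in> sections L" and z: "(q, \<alpha>) \<in> pts (jet_mfd L)"
  shows "J (\<lambda>z. linear_section L A z + lift_section L t z) (\<lambda>z. linear_section L B z + lift_section L r z) (q, \<alpha>) =
    \<alpha> (\<lambda>s. commutator A B s q) + A r q - B t q"
proof -
  let ?l = "linear_section L" and ?p = "lift_section L"
  have js: "jacobi_structure (jet_lbundle L) J" using J by (simp add: canonical_jacobi_def)
  interpret JL: hausdorff_lbundle "jet_lbundle L" by (rule hausdorff_lbundle_jet)
  note p = lift_section_in[OF t] lift_section_in[OF r]
  have add2: "J s (\<lambda>z. u z + v z) x = J s u x + J s v x"
    if "s \<in> sections (jet_lbundle L)" "u \<in> sections (jet_lbundle L)" "v \<in> sections (jet_lbundle L)" for s u v x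
    using JL.bracket_first_order(1)[OF js that(1)] that(2,3) by (simp add: first_order_at_def)
  have add1: "J (\<lambda>z. u z + v z) s x = J u s x + J v s x"
    if "s \<in> sections (jet_lbundle L)" "u \<in> sections (jet_lbundle L)" "v \<in> sections (jet_lbundle L)" for s u v x
    using JL.bracket_first_order(2)[OF js that(1)] that(2,3) by (simp add: first_order_at_def)
  have "J (\<lambda>z. ?l A z + ?p t z) (\<lambda>z. ?l B z + ?p r z) (q, \<alpha>) =
      J (?l A) (?l B) (q, \<alpha>) + J (?l A) (?p r) (q, \<alpha>) + (J (?p t) (?l B) (q, \<alpha>) + J (?p t) (?p r) (q, \<alpha>))"
    using A B p by (simp add: add1 add2 JL.section_add)
  also have "J (?l A) (?l B) (q, \<alpha>) = \<alpha> (\<lambda>s. commutator A B s q)"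
    using J A(1) B(1) z by (simp add: canonical_jacobi_def linear_section_def)
  also have "J (?l A) (?p r) (q, \<alpha>) = A r q"
    using J A(1) r z by (simp add: canonical_jacobi_def lift_section_def)
  also have "J (?p t) (?l B) (q, \<alpha>) = - B t q"
  proof -
    have "J (?p t) (?l B) = (\<lambda>x. - J (?l B) (?p t) x)"
      using js p(1) B(2) unfolding jacobi_structure_def by blast
    then show ?thesis using J B(1) t z by (simp add: canonical_jacobi_def lift_section_def)
  qed
  also have "J (?p t) (?p r) (q, \<alpha>) = 0"
    using J t r by (simp add: canonical_jacobi_def)
  finally show ?thesis by simp
qed

end

section \<open>Restriction to a submanifold\<close>

lemma proj_Basis: "B \<subseteq> Basis \<Longrightarrow> b \<in> B \<Longrightarrow> proj B b = b"
  unfolding proj_def by (rule span_Basis_expand) (auto intro: span_base)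

lemma proj_Basis_notin: "B \<subseteq> Basis \<Longrightarrow> b \<in> Basis \<Longrightarrow> b \<notin> B \<Longrightarrow> proj B b = 0"
  unfolding proj_def by (rule sum.neutral) (auto simp: inner_Basis subset_iff)

lemma linear_proj: "linear (proj B)"
  by (rule linearI)
    (simp_all add: proj_def inner_add_left scaleR_add_left sum.distrib scaleR_sum_right)

text \<open>The coordinate form of \<open>z\<close> in adapted charts: position and value are kept,
  derivatives transverse to \<open>S\<close> are dropped.\<close>

definition jet_proj :: "'e::euclidean_space set \<Rightarrow> 'e \<times> real \<times> 'e \<Rightarrow> 'e \<times> real \<times> 'e" where
  "jet_proj K p = (fst p, fst (snd p), proj K (snd (snd p)))"

lemma bounded_linear_jet_proj: "bounded_linear (jet_proj K)"
  unfolding linear_conv_bounded_linear[symmetric]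
  by (rule linearI) (simp_all add: jet_proj_def linear_add[OF linear_proj] linear_scale[OF linear_proj])

lemma jet_proj_Basis:
  assumes "K \<subseteq> B" "B \<subseteq> Basis" "b \<in> jet_model K B"
  shows "(b \<in> jet_model K K \<and> jet_proj K b = b) \<or> (b \<notin> jet_model K K \<and> b \<in> Basis \<and> jet_proj K b = 0)"
proof -
  have KB: "K \<subseteq> Basis" using assms by auto
  have p0: "proj K 0 = 0" using linear_0[OF linear_proj] .
  consider a where "b = (a, 0, 0)" "a \<in> K" | "b = (0, 1, 0)" | a where "b = (0, 0, a)" "a \<in> B"
    using assms(3) by (auto simp: jet_model_def)
  then show ?thesis
  proof cases
    case 1
    then show ?thesis by (auto simp: jet_model_def jet_proj_def p0)
  next
    case 2
    then show ?thesis by (auto simp: jet_model_def jet_proj_def p0)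
  next
    case 3
    show ?thesis
    proof (cases "a \<in> K")
      case True
      then show ?thesis using 3 proj_Basis[OF KB True] by (auto simp: jet_model_def jet_proj_def)
    next
      case False
      have "a \<in> Basis" "a \<noteq> 0" using 3 assms(2) nonzero_Basis by auto
      then have "b \<notin> jet_model K K" using 3 False by (auto simp: jet_model_def)
      moreover have "b \<in> Basis" using assms(3) jet_model_Basis[OF KB assms(2)] by auto
      ultimately show ?thesis
        using 3 proj_Basis_notin[OF KB \<open>a \<in> Basis\<close> False] by (simp add: jet_proj_def zero_prod_def)
    qed
  qed
qed

lemma fst_jet_quotient_map [simp]: "fst (jet_quotient_map L K S z) = fst z"
  by (simp add: jet_quotient_map_def case_prod_unfold)

context hausdorff_lbundle
begin

lemma jet_zero:
  assumes "\<alpha> \<in> jet_space L q" "q \<in> pts M" shows "\<alpha> (\<lambda>s. 0) = 0"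
proof -
  have "(q, \<alpha>) \<in> jets_over L {q}" using assms(1) by (simp add: jets_over_def)
  then obtain q' s where "(q, \<alpha>) = (q', jet_of L q' s)"
    by (rule jets_overE) (use assms(2) in auto)
  then show ?thesis by (simp add: jet_of_def)
qed

lemma local_der_00: "local_der L U \<phi> W \<rho> e 0 0 = (\<lambda>s y. 0)"
  by (simp add: fun_eq_iff local_der_def frame_section_def)

section \<open>The submanifold \<open>C\<close> of jets over \<open>S\<close> and the map
  \<open>z\<close>\<close>

context
  fixes K S assumes S: "embedded_submanifold M K S"
begin

abbreviation "R \<equiv> restrict_bundle L K S"
abbreviation "C \<equiv> jets_over L S"
abbreviation "KK \<equiv> jet_model K (model M)"
abbreviation "jq \<equiv> jet_quotient_map L K S"
abbreviation "NC \<equiv> submfd (jet_mfd L) KK C"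

lemma hausdorff_lbundle_R: "hausdorff_lbundle R"
  by (rule hausdorff_lbundle_restrict[OF S])

interpretation R: hausdorff_lbundle R by (rule hausdorff_lbundle_R)

lemma KK_Basis: "KK \<subseteq> Basis"
  by (rule jet_model_Basis[OF K_Basis[OF S] model_Basis])

lemma span_KK: "span KK = span K \<times> UNIV \<times> E"
  by (rule span_jet_model[OF K_Basis[OF S] model_Basis])

lemma C_E:
  assumes "z \<in> C" obtains q s where "z = (q, jet_of L q s)" "q \<in> S" "s \<in> sections L"
  by (rule jets_overE[OF assms S_subset[OF S]]) (rule that)

lemma jq_jet_of:
  assumes q: "q \<in> S" and s: "s \<in> sections L"
  shows "jq (q, jet_of L q s) = (q, jet_of R q (restrict_section S s))"
proof -
  obtain U \<phi> where U: "(U, \<phi>) \<in> slice_charts M K S" "q \<in> U" using slice_chart_at[OF S q] .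
  have "q \<in> pts M" using q S_subset[OF S] by auto
  then obtain V e where V: "(V, e) \<in> frames L" "q \<in> V" by (rule frame_at)
  show ?thesis by (simp add: jet_quotient_map_def jet_restrict_jet_of[OF S U V q s])
qed

lemma jq_in: "z \<in> C \<Longrightarrow> jq z \<in> jets_over R S"
proof -
  assume "z \<in> C"
  then obtain q s where z: "z = (q, jet_of L q s)" "q \<in> S" "s \<in> sections L" by (rule C_E)
  have "jet_of R q (restrict_section S s) \<in> jet_space R q"
    by (rule R.jet_of_mem[OF _ restrict_section_in[OF S z(3)]]) (simp add: z(2))
  then show ?thesis using z by (simp add: jq_jet_of jets_over_iff)
qed

lemma jq_image: "jq ` C = pts (jet_mfd R)"
proof (intro equalityI subsetI)
  fix y assume "y \<in> jq ` C"
  then show "y \<in> pts (jet_mfd R)" using jq_in by auto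
next
  fix y assume "y \<in> pts (jet_mfd R)"
  then obtain q \<beta> where y: "y = (q, \<beta>)" "q \<in> S" "\<beta> \<in> jet_space R q" by (auto simp: jets_over_def)
  have "induces_quotient_iso L K S q (jet_restrict L K S q)" by (rule jet_restrict_quotient[OF S y(2)])
  then have "jet_restrict L K S q ` jet_space L q = jet_space R q"
    unfolding induces_quotient_iso_def by blast
  then obtain \<alpha> where \<alpha>: "\<alpha> \<in> jet_space L q" "\<beta> = jet_restrict L K S q \<alpha>" using y(3) by auto
  have "y = jq (q, \<alpha>)" using y(1) \<alpha>(2) by (simp add: jet_quotient_map_def)
  moreover have "(q, \<alpha>) \<in> C" using y(2) \<alpha>(1) by (simp add: jets_over_def)
  ultimately show "y \<in> jq ` C" by (rule image_eqI)
qed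

text \<open>The first jet coordinate is the base chart and the fibre coordinates are unrestricted on
  \<open>C\<close>, so slice charts for \<open>S\<close> yield slice charts for
  \<open>C\<close>.\<close>

lemma jet_slice:
  assumes U: "(U, \<phi>) \<in> slice_charts M K S" and V: "(V, e) \<in> frames L"
  shows "(jets_over L (U \<inter> V), jet_coords L U \<phi> e) \<in> slice_charts (jet_mfd L) KK C"
proof -
  have Uc: "(U, \<phi>) \<in> charts M" by (rule slice_chart[OF S U])
  have im: "\<phi> ` (U \<inter> V \<inter> S) = \<phi> ` (U \<inter> V) \<inter> span K" using slice_chart_iff[OF S U] by auto
  have "jet_coords L U \<phi> e ` (jets_over L (U \<inter> V) \<inter> C) = \<phi> ` (U \<inter> V \<inter> S) \<times> UNIV \<times> E"
    unfolding jets_over_Int by (rule JC_image[OF Uc V]) auto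
  also have "\<dots> = (\<phi> ` (U \<inter> V) \<times> UNIV \<times> E) \<inter> span KK" unfolding im span_KK by auto
  also have "\<dots> = jet_coords L U \<phi> e ` jets_over L (U \<inter> V) \<inter> span KK"
    by (simp only: JC_image[OF Uc V subset_refl])
  finally show ?thesis using jet_chart[OF Uc V] by (simp add: slice_charts_def)
qed

lemma jet_embedded: "embedded_submanifold (jet_mfd L) KK C"
  unfolding embedded_submanifold_def
proof (intro conjI subsetI)
  show "x \<in> model (jet_mfd L)" if "x \<in> KK" for x
    using that K_subset[OF S] by (auto simp: jet_model_def)
  show "x \<in> pts (jet_mfd L)" if "x \<in> C" for x
    using that S_subset[OF S] by (auto simp: jets_over_def)
  fix z assume z: "z \<in> C"
  then have q: "fst z \<in> S" "fst z \<in> pts M" using S_subset[OF S] by (auto simp: jets_over_def)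
  obtain U \<phi> where U: "(U, \<phi>) \<in> slice_charts M K S" "fst z \<in> U" using slice_chart_at[OF S q(1)] .
  obtain V e where V: "(V, e) \<in> frames L" "fst z \<in> V" using frame_at[OF q(2)] .
  have "z \<in> jets_over L (U \<inter> V)" using z U V by (auto simp: jets_over_def)
  then show "z \<in> (\<Union>c\<in>slice_charts (jet_mfd L) KK C. fst c)"
    using jet_slice[OF U(1) V(1)] by force
qed

lemma atlas_mfd_NC: "atlas_mfd NC"
  by (rule atlas_mfd.atlas_mfd_submfd[OF atlas_mfd_jet jet_embedded])

interpretation NC: atlas_mfd NC by (rule atlas_mfd_NC)

context
  fixes U \<phi> V e assumes U: "(U, \<phi>) \<in> slice_charts M K S" and V: "(V, e) \<in> frames L"
begin

abbreviation "D \<equiv> jets_over L (U \<inter> V)"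
abbreviation "\<Phi> \<equiv> jet_coords L U \<phi> e"
abbreviation "DR \<equiv> jets_over R (U \<inter> S \<inter> (S \<inter> V))"
abbreviation "\<Phi>R \<equiv> jet_coords R (U \<inter> S) \<phi> e"

lemma adapted_charts:
  shows "(U, \<phi>) \<in> charts M" "(U \<inter> S, \<phi>) \<in> charts (base R)" "(S \<inter> V, e) \<in> frames R"
    "(D, \<Phi>) \<in> charts (jet_mfd L)" "(DR, \<Phi>R) \<in> charts (jet_mfd R)" "(D \<inter> C, \<Phi>) \<in> charts NC"
proof -
  show Uc: "(U, \<phi>) \<in> charts M" by (rule slice_chart[OF S U])
  show US: "(U \<inter> S, \<phi>) \<in> charts (base R)" using slice_chart_restrict[OF S U] by simp
  show VS: "(S \<inter> V, e) \<in> frames R" by (rule frame_restrict[OF S V])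
  show "(D, \<Phi>) \<in> charts (jet_mfd L)" by (rule jet_chart[OF Uc V])
  show "(DR, \<Phi>R) \<in> charts (jet_mfd R)" by (rule R.jet_chart[OF US VS])
  show "(D \<inter> C, \<Phi>) \<in> charts NC"
    by (rule atlas_mfd.slice_chart_restrict[OF atlas_mfd_jet jet_embedded jet_slice[OF U V]])
qed

lemma jq_coords:
  assumes z: "z \<in> D \<inter> C"
  shows "jq z \<in> DR" "\<Phi>R (jq z) = jet_proj K (\<Phi> z)"
proof -
  obtain q s where zq: "z = (q, jet_of L q s)" "q \<in> S" "s \<in> sections L" using C_E z by blast
  have q: "q \<in> U" "q \<in> V" using z zq(1) by (auto simp: jets_over_def)
  let ?r = "restrict_section S s"
  have r: "?r \<in> sections R" by (rule restrict_section_in[OF S zq(3)])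
  have jz: "jq z = (q, jet_of R q ?r)" using zq by (simp add: jq_jet_of)
  show "jq z \<in> DR" using jq_in[of z] z q zq jz by (auto simp: jets_over_iff)
  have "\<Phi>R (jq z) = (\<phi> q, coef (e q) (?r q), grad (model (base R)) (U \<inter> S) \<phi> (\<lambda>y. coef (e y) (?r y)) q)"
    unfolding jz using q zq(2) by (intro R.JC_eq[OF adapted_charts(2,3) _ r]) auto
  also have "grad (model (base R)) (U \<inter> S) \<phi> (\<lambda>y. coef (e y) (?r y)) q = proj K (gradM U \<phi> (loc e s) q)"
    using jgrad_restrict[OF S U q(1) V q(2) zq(2) zq(3)] by simp
  also have "?r q = s q" using zq(2) by (simp add: restrict_section_def)
  finally show "\<Phi>R (jq z) = jet_proj K (\<Phi> z)"
    using JC_eq[OF adapted_charts(1) V _ zq(3), of q] q zq(1) by (simp add: jet_proj_def)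
qed

lemma jq_smooth_at:
  assumes z: "z \<in> D \<inter> C" shows "smooth_map_at NC (jet_mfd R) jq z"
proof -
  have "smooth_at NC (\<lambda>y. jet_proj K (\<Phi> y)) z"
    by (rule NC.smooth_at_linear[OF bounded_linear_jet_proj NC.smooth_at_chart[OF adapted_charts(6) z]])
  then have "smooth_at NC (\<lambda>y. \<Phi>R (jq y)) z"
    by (rule NC.smooth_at_cong[OF _ NC.openin_chart[OF adapted_charts(6)] z]) (simp only: jq_coords)
  moreover have "jq ` (D \<inter> C) \<subseteq> DR" using jq_coords(1) by blast
  ultimately show ?thesis
    unfolding smooth_map_at_def using adapted_charts(5) NC.openin_chart[OF adapted_charts(6)] z by blast
qed

text \<open>The chain rule for the linear map \<open>jet_proj K\<close>. A function pulled back
  along \<open>z\<close> is constant in the dropped fibre directions, so these components of the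
  gradient vanish; along the remaining basis vectors \<open>jet_proj K\<close> is the
  identity.\<close>

lemma grad_jq:
  assumes z: "z \<in> D \<inter> C" and f: "smooth_at (jet_mfd R) f (jq z)"
  shows "grad KK (D \<inter> C) \<Phi> (\<lambda>y. f (jq y)) z = grad (jet_model K K) DR \<Phi>R f (jq z)"
proof -
  interpret JR: atlas_mfd "jet_mfd R" by (rule R.atlas_mfd_jet)
  obtain O' G W where 1: "open O'" "Cinf O' G" "openin JR.T W" "jq z \<in> W" "W \<subseteq> DR" "\<Phi>R ` W \<subseteq> O'"
    "\<And>y. y \<in> W \<Longrightarrow> f y = G (\<Phi>R y)"
    using JR.smooth_atE[OF f adapted_charts(5) jq_coords(1)[OF z]] by metis
  obtain W' where W': "openin NC.T W'" "z \<in> W'" "jq ` W' \<subseteq> W"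
    using smooth_map_at_preimage[OF atlas_mfd_NC R.atlas_mfd_jet jq_smooth_at[OF z] 1(3,4)] by metis
  let ?P = "jet_proj K" and ?G' = "frechet_derivative G (at (\<Phi>R (jq z)))"
  let ?W = "W' \<inter> (D \<inter> C)"
  have W: "openin NC.T ?W" by (rule openin_Int[OF W'(1) NC.openin_chart[OF adapted_charts(6)]])
  have o: "open (?P -` O')"
    by (rule open_vimage[OF 1(1) linear_continuous_on[OF bounded_linear_jet_proj]])
  have c: "Cinf (?P -` O') (\<lambda>p. G (?P p))"
    by (rule Cinf_compose[OF o Cinf_linear[OF o bounded_linear_jet_proj] 1(2)]) auto
  have zW: "z \<in> ?W" using W'(2) z by simp
  have inO: "\<Phi> ` ?W \<subseteq> ?P -` O'"
  proof (rule image_subsetI)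
    fix y assume y: "y \<in> ?W"
    then have "\<Phi>R (jq y) \<in> O'" using 1(6) W'(3) by auto
    then show "\<Phi> y \<in> ?P -` O'" using jq_coords(2)[of y] y by simp
  qed
  have fG: "f (jq y) = G (?P (\<Phi> y))" if "y \<in> ?W" for y
    using 1(7)[of "jq y"] W'(3) jq_coords(2)[of y] that by auto
  have Pz: "\<Phi>R (jq z) = ?P (\<Phi> z)" by (rule jq_coords(2)[OF z])
  have G: "(G has_derivative ?G') (at (?P (\<Phi> z)))"
    unfolding Pz[symmetric] by (rule Cinf_has_derivative[OF 1(2)]) (use 1(4,6) in blast)
  have part: "partial (D \<inter> C) \<Phi> b (\<lambda>y. f (jq y)) z = ?G' (?P b)" if b: "b \<in> KK" for b
  proof -
    have "partial (D \<inter> C) \<Phi> b (\<lambda>y. f (jq y)) z = frechet_derivative (\<lambda>p. G (?P p)) (at (\<Phi> z)) b"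
      by (rule NC.partial_eq[OF adapted_charts(6) W zW _ inO o c fG]) (use b in auto)
    also have "\<dots> = ?G' (?P b)"
      by (rule fun_cong[OF frechet_derivative_at[OF
            has_derivative_compose[OF bounded_linear_imp_has_derivative[OF bounded_linear_jet_proj] G], symmetric]])
    finally show ?thesis .
  qed
  have gE: "grad (jet_model K K) DR \<Phi>R f (jq z) \<in> span (jet_model K K)" by (rule grad_in_span)
  show ?thesis
  proof (rule NC.grad_eqI[simplified])
    have "jet_model K K \<subseteq> KK" using K_subset[OF S] by (auto simp: jet_model_def)
    then show "grad (jet_model K K) DR \<Phi>R f (jq z) \<in> span KK" using gE span_mono by blast
    fix b assume b: "b \<in> KK"
    consider "b \<in> jet_model K K" "?P b = b" | "b \<notin> jet_model K K" "b \<in> Basis" "?P b = 0"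
      using jet_proj_Basis[OF K_subset[OF S] model_Basis b] by blast
    then show "partial (D \<inter> C) \<Phi> b (\<lambda>y. f (jq y)) z = grad (jet_model K K) DR \<Phi>R f (jq z) \<bullet> b"
    proof cases
      case 1
      then have bm: "b \<in> model (jet_mfd R)" by simp
      have "partial DR \<Phi>R b f (jq z) = ?G' b"
        by (rule JR.partial_eq[OF adapted_charts(5) \<open>openin JR.T W\<close> \<open>jq z \<in> W\<close> \<open>W \<subseteq> DR\<close> \<open>\<Phi>R ` W \<subseteq> O'\<close>
              \<open>open O'\<close> \<open>Cinf O' G\<close> \<open>\<And>y. y \<in> W \<Longrightarrow> f y = G (\<Phi>R y)\<close> bm])
      then show ?thesis
        using part[OF b] 1 JR.grad_inner[OF bm, of DR \<Phi>R f "jq z"] by simp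
    next
      case 2
      have "grad (jet_model K K) DR \<Phi>R f (jq z) \<bullet> b = 0"
        by (rule span_Basis_subset_inner[OF jet_model_Basis[OF K_Basis[OF S] K_Basis[OF S]] gE 2(2,1)])
      then show ?thesis using part[OF b] 2 linear_0[OF has_derivative_linear[OF G]] by simp
    qed
  qed
qed

text \<open>A derivation with symbol in \<open>span K\<close> differentiates along \<open>S\<close>
  only, so on \<open>S\<close> it can be computed from the restricted section.\<close>

lemma local_der_restrict:
  assumes W: "W \<subseteq> U \<inter> V" and w: "w \<in> span K" and s: "s \<in> sections L"
  shows "restrict_section S (local_der L U \<phi> W \<rho> e k w s) =
    local_der R (U \<inter> S) \<phi> (W \<inter> S) (\<lambda>y. if y \<in> S then \<rho> y else 0) e k w (restrict_section S s)"
proof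
  fix y
  show "restrict_section S (local_der L U \<phi> W \<rho> e k w s) y =
    local_der R (U \<inter> S) \<phi> (W \<inter> S) (\<lambda>y. if y \<in> S then \<rho> y else 0) e k w (restrict_section S s) y"
  proof (cases "y \<in> W \<inter> S")
    case True
    then have y: "y \<in> U" "y \<in> V" "y \<in> S" "y \<in> W" using W by auto
    have "grad K (U \<inter> S) \<phi> (\<lambda>y. coef (e y) (restrict_section S s y)) y = proj K (gradM U \<phi> (loc e s) y)"
      by (rule jgrad_restrict[OF S U y(1) V y(2) y(3) s])
    moreover have "w \<bullet> proj K (gradM U \<phi> (loc e s) y) = w \<bullet> gradM U \<phi> (loc e s) y"
      using proj_inner[OF K_Basis[OF S] w] by (simp add: inner_commute[of w])
    moreover have "restrict_section S s y = s y" using y(3) by (simp add: restrict_section_def)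
    ultimately show ?thesis
      using s restrict_section_in[OF S s] True
      by (simp add: local_der_def frame_section_def restrict_section_def[of S "frame_section _ _ _ _"])
  next
    case False
    then show ?thesis
      using s restrict_section_in[OF S s]
      by (auto simp: local_der_def frame_section_def restrict_section_def[of S "frame_section _ _ _ _"])
  qed
qed

end

section \<open>Coisotropy and the comparison of brackets\<close>

interpretation JL: hausdorff_lbundle "jet_lbundle L" by (rule hausdorff_lbundle_jet)

lemma jet_lbundle_frame: "(V, e) \<in> frames L \<Longrightarrow> (jets_over L V, e \<circ> fst) \<in> frames (jet_lbundle L)"
  unfolding jet_lbundle_simps(3) by force

abbreviation "test_section U \<phi> W \<rho> e k w t \<equiv>
  (\<lambda>z. linear_section L (local_der L U \<phi> W \<rho> e k w) z + lift_section L t z)"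

abbreviation "jet_gradient U \<phi> V e s z \<equiv> grad (model (jet_mfd L)) (D U V) (\<Phi> U \<phi> e) (\<lambda>y. coef ((e \<circ> fst) y) (s y)) z"

abbreviation "restrict_fun \<rho> \<equiv> (\<lambda>y. if y \<in> S then \<rho> y else (0 :: real))"

abbreviation "test_section_R U \<phi> W \<rho> e k w t \<equiv>
  (\<lambda>z. linear_section R (local_der R (U \<inter> S) \<phi> (W \<inter> S) (restrict_fun \<rho>) e k w) z + lift_section R t z)"

abbreviation "jet_gradient_R U \<phi> V e s z \<equiv>
  grad (model (jet_mfd R)) (DR U V) (\<Phi>R U \<phi> e) (\<lambda>y. coef ((e \<circ> fst) y) (s y)) z"

lemma sharp_annihilator:
  assumes J: "canonical_jacobi L J" and z: "z \<in> C"
  shows "sharp (jet_lbundle L) J z ` annihilator (jet_lbundle L) KK C z \<subseteq> sub_der_space (jet_lbundle L) KK C z"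
proof (rule image_subsetI)
  fix \<nu> assume \<nu>: "\<nu> \<in> annihilator (jet_lbundle L) KK C z"
  have js: "jacobi_structure (jet_lbundle L) J" using J by (simp add: canonical_jacobi_def)
  obtain q \<alpha> where zq: "z = (q, \<alpha>)" by fastforce
  have q: "q \<in> S" "q \<in> pts M" and zp: "z \<in> pts (jet_mfd L)"
    using z S_subset[OF S] by (auto simp: zq jets_over_def)
  have \<alpha>: "\<alpha> \<in> jet_space L q" using z by (simp add: zq jets_over_iff)
  obtain U \<phi> where U: "(U, \<phi>) \<in> slice_charts M K S" "q \<in> U" using slice_chart_at[OF S q(1)] .
  obtain V e where V: "(V, e) \<in> frames L" "q \<in> V" using frame_at[OF q(2)] .
  have Uc: "(U, \<phi>) \<in> charts M" by (rule slice_chart[OF S U(1)])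
  have zD: "z \<in> D U V" "z \<in> jets_over L V" using z U V by (auto simp: zq jets_over_def)
  have Dc: "(D U V, \<Phi> U \<phi> e) \<in> charts (base (jet_lbundle L))"
    using adapted_charts(4)[OF U(1) V(1)] by simp
  have Ds: "(D U V, \<Phi> U \<phi> e) \<in> slice_charts (base (jet_lbundle L)) KK C"
    using jet_slice[OF U(1) V(1)] by simp
  have emb: "embedded_submanifold (base (jet_lbundle L)) KK C" using jet_embedded by simp
  have V': "(jets_over L V, e \<circ> fst) \<in> frames (jet_lbundle L)" by (rule jet_lbundle_frame[OF V(1)])
  have sub: "sub_der_space (jet_lbundle L) KK C z =
      {der_comb (jet_lbundle L) (D U V) (\<Phi> U \<phi> e) (e \<circ> fst) z k w |k w. w \<in> span KK}"
    by (rule JL.sub_der_space_comb[OF emb Ds zD(1) V' zD(2) z])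
  have \<nu>j: "\<nu> \<in> jet_space (jet_lbundle L) z"
    and \<nu>0: "\<And>a. a \<in> sub_der_space (jet_lbundle L) KK C z \<Longrightarrow> \<nu> a = 0"
    using \<nu> by (auto simp: annihilator_def)
  let ?N = "section_of_jet (jet_lbundle L) z \<nu>"
  note N = JL.section_of_jet[OF Dc zD(1) V' zD(2) \<nu>j]
  let ?c = "coef ((e \<circ> fst) z) (?N z)" and ?g = "jet_gradient U \<phi> V e ?N z"
  have e0: "(e \<circ> fst) z \<noteq> 0" using JL.frame_nz[OF V' zD(2)] .
  have kill: "k * ?c + w \<bullet> ?g = 0" if w: "w \<in> span KK" for k w
  proof -
    let ?d = "der_comb (jet_lbundle L) (D U V) (\<Phi> U \<phi> e) (e \<circ> fst) z k w"
    have "?d \<in> sub_der_space (jet_lbundle L) KK C z" unfolding sub using w by blast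
    then have "\<nu> ?d = 0" by (rule \<nu>0)
    moreover have "\<nu> ?d = ?d ?N"
      using fun_cong[OF N(2), of ?d] JL.der_comb_in[OF Dc zD(1) V' zD(2), of k w] by (simp add: jet_of_def)
    ultimately show ?thesis using N(1) e0 by (simp add: der_comb_def)
  qed
  have c0: "?c = 0" using kill[of 0 1] by (simp add: span_zero)
  have gE: "?g \<in> span (model (jet_mfd L))" by (rule grad_in_span)
  obtain g1 k g3 where g: "?g = (g1, k, g3)" by (rule prod_cases3)
  have "(g1, k, g3) \<in> span (model (jet_mfd L))" using gE unfolding g .
  then have "(g1, k, g3) \<in> E \<times> UNIV \<times> E"
    unfolding jet_mfd_simps span_jet_model[OF model_Basis model_Basis] .
  then have gE': "g1 \<in> E" "g3 \<in> E" by simp_all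
  \<comment> \<open>All fibre directions are tangent to \<open>C\<close>, so the fibre part of the
    gradient may be tested against itself; a sum of squares equal to 0 results, and only the base
    part \<open>g1\<close> survives.\<close>
  have "(0, k, g3) \<in> span KK" using gE' by (simp add: span_KK span_zero)
  from kill[OF this, of 0] have "k * k + g3 \<bullet> g3 = 0" unfolding g by simp
  then have kg: "k = 0" "g3 = 0"
    by (simp_all add: add_nonneg_eq_0_iff)
  obtain W \<rho> W1 where W: "cutoff M W \<rho>" "W \<subseteq> U \<inter> V" "openin T W1" "q \<in> W1" "W1 \<subseteq> W"
    "\<And>y. y \<in> W1 \<Longrightarrow> \<rho> y = 1"
    using cutoff_at[OF Uc U(2) V] by metis
  have fz: "fst z = q" by (simp add: zq)
  \<comment> \<open>With \<open>k = 0\<close> and \<open>w = 0\<close> the linear part is zero and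
    \<open>X w\<close> is the pull-back of \<open>T' w\<close>. It is kept in the form of a test
    section so that \<open>test_section_jet\<close> and \<open>canonical_bracket\<close>
    apply.\<close>
  define T' where "T' w = frame_section W \<rho> e
      (\<lambda>y. (0 - (0, 0) \<bullet> snd (\<Phi> U \<phi> e z)) + w \<bullet> (\<phi> y - \<phi> q))" for w
  define X where "X w = test_section U \<phi> W \<rho> e 0 0 (T' w)" for w
  have T': "T' w \<in> sections L" for w
    unfolding T'_def by (rule test_section_jet(1)[OF Uc V(1) W zp fz])
  have X: "X w \<in> sections (jet_lbundle L)" for w
    unfolding X_def T'_def by (rule test_section_jet(2)[OF Uc V(1) W zp fz])
  have Xc: "coef ((e \<circ> fst) z) (X w z) = 0" for w
    unfolding X_def T'_def by (rule test_section_jet(3)[OF Uc V(1) W zp fz])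
  have Xg: "jet_gradient U \<phi> V e (X w) z = (w, 0, 0)" if "w \<in> E" for w
    unfolding X_def T'_def by (rule test_section_jet(4)[OF Uc V(1) W zp fz that span_zero])
  have XX: "J (X v) (X w) z = 0" for v w
  proof -
    let ?A = "local_der L U \<phi> W \<rho> e 0 0"
    have A: "?A \<in> derivations L" "linear_section L ?A \<in> sections (jet_lbundle L)"
      by (rule local_der_in[OF W(1) Uc V(1) W(2)], rule linear_local_der_in[OF Uc V(1) W(1,2)])
    have "J (X v) (X w) (q, \<alpha>) = \<alpha> (\<lambda>s. commutator ?A ?A s q) + ?A (T' w) q - ?A (T' v) q"
      unfolding X_def by (rule canonical_bracket[OF J A A T' T']) (use zp zq in simp)
    also have "\<dots> = 0" using jet_zero[OF \<alpha> q(2)] by (simp add: local_der_00 commutator_def)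
    finally show ?thesis by (simp add: zq)
  qed
  have JN: "J ?N r z = J (X g1) r z" if r: "r \<in> sections (jet_lbundle L)" for r
  proof (rule JL.bracket_jets[OF js Dc zD(1) V' zD(2) N(1) X _ _ r r refl refl])
    show "?c = coef ((e \<circ> fst) z) (X g1 z)" unfolding c0 Xc ..
    have "?g = jet_gradient U \<phi> V e (X g1) z" unfolding Xg[OF gE'(1)] g kg ..
    then show "grad (model (base (jet_lbundle L))) (D U V) (\<Phi> U \<phi> e) (\<lambda>y. coef ((e \<circ> fst) y) (?N y)) z =
        grad (model (base (jet_lbundle L))) (D U V) (\<Phi> U \<phi> e) (\<lambda>y. coef ((e \<circ> fst) y) (X g1 y)) z"
      unfolding jet_lbundle_base .
  qed
  have fib: "J (X g1) r z \<in> fibre (jet_lbundle L) z" if "r \<in> sections (jet_lbundle L)" for r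
    by (rule JL.section_fibre[OF JL.bracket_section[OF js X that]]) (use zp in simp)
  obtain k' w where w: "w \<in> JL.E" and Jw: "\<And>r. r \<in> sections (jet_lbundle L) \<Longrightarrow>
      J (X g1) r z = der_comb (jet_lbundle L) (D U V) (\<Phi> U \<phi> e) (e \<circ> fst) z k' w r"
    by (rule JL.first_order_der_comb[OF Dc zD(1) V' zD(2) JL.bracket_first_order(1)[OF js X] fib]) blast+
  \<comment> \<open>Only the base directions transverse to \<open>S\<close> have to be excluded.
    Bracketing with the pulled back section \<open>X b\<close>, whose gradient is
    \<open>(b, 0, 0)\<close>, reads off the component of the symbol in direction \<open>b\<close>,
    and this bracket is 0.\<close>
  have "w \<in> span KK"
    unfolding span_Basis_subset_iff[OF KK_Basis]
  proof
    fix c assume c: "c \<in> Basis - KK"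
    show "w \<bullet> c = 0"
    proof (cases "c \<in> model (jet_mfd L)")
      case True
      then obtain b where b: "b \<in> model M" "c = (b, 0, 0)" using c by (auto simp: jet_model_def)
      have bE: "b \<in> E" using b(1) by (rule span_base)
      have "der_comb (jet_lbundle L) (D U V) (\<Phi> U \<phi> e) (e \<circ> fst) z k' w (X b) = 0"
        using Jw[OF X] XX by simp
      then show ?thesis using Xc[of b] Xg[OF bE] X e0 b(2) by (simp add: der_comb_def)
    next
      case False
      then show ?thesis
        using span_Basis_subset_inner[OF JL.model_Basis w, of c] c by simp
    qed
  qed
  moreover have "sharp (jet_lbundle L) J z \<nu> = der_comb (jet_lbundle L) (D U V) (\<Phi> U \<phi> e) (e \<circ> fst) z k' w"
  proof
    fix r
    show "sharp (jet_lbundle L) J z \<nu> r = der_comb (jet_lbundle L) (D U V) (\<Phi> U \<phi> e) (e \<circ> fst) z k' w r"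
      using JN Jw by (cases "r \<in> sections (jet_lbundle L)") (simp_all add: sharp_def der_comb_def)
  qed
  ultimately show "sharp (jet_lbundle L) J z \<nu> \<in> sub_der_space (jet_lbundle L) KK C z"
    unfolding sub by blast
qed

text \<open>Equality on \<open>C\<close> says that the gradient of \<open>s1\<close> at
  \<open>jq z\<close> is the projection to \<open>span KK\<close> of the gradient of
  \<open>S1\<close> at \<open>z\<close>. All fibre directions belong to \<open>KK\<close>, so the
  fibre parts \<open>(k, g3)\<close> agree, and \<open>g3\<close> lies in \<open>span K\<close> as
  part of a gradient over \<open>S\<close>. The same \<open>k\<close> and \<open>w = g3\<close> thus
  serve on both sides; \<open>t\<close> carries the whole base part \<open>g1\<close>, and
  \<open>r\<close> its projection \<open>h1\<close>.\<close>

lemma test_section_realize: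
  assumes U: "(U, \<phi>) \<in> slice_charts M K S" and V: "(V, e) \<in> frames L"
    and W: "cutoff M W \<rho>" "W \<subseteq> U \<inter> V" "openin T W1" "q \<in> W1" "W1 \<subseteq> W" "\<And>y. y \<in> W1 \<Longrightarrow> \<rho> y = 1"
    and z: "z \<in> C" "fst z = q"
    and S1: "S1 \<in> sections (jet_lbundle L)" and s1: "s1 \<in> sections (jet_lbundle R)"
    and rel: "\<And>y. y \<in> C \<Longrightarrow> S1 y = s1 (jq y)"
  obtains k w t r where "w \<in> span K" "t \<in> sections L" "r \<in> sections R" "restrict_section S t = r"
    "test_section U \<phi> W \<rho> e k w t \<in> sections (jet_lbundle L)"
    "coef ((e \<circ> fst) z) (S1 z) = coef ((e \<circ> fst) z) (test_section U \<phi> W \<rho> e k w t z)"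
    "jet_gradient U \<phi> V e S1 z = jet_gradient U \<phi> V e (test_section U \<phi> W \<rho> e k w t) z"
    "test_section_R U \<phi> W \<rho> e k w r \<in> sections (jet_lbundle R)"
    "coef ((e \<circ> fst) (jq z)) (s1 (jq z)) = coef ((e \<circ> fst) (jq z)) (test_section_R U \<phi> W \<rho> e k w r (jq z))"
    "jet_gradient_R U \<phi> V e s1 (jq z) = jet_gradient_R U \<phi> V e (test_section_R U \<phi> W \<rho> e k w r) (jq z)"
proof -
  interpret JR: hausdorff_lbundle "jet_lbundle R" by (rule R.hausdorff_lbundle_jet)
  note ch = adapted_charts[OF U V]
  have q: "q \<in> S" "q \<in> U" "q \<in> V" "q \<in> W" using z W by (auto simp: jets_over_def)
  have zp: "z \<in> pts (jet_mfd L)" using z S_subset[OF S] by (auto simp: jets_over_def)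
  have jzp: "jq z \<in> pts (jet_mfd R)" using jq_in[OF z(1)] by simp
  have zD: "z \<in> D U V" "z \<in> jets_over L V" using z q by (auto simp: jets_over_def)
  have zDC: "z \<in> D U V \<inter> C" using zD z by simp
  have jzD: "jq z \<in> DR U V" by (rule jq_coords(1)[OF U V zDC])
  have fjz: "fst (jq z) = q" using z(2) by simp
  have V': "(jets_over L V, e \<circ> fst) \<in> frames (jet_lbundle L)" by (rule jet_lbundle_frame[OF V])
  have VR: "(jets_over R (S \<inter> V), e \<circ> fst) \<in> frames (jet_lbundle R)"
    unfolding R.jet_lbundle_simps(3) using ch(3) by force
  have jzV: "jq z \<in> jets_over R (S \<inter> V)" using jzD by (auto simp: jets_over_def)
  let ?f = "\<lambda>y. coef ((e \<circ> fst) y) (s1 y)"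
  have smS: "smooth_at (jet_mfd L) (\<lambda>y. coef ((e \<circ> fst) y) (S1 y)) z"
    using JL.section_smooth_at[OF S1 V' zD(2)] by simp
  have sms: "smooth_at (jet_mfd R) ?f (jq z)"
    using JR.section_smooth_at[OF s1 VR jzV] by simp
  define c where "c = coef ((e \<circ> fst) z) (S1 z)"
  have cs: "coef ((e \<circ> fst) (jq z)) (s1 (jq z)) = c" using rel[OF z(1)] by (simp add: c_def)
  obtain g1 k g3 where g: "jet_gradient U \<phi> V e S1 z = (g1, k, g3)" by (rule prod_cases3)
  obtain h1 k' h3 where h: "jet_gradient_R U \<phi> V e s1 (jq z) = (h1, k', h3)" by (rule prod_cases3)
  have "(g1, k, g3) \<in> span (model (jet_mfd L))" unfolding g[symmetric] by (rule grad_in_span)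
  then have "(g1, k, g3) \<in> E \<times> UNIV \<times> E"
    unfolding jet_mfd_simps span_jet_model[OF model_Basis model_Basis] .
  then have gE: "g1 \<in> E" "g3 \<in> E" by simp_all
  have "(h1, k', h3) \<in> span (model (jet_mfd R))" unfolding h[symmetric] by (rule grad_in_span)
  then have "(h1, k', h3) \<in> span K \<times> UNIV \<times> span K"
    unfolding jet_mfd_simps restrict_bundle_simps submfd_simps
      span_jet_model[OF K_Basis[OF S] K_Basis[OF S]] .
  then have hK: "h1 \<in> span K" "h3 \<in> span K" by simp_all
  have "grad KK (D U V \<inter> C) (\<Phi> U \<phi> e) (\<lambda>y. ?f (jq y)) z = (h1, k', h3)"
    using grad_jq[OF U V zDC sms] h by simp
  moreover have "grad KK (D U V \<inter> C) (\<Phi> U \<phi> e) (\<lambda>y. ?f (jq y)) z = proj KK (jet_gradient U \<phi> V e S1 z)"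
    by (rule atlas_mfd.grad_restrict[OF atlas_mfd_jet jet_embedded smS z(1) _ jet_slice[OF U V] zD(1)])
      (simp add: rel)
  ultimately have hg: "proj KK (g1, k, g3) = (h1, k', h3)" using g by simp
  have inn: "(h1, k', h3) \<bullet> v = (g1, k, g3) \<bullet> v" if "v \<in> span KK" for v
    using proj_inner[OF KK_Basis that, of "(g1, k, g3)"] unfolding hg .
  have hE: "h3 \<in> E" using hK span_mono[OF K_subset[OF S]] by auto
  \<comment> \<open>Testing with the difference of the fibre parts itself makes a sum of squares
    vanish.\<close>
  have "(0, k' - k, h3 - g3) \<in> span KK" using hE gE by (simp add: span_KK span_zero span_diff)
  from inn[OF this] have "(k' - k) * (k' - k) + (h3 - g3) \<bullet> (h3 - g3) = 0"
    by (simp add: inner_diff_left inner_diff_right algebra_simps)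
  then have "(k' - k) * (k' - k) = 0 \<and> (h3 - g3) \<bullet> (h3 - g3) = 0"
    by (simp only: add_nonneg_eq_0_iff[OF zero_le_square inner_ge_zero])
  then have kk: "k' = k" "h3 = g3" by simp_all
  have g3K: "g3 \<in> span K" using hK kk by simp
  have h1: "h1 \<bullet> v = g1 \<bullet> v" if "v \<in> span K" for v
  proof -
    have "(v, 0, 0) \<in> span KK" using that by (simp add: span_KK span_zero)
    from inn[OF this] show ?thesis by simp
  qed
  define t where "t = frame_section W \<rho> e
    (\<lambda>y. (c - (k, g3) \<bullet> snd (\<Phi> U \<phi> e z)) + g1 \<bullet> (\<phi> y - \<phi> q))"
  define r where "r = frame_section (W \<inter> S) (restrict_fun \<rho>) e
    (\<lambda>y. (c - (k, g3) \<bullet> snd (\<Phi>R U \<phi> e (jq z))) + h1 \<bullet> (\<phi> y - \<phi> q))"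
  have WR: "cutoff (base R) (W \<inter> S) (restrict_fun \<rho>)" "W \<inter> S \<subseteq> U \<inter> S \<inter> (S \<inter> V)"
    "openin (mfd_topology (base R)) (W1 \<inter> S)" "q \<in> W1 \<inter> S" "W1 \<inter> S \<subseteq> W \<inter> S"
    "\<And>y. y \<in> W1 \<inter> S \<Longrightarrow> restrict_fun \<rho> y = 1"
    using cutoff_restrict[OF S W(1)] openin_restrict[OF S W(3)] W(2,4,5,6) q(1) by auto
  have gR: "h1 \<in> R.E" "g3 \<in> R.E" using hK g3K by simp_all
  note tL = test_section_jet[OF ch(1) V W zp z(2), where c = c and k = k and w = g3 and v = g1, folded t_def]
  note tR = R.test_section_jet[OF ch(2,3) WR jzp fjz, where c = c and k = k and w = g3 and v = h1, folded r_def]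
  have "snd (\<Phi>R U \<phi> e (jq z)) = (fst (snd (\<Phi> U \<phi> e z)), proj K (snd (snd (\<Phi> U \<phi> e z))))"
    unfolding jq_coords(2)[OF U V zDC] by (simp add: jet_proj_def)
  \<comment> \<open>The constants in \<open>t\<close> and \<open>r\<close> agree, because
    \<open>g3\<close> is orthogonal to the transverse derivatives that \<open>jq\<close>
    drops.\<close>
  then have sndeq: "(k, g3) \<bullet> snd (\<Phi>R U \<phi> e (jq z)) = (k, g3) \<bullet> snd (\<Phi> U \<phi> e z)"
    using proj_inner[OF K_Basis[OF S] g3K] by (simp add: inner_prod_def inner_commute[of g3])
  have tr: "restrict_section S t = r"
  proof
    fix y
    show "restrict_section S t y = r y"
    proof (cases "y \<in> W \<inter> S")
      case True
      then have "y \<in> U" "y \<in> S" using W(2) by auto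
      \<comment> \<open>Displacements along \<open>S\<close> lie in \<open>span K\<close> in a slice
        chart, and there \<open>g1\<close> and \<open>h1\<close> have the same pairing.\<close>
      then have "\<phi> y - \<phi> q \<in> span K" using slice_chart_iff[OF S U] q by (simp add: span_diff)
      then show ?thesis
        using True h1 sndeq by (simp add: restrict_section_def t_def r_def frame_section_def)
    next
      case False
      then show ?thesis by (auto simp: restrict_section_def t_def r_def frame_section_def)
    qed
  qed
  have tL1: "t \<in> sections L" by (rule tL(1))
  have tL2: "test_section U \<phi> W \<rho> e k g3 t \<in> sections (jet_lbundle L)" by (rule tL(2))
  have tL3: "coef ((e \<circ> fst) z) (test_section U \<phi> W \<rho> e k g3 t z) = c" by (rule tL(3))
  have tL4: "jet_gradient U \<phi> V e (test_section U \<phi> W \<rho> e k g3 t) z = (g1, k, g3)"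
    by (rule tL(4)[OF _ gE])
  have tR1: "r \<in> sections R" by (rule tR(1))
  have tR2: "test_section_R U \<phi> W \<rho> e k g3 r \<in> sections (jet_lbundle R)" by (rule tR(2))
  have tR3: "coef ((e \<circ> fst) (jq z)) (test_section_R U \<phi> W \<rho> e k g3 r (jq z)) = c" by (rule tR(3))
  have tR4: "jet_gradient_R U \<phi> V e (test_section_R U \<phi> W \<rho> e k g3 r) (jq z) = (h1, k, g3)"
    by (rule tR(4)[OF _ gR])
  show thesis
  proof (rule that[OF g3K tL1 tR1 tr tL2 _ _ tR2])
    show "coef ((e \<circ> fst) z) (S1 z) = coef ((e \<circ> fst) z) (test_section U \<phi> W \<rho> e k g3 t z)"
      unfolding tL3 c_def ..
    show "jet_gradient U \<phi> V e S1 z = jet_gradient U \<phi> V e (test_section U \<phi> W \<rho> e k g3 t) z"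
      unfolding tL4 g ..
    show "coef ((e \<circ> fst) (jq z)) (s1 (jq z)) = coef ((e \<circ> fst) (jq z)) (test_section_R U \<phi> W \<rho> e k g3 r (jq z))"
      unfolding tR3 cs ..
    show "jet_gradient_R U \<phi> V e s1 (jq z) = jet_gradient_R U \<phi> V e (test_section_R U \<phi> W \<rho> e k g3 r) (jq z)"
      unfolding tR4 h kk ..
  qed
qed

text \<open>Both brackets are replaced by the explicit ones of test sections. The terms without
  commutator agree at \<open>q\<close> because the derivations and the sections restrict. The
  commutator terms agree because \<open>push_der\<close> takes the commutator over \<open>S\<close>
  to the one over \<open>M\<close>, and the jet at \<open>jq z\<close> is \<open>\<alpha>\<close>
  restricted along \<open>push_der\<close>.\<close>

lemma bracket_reduces:
  assumes J: "canonical_jacobi L J" and JR: "canonical_jacobi R JR"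
    and z: "z \<in> C"
    and S1: "S1 \<in> sections (jet_lbundle L)" and s1: "s1 \<in> sections (jet_lbundle R)"
    and rel1: "\<And>y. y \<in> C \<Longrightarrow> S1 y = s1 (jq y)"
    and S2: "S2 \<in> sections (jet_lbundle L)" and s2: "s2 \<in> sections (jet_lbundle R)"
    and rel2: "\<And>y. y \<in> C \<Longrightarrow> S2 y = s2 (jq y)"
  shows "JR s1 s2 (jq z) = J S1 S2 z"
proof -
  interpret JR: hausdorff_lbundle "jet_lbundle R" by (rule R.hausdorff_lbundle_jet)
  have js: "jacobi_structure (jet_lbundle L) J" "jacobi_structure (jet_lbundle R) JR"
    using J JR by (simp_all add: canonical_jacobi_def)
  obtain q \<alpha> where zq: "z = (q, \<alpha>)" by fastforce
  have q: "q \<in> S" "q \<in> pts M" and zp: "z \<in> pts (jet_mfd L)"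
    using z S_subset[OF S] by (auto simp: zq jets_over_def)
  obtain U \<phi> where U: "(U, \<phi>) \<in> slice_charts M K S" "q \<in> U" using slice_chart_at[OF S q(1)] .
  obtain V e where V: "(V, e) \<in> frames L" "q \<in> V" using frame_at[OF q(2)] .
  note ch = adapted_charts[OF U(1) V(1)]
  obtain W \<rho> W1 where W: "cutoff M W \<rho>" "W \<subseteq> U \<inter> V" "openin T W1" "q \<in> W1" "W1 \<subseteq> W"
    "\<And>y. y \<in> W1 \<Longrightarrow> \<rho> y = 1"
    using cutoff_at[OF ch(1) U(2) V] by metis
  have fz: "fst z = q" by (simp add: zq)
  have qW: "q \<in> W" "q \<in> W \<inter> S" using W q by auto
  have zDC: "z \<in> D U V \<inter> C" using z U V by (auto simp: zq jets_over_def)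
  have zD: "z \<in> D U V" "z \<in> jets_over L V" using zDC by (auto simp: jets_over_def)
  have jzD: "jq z \<in> DR U V" by (rule jq_coords(1)[OF U(1) V(1) zDC])
  have jzV: "jq z \<in> jets_over R (S \<inter> V)" using jzD by (auto simp: jets_over_def)
  have V': "(jets_over L V, e \<circ> fst) \<in> frames (jet_lbundle L)" by (rule jet_lbundle_frame[OF V(1)])
  have VR: "(jets_over R (S \<inter> V), e \<circ> fst) \<in> frames (jet_lbundle R)"
    unfolding R.jet_lbundle_simps(3) using ch(3) by force
  have Dc: "(D U V, \<Phi> U \<phi> e) \<in> charts (base (jet_lbundle L))" using ch(4) by simp
  have DRc: "(DR U V, \<Phi>R U \<phi> e) \<in> charts (base (jet_lbundle R))" using ch(5) by simp
  obtain k1 w1 t1 r1 where 1: "w1 \<in> span K" "t1 \<in> sections L" "r1 \<in> sections R" "restrict_section S t1 = r1"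
    "test_section U \<phi> W \<rho> e k1 w1 t1 \<in> sections (jet_lbundle L)"
    "coef ((e \<circ> fst) z) (S1 z) = coef ((e \<circ> fst) z) (test_section U \<phi> W \<rho> e k1 w1 t1 z)"
    "jet_gradient U \<phi> V e S1 z = jet_gradient U \<phi> V e (test_section U \<phi> W \<rho> e k1 w1 t1) z"
    "test_section_R U \<phi> W \<rho> e k1 w1 r1 \<in> sections (jet_lbundle R)"
    "coef ((e \<circ> fst) (jq z)) (s1 (jq z)) = coef ((e \<circ> fst) (jq z)) (test_section_R U \<phi> W \<rho> e k1 w1 r1 (jq z))"
    "jet_gradient_R U \<phi> V e s1 (jq z) = jet_gradient_R U \<phi> V e (test_section_R U \<phi> W \<rho> e k1 w1 r1) (jq z)"
    by (rule test_section_realize[OF U(1) V(1) W z fz S1 s1 rel1]) blast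
  obtain k2 w2 t2 r2 where 2: "w2 \<in> span K" "t2 \<in> sections L" "r2 \<in> sections R" "restrict_section S t2 = r2"
    "test_section U \<phi> W \<rho> e k2 w2 t2 \<in> sections (jet_lbundle L)"
    "coef ((e \<circ> fst) z) (S2 z) = coef ((e \<circ> fst) z) (test_section U \<phi> W \<rho> e k2 w2 t2 z)"
    "jet_gradient U \<phi> V e S2 z = jet_gradient U \<phi> V e (test_section U \<phi> W \<rho> e k2 w2 t2) z"
    "test_section_R U \<phi> W \<rho> e k2 w2 r2 \<in> sections (jet_lbundle R)"
    "coef ((e \<circ> fst) (jq z)) (s2 (jq z)) = coef ((e \<circ> fst) (jq z)) (test_section_R U \<phi> W \<rho> e k2 w2 r2 (jq z))"
    "jet_gradient_R U \<phi> V e s2 (jq z) = jet_gradient_R U \<phi> V e (test_section_R U \<phi> W \<rho> e k2 w2 r2) (jq z)"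
    by (rule test_section_realize[OF U(1) V(1) W z fz S2 s2 rel2]) blast
  define A1 where "A1 = local_der L U \<phi> W \<rho> e k1 w1"
  define A2 where "A2 = local_der L U \<phi> W \<rho> e k2 w2"
  define a1 where "a1 = local_der R (U \<inter> S) \<phi> (W \<inter> S) (restrict_fun \<rho>) e k1 w1"
  define a2 where "a2 = local_der R (U \<inter> S) \<phi> (W \<inter> S) (restrict_fun \<rho>) e k2 w2"
  have WR: "cutoff (base R) (W \<inter> S) (restrict_fun \<rho>)" "W \<inter> S \<subseteq> U \<inter> S \<inter> (S \<inter> V)"
    using cutoff_restrict[OF S W(1)] W(2) by auto
  have A: "A1 \<in> derivations L" "linear_section L A1 \<in> sections (jet_lbundle L)"
    "A2 \<in> derivations L" "linear_section L A2 \<in> sections (jet_lbundle L)"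
    unfolding A1_def A2_def
    by (rule local_der_in[OF W(1) ch(1) V(1) W(2)] linear_local_der_in[OF ch(1) V(1) W(1,2)])+
  have a: "a1 \<in> derivations R" "linear_section R a1 \<in> sections (jet_lbundle R)"
    "a2 \<in> derivations R" "linear_section R a2 \<in> sections (jet_lbundle R)"
    unfolding a1_def a2_def
    by (rule R.local_der_in[OF WR(1) ch(2,3) WR(2)] R.linear_local_der_in[OF ch(2,3) WR])+
  have res1: "restrict_section S (A1 s) = a1 (restrict_section S s)" if "s \<in> sections L" for s
    unfolding A1_def a1_def by (rule local_der_restrict[OF U(1) V(1) W(2) 1(1) that])
  have res2: "restrict_section S (A2 s) = a2 (restrict_section S s)" if "s \<in> sections L" for s
    unfolding A2_def a2_def by (rule local_der_restrict[OF U(1) V(1) W(2) 2(1) that])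
  have As: "A1 s \<in> sections L" "A2 s \<in> sections L" if "s \<in> sections L" for s
    using A that by (simp_all add: derivations_def)
  have at: "s q = restrict_section S s q" for s :: "'m \<Rightarrow> 'v" using q(1) by (simp add: restrict_section_def)
  let ?\<beta> = "jet_restrict L K S q \<alpha>"
  have jz: "jq z = (q, ?\<beta>)" by (simp add: zq jet_quotient_map_def)
  have "J S1 S2 z = J (test_section U \<phi> W \<rho> e k1 w1 t1) (test_section U \<phi> W \<rho> e k2 w2 t2) z"
    by (rule JL.bracket_jets[OF js(1) Dc zD(1) V' zD(2) S1 1(5,6) _ S2 2(5,6)]) (use 1(7) 2(7) in simp_all)
  also have "\<dots> = \<alpha> (\<lambda>s. commutator A1 A2 s q) + A1 t2 q - A2 t1 q"
    unfolding zq A1_def[symmetric] A2_def[symmetric]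
    by (rule canonical_bracket[OF J A 1(2) 2(2)]) (use zp zq in simp)
  finally have JL: "J S1 S2 z = \<alpha> (\<lambda>s. commutator A1 A2 s q) + A1 t2 q - A2 t1 q" .
  have "JR s1 s2 (jq z) = JR (test_section_R U \<phi> W \<rho> e k1 w1 r1) (test_section_R U \<phi> W \<rho> e k2 w2 r2) (jq z)"
    by (rule JR.bracket_jets[OF js(2) DRc jzD VR jzV s1 1(8,9) _ s2 2(8,9)]) (use 1(10) 2(10) in simp_all)
  also have "\<dots> = ?\<beta> (\<lambda>s. commutator a1 a2 s q) + a1 r2 q - a2 r1 q"
    unfolding jz a1_def[symmetric] a2_def[symmetric]
    by (rule R.canonical_bracket[OF JR a 1(3) 2(3)]) (use jq_in[OF z] jz in simp)
  finally have JRR: "JR s1 s2 (jq z) = ?\<beta> (\<lambda>s. commutator a1 a2 s q) + a1 r2 q - a2 r1 q" .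
  have e1: "A1 t2 q = a1 r2 q" unfolding at[of "A1 t2"] res1[OF 2(2)] 2(4) ..
  have e2: "A2 t1 q = a2 r1 q" unfolding at[of "A2 t1"] res2[OF 1(2)] 1(4) ..
  \<comment> \<open>\<open>jet_restrict\<close> is 0 off \<open>D_qL_S\<close> by convention, so
    membership must be known before the restricted jet can be evaluated.\<close>
  have cin: "(\<lambda>s. commutator a1 a2 s q) \<in> der_space R q"
    unfolding a1_def a2_def by (rule R.commutator_in[OF WR(1) ch(2,3) WR(2) qW(2)])
  have "push_der L S (\<lambda>s. commutator a1 a2 s q) = (\<lambda>s. commutator A1 A2 s q)"
  proof
    fix s
    show "push_der L S (\<lambda>s. commutator a1 a2 s q) s = commutator A1 A2 s q"
    proof (cases "s \<in> sections L")
      case True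
      have "A1 (A2 s) q = a1 (a2 (restrict_section S s)) q"
        unfolding at[of "A1 (A2 s)"] res1[OF As(2)[OF True]] res2[OF True] ..
      moreover have "A2 (A1 s) q = a2 (a1 (restrict_section S s)) q"
        unfolding at[of "A2 (A1 s)"] res2[OF As(1)[OF True]] res1[OF True] ..
      ultimately show ?thesis using True by (simp add: push_der_def commutator_def)
    next
      \<comment> \<open>Off the sections \<open>push_der\<close> is 0 by convention; the commutator
        is 0 there because local derivations are, and because they also kill the zero
        section.\<close>
      case False
      then have "A1 s = (\<lambda>y. 0)" "A2 s = (\<lambda>y. 0)" by (simp_all add: A1_def A2_def local_der_def)
      moreover have "A1 (\<lambda>y. 0) = (\<lambda>y. 0)" "A2 (\<lambda>y. 0) = (\<lambda>y. 0)"
        unfolding A1_def A2_def by (rule local_der_zero[OF W(1) ch(1) V(1) W(2)])+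
      ultimately show ?thesis using False by (simp add: push_der_def commutator_def)
    qed
  qed
  then have "?\<beta> (\<lambda>s. commutator a1 a2 s q) = \<alpha> (\<lambda>s. commutator A1 A2 s q)"
    using cin by (simp add: jet_restrict_def)
  then show ?thesis unfolding JL JRR e1 e2 by simp
qed

section \<open>The submersion factor over \<open>z\<close>\<close>

lemma jq_smooth:
  assumes "z \<in> C" shows "smooth_map_at NC (jet_mfd R) jq z"
    and "\<exists>U \<phi> V e. (U, \<phi>) \<in> slice_charts M K S \<and> (V, e) \<in> frames L \<and> z \<in> D U V \<inter> C"
proof -
  have q: "fst z \<in> S" "fst z \<in> pts M" using assms S_subset[OF S] by (auto simp: jets_over_def)
  obtain U \<phi> where U: "(U, \<phi>) \<in> slice_charts M K S" "fst z \<in> U" using slice_chart_at[OF S q(1)] .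
  obtain V e where V: "(V, e) \<in> frames L" "fst z \<in> V" using frame_at[OF q(2)] .
  have zD: "z \<in> D U V \<inter> C" using assms U V by (auto simp: jets_over_def)
  show "smooth_map_at NC (jet_mfd R) jq z" by (rule jq_smooth_at[OF U(1) V(1) zD])
  show "\<exists>U \<phi> V e. (U, \<phi>) \<in> slice_charts M K S \<and> (V, e) \<in> frames L \<and> z \<in> D U V \<inter> C"
    using U V zD by blast
qed

text \<open>In adapted charts tangent vectors are pairings of gradients with a coordinate vector
  \<open>w\<close>, and by \<open>grad_jq\<close> the differential keeps \<open>w\<close>.
  Surjectivity is then immediate; dropped components of \<open>w\<close> meet gradients that vanish
  in these directions.\<close>

lemma jq_submersion: "submersion NC (jet_mfd R) jq"
  unfolding submersion_def
proof (intro conjI ballI)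
  interpret JR: hausdorff_mfd "jet_mfd R" by (rule R.hausdorff_mfd_jet)
  interpret NH: hausdorff_mfd NC by (rule hausdorff_mfd.hausdorff_mfd_submfd[OF hausdorff_mfd_jet jet_embedded])
  show "smooth_map NC (jet_mfd R) jq"
    by (rule smooth_map_atI[OF atlas_mfd_NC R.atlas_mfd_jet jq_smooth(1)]) simp
  fix z assume "z \<in> pts NC"
  then have z: "z \<in> C" by simp
  obtain U \<phi> V e where U: "(U, \<phi>) \<in> slice_charts M K S" and V: "(V, e) \<in> frames L" and zD: "z \<in> D U V \<inter> C"
    using jq_smooth(2)[OF z] by blast
  note ch = adapted_charts[OF U V]
  have jz: "jq z \<in> DR U V" by (rule jq_coords(1)[OF U V zD])
  have pull: "(\<lambda>y. if y \<in> pts NC then f (jq y) else 0) \<in> smooth_functions NC"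
    if f: "f \<in> smooth_functions (jet_mfd R)" for f
  proof -
    have "smooth_at NC (\<lambda>y. if y \<in> pts NC then f (jq y) else 0) y" if y: "y \<in> pts NC" for y
    proof -
      have yC: "y \<in> C" using y by simp
      have "smooth_at (jet_mfd R) f (jq y)"
        by (rule JR.smooth_functions_smooth_at[OF f]) (use jq_in[OF yC] in simp)
      from smooth_at_pullback[OF atlas_mfd_NC R.atlas_mfd_jet jq_smooth(1)[OF yC] this]
      show ?thesis by (rule NC.smooth_at_cong[OF _ NC.openin_pts y]) simp
    qed
    then show ?thesis by (simp add: NC.smooth_functions_iff)
  qed
  have diff: "differential NC (jet_mfd R) jq (tangent_comb NC (D U V \<inter> C) (\<Phi> U \<phi> e) z w) =
      tangent_comb (jet_mfd R) (DR U V) (\<Phi>R U \<phi> e) (jq z) w" for w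
  proof
    fix f
    show "differential NC (jet_mfd R) jq (tangent_comb NC (D U V \<inter> C) (\<Phi> U \<phi> e) z w) f =
      tangent_comb (jet_mfd R) (DR U V) (\<Phi>R U \<phi> e) (jq z) w f"
    proof (cases "f \<in> smooth_functions (jet_mfd R)")
      case True
      have sm: "smooth_at (jet_mfd R) f (jq z)"
        by (rule JR.smooth_functions_smooth_at[OF True]) (use jq_in[OF z] in simp)
      have zN: "z \<in> pts NC" using z by simp
      have "grad (model NC) (D U V \<inter> C) (\<Phi> U \<phi> e) (\<lambda>y. if y \<in> pts NC then f (jq y) else 0) z =
          grad (model NC) (D U V \<inter> C) (\<Phi> U \<phi> e) (\<lambda>y. f (jq y)) z"
        by (rule NC.grad_cong[OF ch(6) zD smooth_at_pullback[OF atlas_mfd_NC R.atlas_mfd_jet jq_smooth(1)[OF z] sm]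
              NC.openin_pts zN]) simp
      also have "\<dots> = grad (model (jet_mfd R)) (DR U V) (\<Phi>R U \<phi> e) f (jq z)"
        using grad_jq[OF U V zD sm] by simp
      finally show ?thesis
        using True pull[OF True] by (simp add: differential_def tangent_comb_def)
    next
      case False
      then show ?thesis by (simp add: differential_def tangent_comb_def)
    qed
  qed
  show "differential NC (jet_mfd R) jq ` tangent_space NC z = tangent_space (jet_mfd R) (jq z)"
  proof (intro equalityI subsetI)
    fix u assume "u \<in> differential NC (jet_mfd R) jq ` tangent_space NC z"
    then obtain v where v: "v \<in> tangent_space NC z" "u = differential NC (jet_mfd R) jq v" by blast
    obtain w where "v = tangent_comb NC (D U V \<inter> C) (\<Phi> U \<phi> e) z w"
      using NH.tangent_space_comb[OF ch(6) zD v(1)] by metis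
    then show "u \<in> tangent_space (jet_mfd R) (jq z)"
      using v(2) diff JR.tangent_comb_in[OF ch(5) jz] by simp
  next
    fix u assume "u \<in> tangent_space (jet_mfd R) (jq z)"
    then obtain w where "u = tangent_comb (jet_mfd R) (DR U V) (\<Phi>R U \<phi> e) (jq z) w"
      using JR.tangent_space_comb[OF ch(5) jz] by metis
    then have "u = differential NC (jet_mfd R) jq (tangent_comb NC (D U V \<inter> C) (\<Phi> U \<phi> e) z w)"
      using diff by simp
    then show "u \<in> differential NC (jet_mfd R) jq ` tangent_space NC z"
      using NH.tangent_comb_in[OF ch(6) zD] by (rule image_eqI)
  qed
qed

text \<open>The identity is admissible on fibres because \<open>jq\<close> preserves the base point
  and both bundles are pulled back from \<open>L\<close>. In frames it is given by the frame
  transitions of \<open>L\<close>, composed with the projection of jets to the base.\<close>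

lemma jq_factor:
  "factor (restrict_bundle (jet_lbundle L) KK C) (jet_lbundle R) jq (\<lambda>z v. v)"
  unfolding factor_def
proof (intro conjI)
  show "smooth_map (base (restrict_bundle (jet_lbundle L) KK C)) (base (jet_lbundle R)) jq"
    using jq_submersion by (simp add: submersion_def)
  show "\<forall>z\<in>pts (base (restrict_bundle (jet_lbundle L) KK C)).
      (\<forall>u\<in>fibre (restrict_bundle (jet_lbundle L) KK C) z. \<forall>v\<in>fibre (restrict_bundle (jet_lbundle L) KK C) z. u + v = u + v) \<and>
      (\<forall>c. \<forall>u\<in>fibre (restrict_bundle (jet_lbundle L) KK C) z. c *\<^sub>R u = c *\<^sub>R u) \<and>
      bij_betw (\<lambda>v. v) (fibre (restrict_bundle (jet_lbundle L) KK C) z) (fibre (jet_lbundle R) (jq z))"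
    by (simp add: bij_betw_def)
  show "\<forall>(U, e)\<in>frames (restrict_bundle (jet_lbundle L) KK C). \<forall>(V, e')\<in>frames (jet_lbundle R).
      smooth_fun_on (base (restrict_bundle (jet_lbundle L) KK C)) (U \<inter> jq -` V) (\<lambda>z. coef (e' (jq z)) (e z))"
  proof (clarify)
    fix U e V e' assume "(U, e) \<in> frames (restrict_bundle (jet_lbundle L) KK C)" "(V, e') \<in> frames (jet_lbundle R)"
    then obtain U0 e0 V0 e0' where *: "(U0, e0) \<in> frames L" "U = C \<inter> jets_over L U0" "e = e0 \<circ> fst"
      "(V0, e0') \<in> frames L" "V = jets_over R (S \<inter> V0)" "e' = e0' \<circ> fst"
      by (auto simp: jet_lbundle_simps(3) R.jet_lbundle_simps(3))
    have "smooth_fun_on NC (U \<inter> jq -` V) (\<lambda>z. coef (e0' (fst z)) (e0 (fst z)))"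
    proof (rule NC.smooth_fun_onI)
      show "U \<inter> jq -` V \<subseteq> pts NC" using *(2) by auto
      fix z assume z: "z \<in> U \<inter> jq -` V"
      have zC: "z \<in> C" and zU: "fst z \<in> U0" using z *(2) by (auto simp: jets_over_def)
      have "fst (jq z) \<in> V0" using z *(5) by (auto simp: jets_over_def simp del: fst_jet_quotient_map)
      then have zV: "fst z \<in> V0" by simp
      have zp: "z \<in> pts (jet_mfd L)" using zC S_subset[OF S] by (auto simp: jets_over_def)
      have "smooth_at (jet_mfd L) (\<lambda>z. coef (e0' (fst z)) (e0 (fst z))) z"
        by (rule smooth_at_fst[where f = "\<lambda>x. coef (e0' x) (e0 x)", OF zp transition_smooth_at[OF *(4,1) zV zU]])
      then show "smooth_at NC (\<lambda>z. coef (e0' (fst z)) (e0 (fst z))) z"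
        by (rule atlas_mfd.smooth_at_restrict[OF atlas_mfd_jet jet_embedded _ zC]) simp
    qed
    then show "smooth_fun_on (base (restrict_bundle (jet_lbundle L) KK C)) (U \<inter> jq -` V) (\<lambda>z. coef (e' (jq z)) (e z))"
      using *(3,6) by simp
  qed
qed

lemma jq_pullback:
  assumes "s \<in> sections (jet_lbundle R)"
  shows "factor_pullback (restrict_bundle (jet_lbundle L) KK C) jq (\<lambda>z v. v) s = (\<lambda>z. if z \<in> C then s (jq z) else 0)"
proof
  fix z
  interpret JR: hausdorff_lbundle "jet_lbundle R" by (rule R.hausdorff_lbundle_jet)
  show "factor_pullback (restrict_bundle (jet_lbundle L) KK C) jq (\<lambda>z v. v) s z = (if z \<in> C then s (jq z) else 0)"
  proof (cases "z \<in> C")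
    case True
    have "s (jq z) \<in> fibre (jet_lbundle R) (jq z)"
      by (rule JR.section_fibre[OF assms]) (use jq_in[OF True] in simp)
    then have "s (jq z) \<in> fibre L (fst z)" by simp
    then have "inv_into (fibre L (fst z)) (\<lambda>v. v) (s (jq z)) = s (jq z)"
      by (intro inv_into_f_f) auto
    then show ?thesis using True by (simp add: factor_pullback_def)
  next
    case False
    then show ?thesis by (simp add: factor_pullback_def)
  qed
qed

lemma jet_reduction:
  assumes J: "canonical_jacobi L J" and JR: "canonical_jacobi R JR"
  shows "jacobi_reduces (jet_lbundle L) J KK C jq (\<lambda>z v. v) (jet_lbundle R) JR"
  unfolding jacobi_reduces_def
proof (intro ballI impI, elim conjE)
  interpret JR: hausdorff_lbundle "jet_lbundle R" by (rule R.hausdorff_lbundle_jet)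
  fix s1 s2 S1 S2
  assume s: "s1 \<in> sections (jet_lbundle R)" "s2 \<in> sections (jet_lbundle R)"
    "S1 \<in> sections (jet_lbundle L)" "S2 \<in> sections (jet_lbundle L)"
    and e1: "factor_pullback (restrict_bundle (jet_lbundle L) KK C) jq (\<lambda>z v. v) s1 = restrict_section C S1"
    and e2: "factor_pullback (restrict_bundle (jet_lbundle L) KK C) jq (\<lambda>z v. v) s2 = restrict_section C S2"
  have r1: "S1 y = s1 (jq y)" if "y \<in> C" for y
    using fun_cong[OF e1, of y] that unfolding jq_pullback[OF s(1)] by (simp add: restrict_section_def)
  have r2: "S2 y = s2 (jq y)" if "y \<in> C" for y
    using fun_cong[OF e2, of y] that unfolding jq_pullback[OF s(2)] by (simp add: restrict_section_def)
  have js: "jacobi_structure (jet_lbundle R) JR" using JR by (simp add: canonical_jacobi_def)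
  have br: "JR s1 s2 (jq z) = J S1 S2 z" if "z \<in> C" for z
    by (rule bracket_reduces[OF J JR that s(3,1) r1 s(4,2) r2])
  show "factor_pullback (restrict_bundle (jet_lbundle L) KK C) jq (\<lambda>z v. v) (JR s1 s2) = restrict_section C (J S1 S2)"
    unfolding jq_pullback[OF JR.bracket_section[OF js s(1,2)]] restrict_section_def
    by (rule ext) (simp add: br)
qed

end

end

theorem proposition4p3p5:
  fixes L :: "('q, 'e::euclidean_space, 'v::real_vector) lbundle"
    and K :: "'e set" and S :: "'q set"
    and J JS :: "('q \<times> ('q, 'v) jet \<Rightarrow> 'v) \<Rightarrow> ('q \<times> ('q, 'v) jet \<Rightarrow> 'v) \<Rightarrow> 'q \<times> ('q, 'v) jet \<Rightarrow> 'v"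
  assumes "line_bundle L"
    and "embedded_submanifold (base L) K S"
    and "canonical_jacobi L J"
    and "canonical_jacobi (restrict_bundle L K S) JS"
  shows "coisotropic (jet_lbundle L) J (jet_model K (model (base L))) (jets_over L S) \<and>
    (\<forall>q\<in>S. induces_quotient_iso L K S q (jet_restrict L K S q)) \<and>
    jet_quotient_map L K S ` jets_over L S = pts (jet_mfd (restrict_bundle L K S)) \<and>
    (\<exists>\<zeta>. submersion_factor
           (restrict_bundle (jet_lbundle L) (jet_model K (model (base L))) (jets_over L S))
           (jet_lbundle (restrict_bundle L K S)) (jet_quotient_map L K S) \<zeta> \<and>
         jacobi_reduces (jet_lbundle L) J (jet_model K (model (base L))) (jets_over L S)
           (jet_quotient_map L K S) \<zeta> (jet_lbundle (restrict_bundle L K S)) JS)"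
proof -
  interpret hausdorff_lbundle L by (rule line_bundle_hausdorff_lbundle[OF assms(1)])
  note S = assms(2)
  have "coisotropic (jet_lbundle L) J (jet_model K (model (base L))) (jets_over L S)"
    unfolding coisotropic_def
    using jet_embedded[OF S] sharp_annihilator[OF S assms(3)] by simp
  moreover have "submersion_factor
      (restrict_bundle (jet_lbundle L) (jet_model K (model (base L))) (jets_over L S))
      (jet_lbundle (restrict_bundle L K S)) (jet_quotient_map L K S) (\<lambda>z v. v)"
    unfolding submersion_factor_def using jq_factor[OF S] jq_submersion[OF S] by simp
  ultimately show ?thesis
    using jet_restrict_quotient[OF S] jq_image[OF S] jet_reduction[OF S assms(3,4)] by blast
qed

end
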